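(* Let $(V_N)_{N\ge1}$ be the random sequence of unitary matrices, with $V_N\in U(N)$ Haar distributed, constructed on a common probability space by the recursive construction described in the context, and let $Z_N=\det(I_N-V_N)$. Then, almost surely, $$\limsup_{N\to\infty}\frac{\operatorname{Re}\log Z_N}{\sqrt{\log N\,\log\log\log N}}=1 \qquad\text{and}\qquad \limsup_{N\to\infty}\frac{\operatorname{Im}\log Z_N}{\sqrt{\log N\,\log\log\log N}}=1 .$$
   Context: Definition of the logarithm: if $e^{\mathrm{i}\theta_1},\dots,e^{\mathrm{i}\theta_N}$ are the eigenvalues of $V_N$, then $\log Z_N:=\sum_{n=1}^N\log(1-e^{\mathrm{i}\theta_n})$ with the branch $\operatorname{Im}\log(1-e^{\mathrm{i}\theta_n})\in(-\pi/2,\pi/2]$ (defined almost surely). Coupling of the different dimensions: let $\mathscr{S}_{\mathbb{C}}^k=\{c\in\mathbb{C}^k:\ |c_1|^2+\dots+|c_k|^2=1\}$ with uniform probability measure $\nu_k$, and let $(m^{(k)})_{k\ge1}$ be a random element of $\mathscr{S}_{\mathbb{C}}^1\times\mathscr{S}_{\mathbb{C}}^2\times\mathscr{S}_{\mathbb{C}}^3\times\cdots$ with the product law $\nu_1\times\nu_2\times\nu_3\times\cdots$. For each $k$ let $M^{(k)}\in U(k)$ be the (almost surely well-defined) unitary reflection that maps $e_1=(1,0,\dots,0)^T$ to $m^{(k)}$ and is the identity on the hyperplane orthogonal to $m^{(k)}-e_1$; explicitly, with $v=m^{(k)}-e_1$, $M^{(k)}=I_k-\frac{1}{1-\overline{m^{(k)}_1}}\,v\,\overline{v}^T$.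 Set $V_1=M^{(1)}$ and, for $N\ge1$, $$V_{N+1}=M^{(N+1)}\begin{pmatrix}1&0\\0&V_N\end{pmatrix}.$$ Then each $V_N$ is Haar distributed on $U(N)$, and "almost surely" refers to the joint law of the sequence $(V_N)_{N\ge1}$. *)

theory Defs
  imports "HOL-Probability.Probability" "Jordan_Normal_Form.Char_Poly"
begin

(* The vector (c_1, ..., c_k) is the extensional function c on {..<k} with c_(i+1) = c i. *)

definition sphere_cplx :: "nat \<Rightarrow> (nat \<Rightarrow> complex) set" where
  "sphere_cplx k = {c \<in> {..<k} \<rightarrow>\<^sub>E UNIV. (\<Sum>i<k. (cmod (c i))\<^sup>2) = 1}"

definition cball_cplx :: "nat \<Rightarrow> (nat \<Rightarrow> complex) set" where
  "cball_cplx k = {c \<in> {..<k} \<rightarrow>\<^sub>E UNIV. (\<Sum>i<k. (cmod (c i))\<^sup>2) \<le> 1}"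

definition normalize_cplx :: "nat \<Rightarrow> (nat \<Rightarrow> complex) \<Rightarrow> nat \<Rightarrow> complex" where
  "normalize_cplx k c = (\<lambda>i\<in>{..<k}. c i / complex_of_real (sqrt (\<Sum>j<k. (cmod (c j))\<^sup>2)))"

(* Normalized surface measure as cone measure: a set A of unit vectors has measure
   vol {x. |x| \<le> 1 and x/|x| \<in> A} / vol {x. |x| \<le> 1}, with vol the Lebesgue measure on C^k.
   For k \<ge> 1 the restriction only discards the null set of the vector 0. *)
definition sphere_measure :: "nat \<Rightarrow> (nat \<Rightarrow> complex) measure" where
  "sphere_measure k =
     restrict_space
       (distr (uniform_measure (Pi\<^sub>M {..<k} (\<lambda>_. lborel)) (cball_cplx k))
              (Pi\<^sub>M {..<k} (\<lambda>_. borel)) (normalize_cplx k))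
       (sphere_cplx k)"

lemma sets_cball_cplx: "cball_cplx k \<in> sets (Pi\<^sub>M {..<k} (\<lambda>_. borel))"
proof -
  have "{c \<in> space (Pi\<^sub>M {..<k} (\<lambda>_. borel)). (\<Sum>i<k. (cmod (c i))\<^sup>2) \<le> 1}
          \<in> sets (Pi\<^sub>M {..<k} (\<lambda>_. borel))"
    by measurable
  then show ?thesis by (simp add: cball_cplx_def space_PiM)
qed

lemma sets_sphere_cplx: "sphere_cplx k \<in> sets (Pi\<^sub>M {..<k} (\<lambda>_. borel))"
proof -
  have "{c \<in> space (Pi\<^sub>M {..<k} (\<lambda>_. borel)). (\<Sum>i<k. (cmod (c i))\<^sup>2) = 1}
          \<in> sets (Pi\<^sub>M {..<k} (\<lambda>_. borel))"
    by measurable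
  then show ?thesis by (simp add: sphere_cplx_def space_PiM)
qed

lemma sets_PiM_lborel [measurable_cong]:
  "sets (Pi\<^sub>M {..<k} (\<lambda>_. lborel)) = sets (Pi\<^sub>M {..<k} (\<lambda>_. borel))"
  by (intro sets_PiM_cong) auto

lemma measurable_normalize_cplx [measurable]:
  "normalize_cplx k \<in> Pi\<^sub>M {..<k} (\<lambda>_. borel) \<rightarrow>\<^sub>M Pi\<^sub>M {..<k} (\<lambda>_. borel)"
  unfolding normalize_cplx_def by measurable

lemma space_sphere_measure: "space (sphere_measure k) = sphere_cplx k"
  by (auto simp: sphere_measure_def space_restrict_space sphere_cplx_def space_PiM)

lemma emeasure_PiM_lborel:
  fixes A :: "nat \<Rightarrow> complex set"
  assumes "\<And>i. i < k \<Longrightarrow> A i \<in> sets borel"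
  shows "emeasure (Pi\<^sub>M {..<k} (\<lambda>_. lborel)) (Pi\<^sub>E {..<k} A) = (\<Prod>i<k. emeasure lborel (A i))"
proof -
  interpret product_sigma_finite "\<lambda>_::nat. lborel :: complex measure"
    by standard
  show ?thesis using assms by (intro emeasure_PiM) auto
qed

lemma emeasure_cball_cplx:
  "emeasure (Pi\<^sub>M {..<k} (\<lambda>_. lborel)) (cball_cplx k) \<noteq> 0"
  "emeasure (Pi\<^sub>M {..<k} (\<lambda>_. lborel)) (cball_cplx k) \<noteq> \<infinity>"
proof -
  let ?L = "Pi\<^sub>M {..<k} (\<lambda>_. lborel :: complex measure)"
  define r :: real where "r = (if k = 0 then 1 else 1 / real k)"
  have r: "r > 0" by (simp add: r_def)
  have sub1: "Pi\<^sub>E {..<k} (\<lambda>_. cball 0 r) \<subseteq> cball_cplx k"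
  proof
    fix c :: "nat \<Rightarrow> complex" assume c: "c \<in> Pi\<^sub>E {..<k} (\<lambda>_. cball 0 r)"
    have "(\<Sum>i<k. (cmod (c i))\<^sup>2) \<le> (\<Sum>i<k. r\<^sup>2)"
      using c by (intro sum_mono power_mono) (auto simp: PiE_iff)
    also have "\<dots> \<le> 1"
      by (auto simp: r_def power2_eq_square field_simps)
    finally show "c \<in> cball_cplx k" using c by (auto simp: cball_cplx_def PiE_iff)
  qed
  have pos: "emeasure lborel (cball (0::complex) r) \<noteq> 0"
    using r by (simp add: emeasure_cball unit_ball_vol_pos less_imp_neq ennreal_eq_0_iff)
       (metis unit_ball_vol_pos not_le mult_pos_pos zero_less_power zero_le_numeral)
  have "(\<Prod>i<k. emeasure lborel (cball (0::complex) r)) \<noteq> 0"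
    using pos by simp
  then have "emeasure ?L (Pi\<^sub>E {..<k} (\<lambda>_. cball 0 r)) \<noteq> 0"
    by (subst emeasure_PiM_lborel) auto
  moreover have "emeasure ?L (Pi\<^sub>E {..<k} (\<lambda>_. cball 0 r)) \<le> emeasure ?L (cball_cplx k)"
    using sub1 by (intro emeasure_mono) (simp_all add: sets_cball_cplx sets_PiM_lborel)
  ultimately show "emeasure ?L (cball_cplx k) \<noteq> 0" by auto
  have sub2: "cball_cplx k \<subseteq> Pi\<^sub>E {..<k} (\<lambda>_. cball 0 1)"
  proof
    fix c assume c: "c \<in> cball_cplx k"
    have "cmod (c i) \<le> 1" if "i < k" for i
    proof -
      have "(cmod (c i))\<^sup>2 \<le> (\<Sum>i<k. (cmod (c i))\<^sup>2)"
        using that by (intro member_le_sum) auto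
      also have "\<dots> \<le> 1" using c by (simp add: cball_cplx_def)
      finally show ?thesis by (simp add: power_le_one_iff abs_square_le_1)
    qed
    then show "c \<in> Pi\<^sub>E {..<k} (\<lambda>_. cball 0 1)"
      using c by (auto simp: cball_cplx_def PiE_iff)
  qed
  have "emeasure ?L (cball_cplx k) \<le> emeasure ?L (Pi\<^sub>E {..<k} (\<lambda>_. cball 0 1))"
    using sub2 by (intro emeasure_mono) (auto intro!: sets_PiM_I_finite)
  also have "\<dots> = (\<Prod>i<k. emeasure lborel (cball (0::complex) 1))"
    by (subst emeasure_PiM_lborel) auto
  also have "\<dots> < \<infinity>"
    using emeasure_lborel_cball_finite[of "0::complex" 1] by (simp add: power_less_top_ennreal)
  finally show "emeasure ?L (cball_cplx k) \<noteq> \<infinity>" by simp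
qed

lemma prob_space_sphere_measure:
  assumes "k \<ge> 1"
  shows "prob_space (sphere_measure k)"
proof -
  let ?L = "Pi\<^sub>M {..<k} (\<lambda>_. lborel :: complex measure)"
  let ?B = "Pi\<^sub>M {..<k} (\<lambda>_. borel :: complex measure)"
  let ?U = "uniform_measure ?L (cball_cplx k)"
  interpret U: prob_space ?U
    using emeasure_cball_cplx by (intro prob_space_uniform_measure) (auto simp: top_unique)
  have meas: "normalize_cplx k \<in> ?U \<rightarrow>\<^sub>M ?B"
    using measurable_normalize_cplx by (simp add: measurable_def sets_PiM_lborel space_PiM)
  interpret D: prob_space "distr ?U ?B (normalize_cplx k)"
    by (rule U.prob_space_distr[OF meas])
  have null: "Pi\<^sub>E {..<k} (\<lambda>_. {0}) \<in> null_sets ?L"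
  proof (rule null_setsI)
    show "emeasure ?L (Pi\<^sub>E {..<k} (\<lambda>_. {0})) = 0"
      using assms by (subst emeasure_PiM_lborel) auto
    show "Pi\<^sub>E {..<k} (\<lambda>_. {0}) \<in> sets ?L"
      by (intro sets_PiM_I_finite) auto
  qed
  have "AE c in ?L. c \<notin> Pi\<^sub>E {..<k} (\<lambda>_. {0})"
    using null by (rule AE_not_in)
  then have "AE c in ?L. normalize_cplx k c \<in> sphere_cplx k"
    using AE_space
  proof eventually_elim
    case (elim c)
    define s where "s = (\<Sum>j<k. (cmod (c j))\<^sup>2)"
    have "c \<in> extensional {..<k}" using elim(2) by (simp add: space_PiM PiE_def)
    then have "\<not> (\<forall>i<k. c i = 0)"
      using elim(1) by (auto simp only: PiE_iff lessThan_iff singleton_iff)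
    then obtain i where i: "i < k" "c i \<noteq> 0" by blast
    have "0 < (cmod (c i))\<^sup>2" using i by simp
    also have "\<dots> \<le> s" unfolding s_def using i by (intro member_le_sum) auto
    finally have s: "s > 0" .
    have "(\<Sum>i<k. (cmod (normalize_cplx k c i))\<^sup>2) = (\<Sum>i<k. (cmod (c i))\<^sup>2 / s)"
      using s by (intro sum.cong)
        (auto simp: normalize_cplx_def s_def[symmetric] norm_divide power_divide)
    also have "\<dots> = 1" using s by (simp add: sum_divide_distrib[symmetric] s_def[symmetric])
    finally show ?case by (auto simp: sphere_cplx_def normalize_cplx_def)
  qed
  then have "AE c in ?U. normalize_cplx k c \<in> sphere_cplx k"
    using emeasure_cball_cplx
    by (intro AE_uniform_measureI) (auto simp: sets_cball_cplx sets_PiM_lborel)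
  then have "AE c in distr ?U ?B (normalize_cplx k). c \<in> sphere_cplx k"
    using sets_sphere_cplx by (subst AE_distr_iff[OF meas]) (auto simp: sphere_cplx_def space_PiM)
  then have "emeasure (distr ?U ?B (normalize_cplx k)) (sphere_cplx k) = 1"
    using sets_sphere_cplx by (intro D.emeasure_eq_1_AE) simp_all
  then show ?thesis
    unfolding sphere_measure_def using sets_sphere_cplx
    by (intro prob_space_restrict_space) simp_all
qed

(* With v = c - e_1, this is I_k - v v^* / (1 - cnj c_1).  For c = e_1 the division by zero
   gives I_k. *)
definition reflection :: "nat \<Rightarrow> (nat \<Rightarrow> complex) \<Rightarrow> complex mat" where
  "reflection k c =
     (let v = vec k c - unit_vec k 0
      in 1\<^sub>m k - (1 / (1 - cnj (c 0))) \<cdot>\<^sub>m mat k k (\<lambda>(i, j). v $ i * cnj (v $ j)))"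

lemma reflection_carrier: "reflection k c \<in> carrier_mat k k"
  by (auto simp: reflection_def Let_def)

(* V_mat m 0 is a dummy value; the sequence starts with V_mat m 1. *)
fun V_mat :: "(nat \<Rightarrow> nat \<Rightarrow> complex) \<Rightarrow> nat \<Rightarrow> complex mat" where
  "V_mat m 0 = 1\<^sub>m 0"
| "V_mat m (Suc 0) = reflection 1 (m 1)"
| "V_mat m (Suc (Suc n)) = reflection (Suc (Suc n)) (m (Suc (Suc n))) *
     four_block_mat (1\<^sub>m 1) (0\<^sub>m 1 (Suc n)) (0\<^sub>m (Suc n) 1) (V_mat m (Suc n))"

lemma V_mat_carrier: "V_mat m n \<in> carrier_mat n n"
proof (induction m n rule: V_mat.induct)
  case (3 m n)
  have "four_block_mat (1\<^sub>m 1) (0\<^sub>m 1 (Suc n)) (0\<^sub>m (Suc n) 1) (V_mat m (Suc n))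
      \<in> carrier_mat (1 + Suc n) (1 + Suc n)"
    using 3 by (intro four_block_carrier_mat) auto
  then show ?case
    unfolding V_mat.simps by (intro mult_carrier_mat[OF reflection_carrier]) simp
qed (auto simp: reflection_carrier)

definition Z_det :: "complex mat \<Rightarrow> complex" where
  "Z_det A = Determinant.det (1\<^sub>m (dim_row A) - A)"

(* The sum runs over the eigenvalues with algebraic multiplicity.  Ln is the principal branch;
   log_branch shows that on the unit circle it is the branch with imaginary part
   in (-pi/2, pi/2]. *)
definition log_Z :: "complex mat \<Rightarrow> complex" where
  "log_Z A = (\<Sum>z\<in>#proots (char_poly A). Ln (1 - z))"

lemma log_branch:
  assumes "cmod z = 1" "z \<noteq> 1"
  shows "exp (Ln (1 - z)) = 1 - z" "- pi / 2 < Im (Ln (1 - z))" "Im (Ln (1 - z)) \<le> pi / 2"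
proof -
  show "exp (Ln (1 - z)) = 1 - z" using assms by simp
  have "Re z \<noteq> 1"
  proof
    assume "Re z = 1"
    then have "Im z = 0" using assms(1) by (simp add: cmod_def)
    with \<open>Re z = 1\<close> assms(2) show False by (simp add: complex_eq_iff)
  qed
  then have "Re (1 - z) > 0"
    using complex_Re_le_cmod[of z] assms by simp
  then have "\<bar>Im (Ln (1 - z))\<bar> < pi / 2" by (rule Re_Ln_pos_lt_imp)
  then show "- pi / 2 < Im (Ln (1 - z))" "Im (Ln (1 - z)) \<le> pi / 2" by auto
qed

lemma exp_log_Z:
  assumes A: "A \<in> carrier_mat n n" and nz: "Z_det A \<noteq> 0"
  shows "exp (log_Z A) = Z_det A"
proof -
  have poly1: "poly (char_poly A) 1 = Z_det A"
    unfolding char_poly_def Z_det_def using A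
    by (intro poly_det_cong[of _ n]) (auto simp: char_poly_matrix_def)
  have "char_poly A = (\<Prod>z\<in>#proots (char_poly A). [:-z, 1:])"
    using complex_poly_decompose_multiset[of "char_poly A"] degree_monic_char_poly[OF A] by simp
  then have "poly (char_poly A) 1 = poly (\<Prod>z\<in>#proots (char_poly A). [:-z, 1:]) 1" by simp
  then have prod: "poly (char_poly A) 1 = (\<Prod>z\<in>#proots (char_poly A). 1 - z)"
    by (simp add: poly_prod_mset)
  have "exp (\<Sum>z\<in>#M. Ln (1 - z)) = (\<Prod>z\<in>#M. 1 - z)" if "1 \<notin># M" for M :: "complex multiset"
    using that by (induction M) (auto simp: exp_add)
  moreover have "1 \<notin># proots (char_poly A)"
    using nz poly1 by (cases "char_poly A = 0") auto
  ultimately show ?thesis by (simp add: log_Z_def prod poly1[symmetric])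
qed

end

(*
  Since det (1 - V_(N+1)) = (1 - m^(N+1)_1) det (1 - V_N), log Z_N is the sum of the independent
  variables log (1 - m^(k)_1), k <= N, up to a multiple of 2 pi i, which vanishes: moving m^(N+1)
  along the sphere to -e_1 keeps both sides continuous and ends at diag(-1, V_N).

  The law of xi = m^(k)_1 is invariant under phases. Expanding exp (t Re (alpha log (1 - xi))) =
  |(1 - xi)^(t alpha / 2)|^2 into a power series in xi, only the diagonal terms survive in the
  expectation, so with E |xi|^2 = 1 / k and E |xi|^4 = O(1 / k^2) the moment generating function is
  exp (t^2 / (4 k) + O(1 / k^2)); here xi is truncated to |xi| <= 1/2, which changes only finitely
  many summands. Hence the increments of the partial sums have moment generating functions
  within a constant factor of those of Gaussians with variance (H_n - H_m) / 2, and this alone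
  implies the law of the iterated logarithm: the upper bound by a maximal inequality, the lower
  bound by exponential tilting of independent blocks.
*)
theory Submission
  imports Defs "HOL-Real_Asymp.Real_Asymp" "HOL-Complex_Analysis.Cauchy_Integral_Theorem"
begin

section \<open>The logarithm of the characteristic polynomial as a sum\<close>

text \<open>Eigenvalues are awkward to follow along the sphere, so \<open>log_Z\<close> is first
  described without them: it is the value at t = 1 of the continuous logarithm of det (1 - t A) that
  starts at 0. Over a square of parameters such a logarithm exists jointly, which makes the
  deformation argument rigorous. Real and imaginary part are the cases \<alpha> = 1 and \<alpha> =
  -i of Re (\<alpha> log Z). Phase invariance makes all directions alike: the summand of dimension k
  has variance about 1 / (2 k), so the sum has variance s of about (log N) / 2, and sqrt (2 s log
  log s) is asymptotic to the normalization in the theorem. The law of xi is never computed. The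
  sphere carries the cone measure, and the only symmetries used are unitary maps of two coordinates,
  obtained from shears and the translation invariance of Lebesgue measure. Constant factors in the
  moment generating functions become constant factors in tail probabilities, and Borel-Cantelli only
  asks whether the sum of these converges.\<close>

text \<open>Two logarithms of the same number differ by a multiple of 2 pi i. Distinct multiples are
  at least 2 pi apart, so a continuous difference on a connected set is constant.\<close>

lemma exp_lift_unique:
  fixes g h :: "'a::topological_space \<Rightarrow> complex"
  assumes S: "connected S" and g: "continuous_on S g" and h: "continuous_on S h"
    and eq: "\<And>x. x \<in> S \<Longrightarrow> exp (g x) = exp (h x)"
    and a: "a \<in> S" "g a = h a" and b: "b \<in> S"
  shows "g b = h b"
proof -
  have "(\<lambda>x. g x - h x) constant_on S"
  proof (rule continuous_discrete_range_constant[OF S])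
    show "continuous_on S (\<lambda>x. g x - h x)" using g h by (intro continuous_intros)
    fix x assume x: "x \<in> S"
    have "2 * pi \<le> norm ((g y - h y) - (g x - h x))"
      if y: "y \<in> S" and ne: "g y - h y \<noteq> g x - h x" for y
    proof -
      have "exp ((g y - h y) - (g x - h x)) = 1"
        using eq[OF x] eq[OF y] by (simp add: exp_diff)
      then obtain n :: int where n: "(g y - h y) - (g x - h x) = of_int (2 * n) * pi * \<i>"
        using exp_eq_1[of "(g y - h y) - (g x - h x)"] by (auto simp: complex_eq_iff)
      with ne have "n \<noteq> 0" by auto
      then have "1 \<le> \<bar>real_of_int n\<bar>" by linarith
      then have "2 * pi \<le> 2 * pi * \<bar>real_of_int n\<bar>" by simp
      also have "\<dots> = norm ((g y - h y) - (g x - h x))"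
        unfolding n by (simp add: norm_mult)
      finally show ?thesis .
    qed
    then show "\<exists>e>0. \<forall>y. y \<in> S \<and> g y - h y \<noteq> g x - h x \<longrightarrow> e \<le> norm ((g y - h y) - (g x - h x))"
      by (intro exI[of _ "2 * pi"]) auto
  qed
  then obtain c where "\<forall>x\<in>S. g x - h x = c" by (auto simp: constant_on_def)
  then have "g b - h b = g a - h a" using a(1) b by simp
  with a(2) show ?thesis by simp
qed

lemma char_poly_proots:
  fixes A :: "complex mat"
  assumes A: "A \<in> carrier_mat n n"
  shows "char_poly A = (\<Prod>z\<in>#proots (char_poly A). [:-z, 1:])" "size (proots (char_poly A)) = n"
proof -
  show *: "char_poly A = (\<Prod>z\<in>#proots (char_poly A). [:-z, 1:])"
    using complex_poly_decompose_multiset[of "char_poly A"] degree_monic_char_poly[OF A] by simp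
  have "degree (\<Prod>z\<in>#M. [:-z, 1:]) = size M" for M :: "complex multiset"
  proof (induction M)
    case (add z M)
    have "(\<Prod>z\<in>#M. [:-z, 1:]) \<noteq> 0" by (auto simp: prod_mset_zero_iff)
    then have "degree ([:-z, 1:] * (\<Prod>z\<in>#M. [:-z, 1:])) = degree [:-z, 1:] + size M"
      by (subst degree_mult_eq) (use add in auto)
    then show ?case by (simp del: mult_pCons_left)
  qed auto
  then show "size (proots (char_poly A)) = n" using * degree_monic_char_poly[OF A] by metis
qed

text \<open>For t \<noteq> 0 the determinant is t^n times the characteristic polynomial at 1 / t,
  which splits over the roots; t = 0 is separate because of the division.\<close>

lemma det_one_minus_smult:
  fixes A :: "complex mat"
  assumes A: "A \<in> carrier_mat n n"
  shows "Determinant.det (1\<^sub>m n - t \<cdot>\<^sub>m A) = (\<Prod>z\<in>#proots (char_poly A). 1 - t * z)"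
proof (cases "t = 0")
  case True
  have "1\<^sub>m n - 0 \<cdot>\<^sub>m A = 1\<^sub>m n" using A by auto
  with True show ?thesis by simp
next
  case False
  let ?M = "proots (char_poly A)"
  have "1\<^sub>m n - t \<cdot>\<^sub>m A = t \<cdot>\<^sub>m (- char_matrix A (1 / t))"
    using A False by (auto simp: char_matrix_def algebra_simps)
  then have "Determinant.det (1\<^sub>m n - t \<cdot>\<^sub>m A) = t ^ n * poly (char_poly A) (1 / t)"
    using A by (simp add: char_poly_matrix[OF A] char_matrix_def)
  also have "poly (char_poly A) (1 / t) = (\<Prod>z\<in>#?M. 1 / t - z)"
    by (subst char_poly_proots[OF A]) (simp add: poly_prod_mset)
  also have "t ^ n = (\<Prod>z\<in>#?M. t)" using char_poly_proots(2)[OF A] by simp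
  also have "(\<Prod>z\<in>#?M. t) * (\<Prod>z\<in>#?M. 1 / t - z) = (\<Prod>z\<in>#?M. t * (1 / t - z))"
    by (rule prod_mset.distrib[symmetric])
  also have "\<dots> = (\<Prod>z\<in>#?M. 1 - t * z)"
    using False by (simp add: algebra_simps)
  finally show ?thesis .
qed

text \<open>Unitarity in the form that passes to products and blocks and puts eigenvalues on the
  unit circle without any adjoint.\<close>

definition isometric_mat :: "complex mat \<Rightarrow> bool" where
  "isometric_mat A \<longleftrightarrow> (\<forall>x\<in>carrier_vec (dim_col A).
     (\<Sum>i<dim_row A. (cmod ((A *\<^sub>v x) $ i))\<^sup>2) = (\<Sum>i<dim_col A. (cmod (x $ i))\<^sup>2))"

lemma cmod_eigenvalue_isometric:
  assumes A: "A \<in> carrier_mat n n" and iso: "isometric_mat A" and z: "z \<in># proots (char_poly A)"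
  shows "cmod z = 1"
proof -
  have "poly (char_poly A) z = 0" using z by (cases "char_poly A = 0") auto
  then obtain x where x: "x \<in> carrier_vec n" "x \<noteq> 0\<^sub>v n" "A *\<^sub>v x = z \<cdot>\<^sub>v x"
    using eigenvalue_root_char_poly[OF A] A unfolding eigenvalue_def eigenvector_def by auto
  define s where "s = (\<Sum>i<n. (cmod (x $ i))\<^sup>2)"
  have "s = (\<Sum>i<n. (cmod ((A *\<^sub>v x) $ i))\<^sup>2)"
    using iso x(1) A by (auto simp: isometric_mat_def s_def)
  also have "\<dots> = (cmod z)\<^sup>2 * s"
    using x by (simp add: s_def sum_distrib_left norm_mult power_mult_distrib)
  finally have "s = (cmod z)\<^sup>2 * s" .
  moreover have "s \<noteq> 0"
  proof
    assume "s = 0"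
    then have "\<forall>i<n. x $ i = 0" unfolding s_def by (subst (asm) sum_nonneg_eq_0_iff) auto
    then have "x = 0\<^sub>v n" using x(1) by auto
    with x(2) show False by simp
  qed
  ultimately have "(cmod z)\<^sup>2 = 1" by simp
  then show ?thesis by (simp add: power2_eq_1_iff) (use norm_ge_zero[of z] in linarith)
qed

text \<open>For |z| = 1, z \<noteq> 1 and t in [0, 1] the factor 1 - t z stays in the right half
  plane, so the sum of the principal logarithms over the eigenvalues is itself a continuous
  logarithm of det (1 - t A) starting at 0. Uniqueness of lifts identifies the values at t =
  1.\<close>

lemma log_Z_eq_lift:
  assumes A: "A \<in> carrier_mat n n" and iso: "isometric_mat A" and nz: "Z_det A \<noteq> 0"
    and g: "continuous_on {0..1} g" "g 0 = 0"
      "\<And>t. t \<in> {0..1} \<Longrightarrow> exp (g t) = Determinant.det (1\<^sub>m n - complex_of_real t \<cdot>\<^sub>m A)"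
  shows "log_Z A = g 1"
proof -
  define h where "h t = (\<Sum>z\<in>#proots (char_poly A). Ln (1 - complex_of_real t * z))" for t
  have pos: "Re (1 - complex_of_real t * z) > 0" if "t \<in> {0..1}" "z \<in># proots (char_poly A)" for t z
  proof -
    have z: "cmod z = 1" using cmod_eigenvalue_isometric[OF A iso that(2)] .
    have "1 \<cdot>\<^sub>m A = A" using A by auto
    then have "(\<Prod>z\<in>#proots (char_poly A). 1 - z) \<noteq> 0"
      using det_one_minus_smult[OF A, of 1] nz A by (simp add: Z_det_def)
    then have "z \<noteq> 1" using that(2) by (auto simp: prod_mset_zero_iff)
    moreover have "z = 1" if "Re z = 1"
      using z that by (simp add: cmod_def complex_eq_iff)
    ultimately have "Re z < 1" using z complex_Re_le_cmod[of z] by fastforce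
    moreover have "t * Re z \<le> max 0 (Re z)"
      using that(1) by (cases "Re z \<le> 0") (auto simp: mult_left_le_one_le mult_nonneg_nonpos)
    ultimately show ?thesis by simp
  qed
  have cont_h: "continuous_on {0..1} h"
  proof -
    have "continuous_on {0..1} (\<lambda>t. \<Sum>z\<in>#M. Ln (1 - complex_of_real t * z))"
      if "\<And>t z. t \<in> {0..1} \<Longrightarrow> z \<in># M \<Longrightarrow> Re (1 - complex_of_real t * z) > 0" for M
      using that
    proof (induction M)
      case (add x M)
      have "continuous_on {0..1} (\<lambda>t. Ln (1 - complex_of_real t * x))"
        using add.prems[of _ x] by (intro continuous_intros) (auto simp: complex_nonpos_Reals_iff not_le)
      moreover have "continuous_on {0..1} (\<lambda>t. \<Sum>z\<in>#M. Ln (1 - complex_of_real t * z))"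
        using add by auto
      ultimately show ?case by (auto intro!: continuous_intros)
    qed auto
    then show ?thesis unfolding h_def using pos by blast
  qed
  have exp_h: "exp (h t) = Determinant.det (1\<^sub>m n - complex_of_real t \<cdot>\<^sub>m A)" if "t \<in> {0..1}" for t
  proof -
    have "exp (\<Sum>z\<in>#M. Ln (1 - complex_of_real t * z)) = (\<Prod>z\<in>#M. 1 - complex_of_real t * z)"
      if "\<And>z. z \<in># M \<Longrightarrow> 1 - complex_of_real t * z \<noteq> 0" for M
      using that by (induction M) (auto simp: exp_add)
    moreover have "1 - complex_of_real t * z \<noteq> 0" if "z \<in># proots (char_poly A)" for z
      using pos[OF \<open>t \<in> {0..1}\<close> that] by fastforce
    ultimately show ?thesis unfolding h_def det_one_minus_smult[OF A] by blast
  qed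
  have h0: "h 0 = 0" by (simp add: h_def)
  have "h 1 = g 1"
    by (rule exp_lift_unique[of "{0..1::real}" h g 0]) (use cont_h exp_h g h0 in auto)
  then show ?thesis by (simp add: h_def log_Z_def)
qed

section \<open>Reflections: isometry and the determinant recursion\<close>

lemma reflection_mult_vec:
  fixes c :: "nat \<Rightarrow> complex"
  assumes k: "0 < k" and x: "x \<in> carrier_vec k" and i: "i < k"
  defines "v \<equiv> \<lambda>i. c i - (if i = 0 then 1 else 0)"
  shows "(reflection k c *\<^sub>v x) $ i =
    x $ i - 1 / (1 - cnj (c 0)) * (\<Sum>j<k. cnj (v j) * x $ j) * v i"
proof -
  have v: "(vec k c - unit_vec k 0) $ j = v j" if "j < k" for j
    using that by (simp add: v_def)
  have "(reflection k c *\<^sub>v x) $ i = (\<Sum>j<k. (reflection k c) $$ (i, j) * x $ j)"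
    using x i reflection_carrier[of k c] by (auto simp: scalar_prod_def atLeast0LessThan)
  also have "\<dots> = (\<Sum>j<k. (if i = j then x $ j else 0) -
      1 / (1 - cnj (c 0)) * (cnj (v j) * x $ j) * v i)"
    using i by (intro sum.cong) (auto simp: reflection_def Let_def v algebra_simps simp del: index_minus_vec(1))
  also have "\<dots> = x $ i - (\<Sum>j<k. 1 / (1 - cnj (c 0)) * (cnj (v j) * x $ j) * v i)"
    using i by (simp add: sum_subtractf)
  finally show ?thesis by (simp add: sum_distrib_left sum_distrib_right)
qed

text \<open>With v = c - e_1 and g = 1 / (1 - cnj c_0), the unit norm of c gives |v|^2 = (1 - c_0) +
  (1 - cnj c_0), hence |g|^2 |v|^2 = g + cnj g. This is what cancels the cross terms in |x - g a
  v|^2, where a is the inner product of x with v.\<close>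

lemma isometric_reflection:
  assumes k: "0 < k" and c: "(\<Sum>i<k. (cmod (c i))\<^sup>2) = 1" and c0: "c 0 \<noteq> 1"
  shows "isometric_mat (reflection k c)"
proof -
  have "(\<Sum>i<k. (cmod ((reflection k c *\<^sub>v x) $ i))\<^sup>2) = (\<Sum>i<k. (cmod (x $ i))\<^sup>2)"
    if x: "x \<in> carrier_vec k" for x
  proof -
    define v where "v = (\<lambda>i. c i - (if i = 0 then 1 else 0))"
    define a where "a = (\<Sum>j<k. cnj (v j) * x $ j)"
    define g where "g = 1 / (1 - cnj (c 0))"
    have g: "g * (1 - cnj (c 0)) = 1" "cnj g * (1 - c 0) = 1"
      using c0 by (simp_all add: g_def)
    have vv: "(\<Sum>i<k. v i * cnj (v i)) = (1 - c 0) + (1 - cnj (c 0))"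
    proof -
      have "(\<Sum>i<k. v i * cnj (v i)) = (\<Sum>i<k. c i * cnj (c i) + (if i = 0 then 1 - c 0 - cnj (c 0) else 0))"
        by (intro sum.cong) (auto simp: v_def algebra_simps)
      also have "\<dots> = (\<Sum>i<k. c i * cnj (c i)) + (1 - c 0 - cnj (c 0))"
        using k by (simp add: sum.distrib)
      also have "(\<Sum>i<k. c i * cnj (c i)) = complex_of_real (\<Sum>i<k. (cmod (c i))\<^sup>2)"
        unfolding of_real_sum by (intro sum.cong refl) (simp only: complex_norm_square)
      finally show ?thesis using c by simp
    qed
    have "complex_of_real (\<Sum>i<k. (cmod ((reflection k c *\<^sub>v x) $ i))\<^sup>2)
        = (\<Sum>i<k. (x $ i - g * a * v i) * cnj (x $ i - g * a * v i))"
      unfolding of_real_sum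
      by (intro sum.cong refl)
        (simp only: complex_norm_square reflection_mult_vec[OF k x] lessThan_iff v_def a_def g_def)
    also have "\<dots> = (\<Sum>i<k. x $ i * cnj (x $ i) - g * a * cnj (cnj (v i) * x $ i)
        - cnj (g * a) * (cnj (v i) * x $ i) + (g * a) * cnj (g * a) * (v i * cnj (v i)))"
      by (intro sum.cong) (auto simp: algebra_simps)
    also have "\<dots> = (\<Sum>i<k. x $ i * cnj (x $ i)) - g * a * cnj a - cnj (g * a) * a
        + (g * a) * cnj (g * a) * ((1 - c 0) + (1 - cnj (c 0)))"
      unfolding vv[symmetric] a_def
      by (simp add: sum.distrib sum_subtractf sum_distrib_left[symmetric] cnj_sum)
    also have "(g * a) * cnj (g * a) * ((1 - c 0) + (1 - cnj (c 0)))
      = (a * cnj a) * (g * (cnj g * (1 - c 0)) + cnj g * (g * (1 - cnj (c 0))))"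
      by (simp add: algebra_simps)
    also have "\<dots> = (a * cnj a) * (g + cnj g)" unfolding g by simp
    finally have "complex_of_real (\<Sum>i<k. (cmod ((reflection k c *\<^sub>v x) $ i))\<^sup>2)
        = (\<Sum>i<k. x $ i * cnj (x $ i))" by (simp add: algebra_simps)
    also have "\<dots> = complex_of_real (\<Sum>i<k. (cmod (x $ i))\<^sup>2)"
      unfolding of_real_sum by (intro sum.cong refl) (simp only: complex_norm_square)
    finally show ?thesis by (simp only: of_real_eq_iff)
  qed
  then show ?thesis using reflection_carrier[of k c] by (simp add: isometric_mat_def)
qed

lemma isometric_mult:
  assumes "A \<in> carrier_mat n n" "B \<in> carrier_mat n n" "isometric_mat A" "isometric_mat B"
  shows "isometric_mat (A * B)"
  using assms by (auto simp: isometric_mat_def)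

lemma isometric_one_block:
  assumes V: "V \<in> carrier_mat n n" and iso: "isometric_mat V"
  shows "isometric_mat (four_block_mat (1\<^sub>m 1) (0\<^sub>m 1 n) (0\<^sub>m n 1) V)" (is "isometric_mat ?B")
proof -
  have "(\<Sum>i<Suc n. (cmod ((?B *\<^sub>v x) $ i))\<^sup>2) = (\<Sum>i<Suc n. (cmod (x $ i))\<^sup>2)"
    if x: "x \<in> carrier_vec (Suc n)" for x
  proof -
    define y where "y = vec n (\<lambda>i. x $ Suc i)"
    have "x = vec 1 (\<lambda>_. x $ 0) @\<^sub>v y"
      using x by (intro eq_vecI) (auto simp: y_def)
    then have "?B *\<^sub>v x = ?B *\<^sub>v (vec 1 (\<lambda>_. x $ 0) @\<^sub>v y)" by simp
    also have "\<dots> = vec 1 (\<lambda>_. x $ 0) @\<^sub>v (V *\<^sub>v y)"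
      using V by (subst four_block_mat_mult_vec[of _ 1 1 _ n _ n]) (auto simp: y_def)
    finally have *: "?B *\<^sub>v x = vec 1 (\<lambda>_. x $ 0) @\<^sub>v (V *\<^sub>v y)" .
    have "(\<Sum>i<n. (cmod ((V *\<^sub>v y) $ i))\<^sup>2) = (\<Sum>i<n. (cmod (y $ i))\<^sup>2)"
      using iso V by (auto simp: isometric_mat_def y_def)
    then show ?thesis
      unfolding * using V by (simp add: sum.lessThan_Suc_shift y_def del: sum.lessThan_Suc)
  qed
  then show ?thesis using V by (simp add: isometric_mat_def)
qed

(* The first column of 1 - W is e_1 - m, and adding multiples of it to the other columns
   turns them into those of 1 - diag(1, V). *)
lemma det_one_minus_reflection_mult:
  assumes V: "V \<in> carrier_mat n n" and c0: "c 0 \<noteq> 1"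
  defines "W \<equiv> reflection (Suc n) c * four_block_mat (1\<^sub>m 1) (0\<^sub>m 1 n) (0\<^sub>m n 1) V"
  shows "Determinant.det (1\<^sub>m (Suc n) - W) = (1 - c 0) * Determinant.det (1\<^sub>m n - V)"
proof -
  define B where "B = four_block_mat (1\<^sub>m 1) (0\<^sub>m 1 n) (0\<^sub>m n 1) V"
  define v where "v = (\<lambda>i. c i - (if i = 0 then 1 else 0))"
  define g where "g = 1 / (1 - cnj (c 0))"
  define w where "w j = (\<Sum>l<Suc n. cnj (v l) * B $$ (l, j))" for j
  have B: "B \<in> carrier_mat (Suc n) (Suc n)"
    unfolding B_def using four_block_carrier_mat[OF one_carrier_mat[of 1] V] by simp
  have W: "W \<in> carrier_mat (Suc n) (Suc n)"
    unfolding W_def B_def[symmetric] using B reflection_carrier[of "Suc n" c] by auto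
  have W_entry: "W $$ (i, j) = B $$ (i, j) - g * w j * v i" if "i < Suc n" "j < Suc n" for i j
  proof -
    have "W $$ (i, j) = (reflection (Suc n) c *\<^sub>v col B j) $ i"
      unfolding W_def B_def[symmetric] using that B reflection_carrier[of "Suc n" c] by auto
    also have "\<dots> = col B j $ i - g * (\<Sum>l<Suc n. cnj (v l) * col B j $ l) * v i"
      unfolding g_def v_def using that B by (subst reflection_mult_vec) auto
    also have "(\<Sum>l<Suc n. cnj (v l) * col B j $ l) = w j"
      unfolding w_def using that B by (intro sum.cong) auto
    finally show ?thesis using that B by simp
  qed
  have "w 0 = (\<Sum>l<Suc n. if l = 0 then cnj (v 0) else 0)"
    unfolding w_def B_def using V by (intro sum.cong) auto
  \<comment> \<open>Hence the first column of \<open>W\<close> is e_1 + v = c: the reflection maps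
    e_1 to c.\<close>
  then have w0: "g * w 0 = -1"
    using c0 by (simp add: g_def v_def field_simps del: sum.lessThan_Suc)
  define Y where "Y = four_block_mat (mat 1 1 (\<lambda>_. - v 0)) (0\<^sub>m 1 n)
    (mat n 1 (\<lambda>(i, _). - v (Suc i))) (1\<^sub>m n - V)"
  \<comment> \<open>\<open>U\<close> is unipotent and records which multiple of the first column of
    \<open>Y\<close> is added to each of the others.\<close>
  define U where "U = four_block_mat (1\<^sub>m 1) (mat 1 n (\<lambda>(_, j). - (g * w (Suc j))))
    (0\<^sub>m n 1) (1\<^sub>m n)"
  have "1\<^sub>m (Suc n) - W = Y * U"
  proof (rule eq_matI)
    fix i j assume ij: "i < dim_row (Y * U)" "j < dim_col (Y * U)"
    then have ij': "i < Suc n" "j < Suc n" using V by (auto simp: Y_def U_def)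
    have dims: "dim_col Y = Suc n" "dim_row U = Suc n" "dim_row Y = Suc n" "dim_col U = Suc n"
      using V by (auto simp: Y_def U_def)
    have "(Y * U) $$ (i, j) = (\<Sum>l<Suc n. Y $$ (i, l) * U $$ (l, j))"
      using ij' dims by (simp add: scalar_prod_def atLeast0LessThan)
    also have "\<dots> = Y $$ (i, 0) * U $$ (0, j) + (\<Sum>l<n. Y $$ (i, Suc l) * U $$ (Suc l, j))"
      by (simp add: sum.lessThan_Suc_shift del: sum.lessThan_Suc)
    also have "(\<Sum>l<n. Y $$ (i, Suc l) * U $$ (Suc l, j)) =
        (\<Sum>l<n. if Suc l = j then Y $$ (i, j) else 0)"
      using ij' by (intro sum.cong) (auto simp: U_def)
    also have "\<dots> = (if j = 0 then 0 else Y $$ (i, j))"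
      using ij' by (cases j) auto
    finally have YU: "(Y * U) $$ (i, j) = Y $$ (i, 0) * U $$ (0, j) + (if j = 0 then 0 else Y $$ (i, j))" .
    show "(1\<^sub>m (Suc n) - W) $$ (i, j) = (Y * U) $$ (i, j)"
      unfolding YU index_minus_mat(1)[of i W j, unfolded carrier_matD[OF W], OF ij'] W_entry[OF ij']
      using ij' V w0 by (cases i; cases j) (auto simp: Y_def U_def B_def v_def algebra_simps)
  qed (use W V in \<open>auto simp: Y_def U_def\<close>)
  moreover have "Y \<in> carrier_mat (Suc n) (Suc n)" "U \<in> carrier_mat (Suc n) (Suc n)"
    using V by (auto simp: Y_def U_def)
  ultimately have "Determinant.det (1\<^sub>m (Suc n) - W) = Determinant.det Y * Determinant.det U"
    using det_mult by metis
  also have "Determinant.det Y = - v 0 * Determinant.det (1\<^sub>m n - V)"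
    unfolding Y_def using V
    by (subst det_four_block_mat_upper_right_zero[of _ 1 _ n]) (auto simp: det_single)
  also have "Determinant.det U = 1"
    unfolding U_def by (subst det_four_block_mat_lower_left_zero[of _ 1 _ n]) auto
  finally show ?thesis by (simp add: v_def)
qed

lemma reflection_neg_unit:
  assumes c: "\<And>i. i < Suc n \<Longrightarrow> c i = (if i = 0 then -1 else 0)"
  shows "reflection (Suc n) c = four_block_mat (mat 1 1 (\<lambda>_. -1)) (0\<^sub>m 1 n) (0\<^sub>m n 1) (1\<^sub>m n)"
  by (rule eq_matI) (use c in \<open>auto simp: reflection_def Let_def\<close>)

text \<open>The end point of the deformation, where the recursion can be read off: the additional
  eigenvalue -1 contributes Ln (1 + 1).\<close>

lemma log_Z_neg_one_block:
  assumes V: "V \<in> carrier_mat n n"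
  shows "log_Z (four_block_mat (mat 1 1 (\<lambda>_. -1)) (0\<^sub>m 1 n) (0\<^sub>m n 1) V) = Ln 2 + log_Z V"
proof -
  have 1: "char_poly (mat 1 1 (\<lambda>_. -1 :: complex)) = [:1, 1:]"
    by (simp add: char_poly_def char_poly_matrix_def det_single one_pCons)
  have nz: "char_poly V \<noteq> 0" using degree_monic_char_poly[OF V] by auto
  have "proots ([:1, 1:] * char_poly V) = {#-1#} + proots (char_poly V)"
    using nz by (subst proots_mult) auto
  then show ?thesis
    unfolding log_Z_def using V
    by (subst char_poly_four_block_zeros_col[where n = n])
      (auto simp: 1[simplified] simp del: mult_pCons_left)
qed

section \<open>Deforming the unit vector to determine the branch\<close>

lemma continuous_on_det:
  fixes A :: "'a::topological_space \<Rightarrow> complex mat"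
  assumes "\<And>x. x \<in> S \<Longrightarrow> A x \<in> carrier_mat n n"
    and "\<And>i j. i < n \<Longrightarrow> j < n \<Longrightarrow> continuous_on S (\<lambda>x. A x $$ (i, j))"
  shows "continuous_on S (\<lambda>x. Determinant.det (A x))"
proof -
  have "continuous_on S (\<lambda>x. \<Sum>p\<in>{p. p permutes {0..<n}}. signof p * (\<Prod>i = 0..<n. A x $$ (i, p i)))"
    by (intro continuous_intros assms(2)) (auto dest: permutes_in_image)
  then show ?thesis
    by (rule continuous_on_eq) (simp only: Determinant.det_def'[OF assms(1)])
qed

(* Normalizing the segment from m to -e_1 gives a path of unit vectors avoiding e_1. *)
lemma unit_path_to_neg_unit:
  fixes m :: "nat \<Rightarrow> complex"
  assumes m: "(\<Sum>i<Suc n. (cmod (m i))\<^sup>2) = 1" and m0: "m 0 \<noteq> 1"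
  obtains u :: "real \<Rightarrow> nat \<Rightarrow> complex" where
    "u 0 = m" "\<And>i. u 1 i = (if i = 0 then -1 else 0)"
    "\<And>i. continuous_on {0..1} (\<lambda>s. u s i)"
    "\<And>s. s \<in> {0..1} \<Longrightarrow> (\<Sum>i<Suc n. (cmod (u s i))\<^sup>2) = 1"
    "\<And>s. s \<in> {0..1} \<Longrightarrow> Re (u s 0) < 1"
proof -
  define r where "r = Re (m 0)"
  have cm0: "(cmod (m 0))\<^sup>2 \<le> 1"
    using member_le_sum[of 0 "{..<Suc n}" "\<lambda>i. (cmod (m i))\<^sup>2"] m by simp
  have r2: "r\<^sup>2 \<le> 1" and r1: "r < 1"
  proof -
    have *: "r\<^sup>2 + (Im (m 0))\<^sup>2 \<le> 1" using cm0 by (simp add: cmod_power2 r_def)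
    then show r2: "r\<^sup>2 \<le> 1" by (smt (verit) zero_le_power2)
    have "r \<noteq> 1"
    proof
      assume "r = 1"
      with * have "Im (m 0) = 0" by simp
      with \<open>r = 1\<close> m0 show False by (simp add: r_def complex_eq_iff)
    qed
    with r2 show "r < 1" by (simp add: power_le_one_iff abs_square_le_1)
  qed
  define w where "w s i = complex_of_real (1 - s) * m i - (if i = 0 then complex_of_real s else 0)" for s i
  define q where "q s = (\<Sum>i<Suc n. (cmod (w s i))\<^sup>2)" for s
  have q: "q s = (1 - s)\<^sup>2 + s\<^sup>2 - 2 * s * (1 - s) * r" for s
  proof -
    have "q s = (\<Sum>i<Suc n. (1 - s)\<^sup>2 * (cmod (m i))\<^sup>2 + (if i = 0 then s\<^sup>2 - 2 * s * (1 - s) * r else 0))"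
      unfolding q_def cmod_power2
      by (intro sum.cong refl) (auto simp: w_def r_def power2_eq_square algebra_simps)
    also have "\<dots> = (1 - s)\<^sup>2 * (\<Sum>i<Suc n. (cmod (m i))\<^sup>2) + (s\<^sup>2 - 2 * s * (1 - s) * r)"
      by (simp add: sum.distrib sum_distrib_left del: sum.lessThan_Suc)
    finally show ?thesis unfolding m by simp
  qed
  have qpos: "q s > 0" if "s \<in> {0..1}" for s
  proof -
    \<comment> \<open>In this form both terms are nonnegative, and for r < 1 the second one vanishes
      only at the end points, where q = 1.\<close>
    have *: "q s = (1 - 2 * s)\<^sup>2 + 2 * (s * (1 - s)) * (1 - r)"
      unfolding q by (simp add: power2_eq_square algebra_simps)
    show ?thesis
    proof (cases "s = 0 \<or> s = 1")
      case True then show ?thesis by (auto simp: q)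
    next
      case False
      with that have "0 < s" "0 < 1 - s" "0 < 1 - r" using r1 by auto
      then have "2 * (s * (1 - s)) * (1 - r) > 0" by (intro mult_pos_pos) simp_all
      then show ?thesis unfolding * using zero_le_power2[of "1 - 2 * s"] by linarith
    qed
  qed
  define u where "u s i = w s i / complex_of_real (sqrt (q s))" for s i
  have cont_q: "continuous_on {0..1} q"
    unfolding q by (intro continuous_intros)
  have unit: "(\<Sum>i<Suc n. (cmod (u s i))\<^sup>2) = 1" if "s \<in> {0..1}" for s
  proof -
    have "(\<Sum>i<Suc n. (cmod (u s i))\<^sup>2) = (\<Sum>i<Suc n. (cmod (w s i))\<^sup>2 / q s)"
      using qpos[OF that] by (intro sum.cong) (auto simp: u_def norm_divide power_divide)
    also have "\<dots> = 1" using qpos[OF that] by (simp only: sum_divide_distrib[symmetric] q_def[symmetric]) simp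
    finally show ?thesis .
  qed
  \<comment> \<open>If the real part were 1, the first coordinate before normalization would have
    real part equal to the whole norm \<open>sqrt (q s)\<close>. Squaring forces s = 1 or r = -1,
    and then that real part is -1.\<close>
  have Re_ne: "Re (u s 0) \<noteq> 1" if s: "s \<in> {0..1}" for s
  proof
    assume "Re (u s 0) = 1"
    then have eq: "(1 - s) * r - s = sqrt (q s)"
      using qpos[OF s] by (auto simp: u_def w_def r_def field_simps Re_divide_of_real)
    then have "((1 - s) * r - s)\<^sup>2 = q s" using qpos[OF s] by simp
    then have "(1 - s)\<^sup>2 * (1 - r\<^sup>2) = 0" unfolding q by (simp add: power2_eq_square algebra_simps)
    then have "s = 1 \<or> r = -1" using r1 by (auto simp: power2_eq_1_iff)
    then have "(1 - s) * r - s = -1" by auto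
    with eq qpos[OF s] show False by (smt (verit) real_sqrt_gt_zero)
  qed
  show ?thesis
  proof (rule that[of u])
    show "u 0 = m" by (rule ext) (simp add: u_def w_def q)
    show "u 1 i = (if i = 0 then -1 else 0)" for i by (simp add: u_def w_def q)
    show "continuous_on {0..1} (\<lambda>s. u s i)" for i
      unfolding u_def w_def using cont_q qpos by (cases "i = 0") (auto intro!: continuous_intros, force+)
    show "(\<Sum>i<Suc n. (cmod (u s i))\<^sup>2) = 1" if "s \<in> {0..1}" for s using unit[OF that] .
    show "Re (u s 0) < 1" if s: "s \<in> {0..1}" for s
    proof -
      have "(cmod (u s 0))\<^sup>2 \<le> 1"
        using member_le_sum[of 0 "{..<Suc n}" "\<lambda>i. (cmod (u s i))\<^sup>2"] unit[OF s] by simp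
      then have "cmod (u s 0) \<le> 1" by (simp add: power_le_one_iff abs_square_le_1)
      then show ?thesis using Re_ne[OF s] complex_Re_le_cmod[of "u s 0"] by linarith
    qed
  qed
qed

(* Both sides are continuous logarithms of (1 - u s 0) * det (1 - V) along a path u of unit vectors
   from m to -e_1, at whose end the matrix is diag(-1, V). *)
lemma log_Z_reflection_mult:
  assumes V: "V \<in> carrier_mat n n" and iso: "isometric_mat V" and nz: "Z_det V \<noteq> 0"
    and m: "(\<Sum>i<Suc n. (cmod (m i))\<^sup>2) = 1" and m0: "m 0 \<noteq> 1"
  shows "log_Z (reflection (Suc n) m * four_block_mat (1\<^sub>m 1) (0\<^sub>m 1 n) (0\<^sub>m n 1) V)
    = Ln (1 - m 0) + log_Z V"
proof -
  obtain u :: "real \<Rightarrow> nat \<Rightarrow> complex" where u: "u 0 = m" "\<And>i. u 1 i = (if i = 0 then -1 else 0)"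
    and cont_u: "\<And>i. continuous_on {0..1} (\<lambda>s. u s i)"
    and unit: "\<And>s. s \<in> {0..1} \<Longrightarrow> (\<Sum>i<Suc n. (cmod (u s i))\<^sup>2) = 1"
    and Re_u0: "\<And>s. s \<in> {0..1} \<Longrightarrow> Re (u s 0) < 1"
    by (rule unit_path_to_neg_unit[OF m m0], rule that)
  have u0: "u s 0 \<noteq> 1" if "s \<in> {0..1}" for s using Re_u0[OF that] by auto
  define B where "B = four_block_mat (1\<^sub>m 1) (0\<^sub>m 1 n) (0\<^sub>m n 1) V"
  define W where "W s = reflection (Suc n) (u s) * B" for s
  have B: "B \<in> carrier_mat (Suc n) (Suc n)"
    unfolding B_def using four_block_carrier_mat[OF one_carrier_mat[of 1] V] by simp
  have W: "W s \<in> carrier_mat (Suc n) (Suc n)" for s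
    unfolding W_def by (rule mult_carrier_mat[OF reflection_carrier B])
  have isoW: "isometric_mat (W s)" if "s \<in> {0..1}" for s
    unfolding W_def
    by (rule isometric_mult[OF reflection_carrier B isometric_reflection[OF _ unit[OF that] u0[OF that]]
        isometric_one_block[OF V iso, folded B_def]]) simp
  have nzW: "Z_det (W s) = (1 - u s 0) * Z_det V" if "s \<in> {0..1}" for s
  proof -
    have "Determinant.det (1\<^sub>m (Suc n) - W s) = (1 - u s 0) * Determinant.det (1\<^sub>m n - V)"
      unfolding W_def B_def by (rule det_one_minus_reflection_mult[OF V, of "u s", OF u0[OF that]])
    then show ?thesis unfolding Z_det_def carrier_matD[OF W] carrier_matD[OF V] .
  qed
  have nzW': "Z_det (W s) \<noteq> 0" if "s \<in> {0..1}" for s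
    using nzW[OF that] u0[OF that] nz by simp
  define F where "F = (\<lambda>(s, t). Determinant.det (1\<^sub>m (Suc n) - complex_of_real t \<cdot>\<^sub>m W s))"
  let ?S = "{0..1::real} \<times> {0..1::real}"
  have cont_F: "continuous_on ?S F"
    unfolding F_def case_prod_unfold
  proof (rule continuous_on_det)
    show "1\<^sub>m (Suc n) - complex_of_real (snd x) \<cdot>\<^sub>m W (fst x) \<in> carrier_mat (Suc n) (Suc n)" for x
      by (rule minus_carrier_mat[OF smult_carrier_mat[OF W]])
    fix i j assume ij: "i < Suc n" "j < Suc n"
    have cont_uf: "continuous_on ?S (\<lambda>x. u (fst x) i)" for i
      by (rule continuous_on_compose2[OF cont_u]) (auto intro: continuous_on_fst continuous_on_id)
    have u0': "1 - cnj (u (fst x) 0) \<noteq> 0" if "x \<in> ?S" for x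
      using u0[of "fst x"] that by (metis complex_cnj_cnj complex_cnj_one mem_Times_iff right_minus_eq)
    have refl: "continuous_on ?S (\<lambda>x. reflection (Suc n) (u (fst x)) $$ (i, l))" if l: "l < Suc n" for l
    proof -
      have eq: "(\<lambda>x::real \<times> real. reflection (Suc n) (u (fst x)) $$ (i, l)) = (\<lambda>x. (if i = l then 1 else 0) -
          1 / (1 - cnj (u (fst x) 0)) * ((u (fst x) i - (if i = 0 then 1 else 0)) *
          cnj (u (fst x) l - (if l = 0 then 1 else 0))))"
        using ij l by (intro ext) (simp add: reflection_def Let_def)
      show ?thesis
        unfolding eq using u0' by (intro continuous_intros cont_uf) blast+
    qed
    have eq: "(\<lambda>x::real \<times> real. \<Sum>l<Suc n. reflection (Suc n) (u (fst x)) $$ (i, l) * B $$ (l, j)) = (\<lambda>x. W (fst x) $$ (i, j))"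
    proof
      fix x :: "real \<times> real"
      note R = reflection_carrier[of "Suc n" "u (fst x)"]
      show "(\<Sum>l<Suc n. reflection (Suc n) (u (fst x)) $$ (i, l) * B $$ (l, j)) = W (fst x) $$ (i, j)"
        unfolding W_def using ij carrier_matD[OF B] carrier_matD[OF R]
        by (simp add: scalar_prod_def atLeast0LessThan del: sum.lessThan_Suc)
    qed
    have "continuous_on ?S (\<lambda>x. W (fst x) $$ (i, j))"
      unfolding eq[symmetric] by (intro continuous_intros refl) simp
    then have "continuous_on ?S (\<lambda>x. (1\<^sub>m (Suc n)) $$ (i, j) - complex_of_real (snd x) * W (fst x) $$ (i, j))"
      by (intro continuous_intros)
    then show "continuous_on ?S (\<lambda>x. (1\<^sub>m (Suc n) - complex_of_real (snd x) \<cdot>\<^sub>m W (fst x)) $$ (i, j))"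
      by (rule continuous_on_eq) (use ij carrier_matD[OF W] in simp)
  qed
  \<comment> \<open>For t < 1 an eigenvalue of modulus 1 cannot satisfy t z = 1; for t = 1 the
    determinant recursion excludes the eigenvalue 1.\<close>
  have F_nz: "F x \<noteq> 0" if "x \<in> ?S" for x
  proof -
    obtain s t where x: "x = (s, t)" by fastforce
    with that have s: "s \<in> {0..1}" and t: "0 \<le> t" "t \<le> 1" by auto
    have "1 - complex_of_real t * z \<noteq> 0" if z: "z \<in># proots (char_poly (W s))" for z
    proof
      assume "1 - complex_of_real t * z = 0"
      then have tz: "complex_of_real t * z = 1" by simp
      then have "t * cmod z = 1" using t by (metis norm_mult norm_of_real abs_of_nonneg norm_one)
      then have "t = 1" using cmod_eigenvalue_isometric[OF W isoW[OF s] z] by simp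
      with tz have "z = 1" by simp
      moreover have "1 \<cdot>\<^sub>m W s = W s" using W[of s] by auto
      ultimately have "Z_det (W s) = 0"
        using det_one_minus_smult[OF W, of 1 s] W[of s] z
        by (simp add: Z_det_def)
      with nzW'[OF s] show False by simp
    qed
    then show ?thesis
      unfolding x F_def prod.case det_one_minus_smult[OF W] by (auto simp: prod_mset_zero_iff)
  qed
  have "convex ?S" by (intro convex_Times) auto
  \<comment> \<open>Taking the logarithm on the whole square, instead of separately for each s,
    makes its value at t = 1 continuous in s.\<close>
  then obtain g where g: "continuous_on ?S g" "\<And>x. x \<in> ?S \<Longrightarrow> F x = exp (g x)"
    using continuous_logarithm_on_contractible[OF cont_F convex_imp_contractible F_nz] by blast
  \<comment> \<open>Since F (s, 0) = 1, subtracting \<open>g (s, 0)\<close> keeps a logarithm of F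
    and normalizes it to 0 at t = 0, as \<open>log_Z_eq_lift\<close> demands.\<close>
  define h where "h s t = g (s, t) - g (s, 0)" for s t
  have exp_h: "exp (h s t) = F (s, t)" if "s \<in> {0..1}" "t \<in> {0..1}" for s t
  proof -
    have "1\<^sub>m (Suc n) - 0 \<cdot>\<^sub>m W s = 1\<^sub>m (Suc n)" using W[of s] by auto
    then have "F (s, 0) = 1" by (simp add: F_def)
    then show ?thesis using g(2)[of "(s, t)"] g(2)[of "(s, 0)"] that by (simp add: h_def exp_diff)
  qed
  have log_W: "log_Z (W s) = h s 1" if s: "s \<in> {0..1}" for s
  proof (rule log_Z_eq_lift[OF W isoW[OF s] nzW'[OF s]])
    have "continuous_on {0..1} (\<lambda>t. g (s, t))"
      by (rule continuous_on_compose2[OF g(1)]) (use s in \<open>auto intro!: continuous_intros\<close>)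
    then show "continuous_on {0..1} (h s)"
      unfolding h_def by (intro continuous_intros)
    show "h s 0 = 0" by (simp add: h_def)
    show "exp (h s t) = Determinant.det (1\<^sub>m (Suc n) - complex_of_real t \<cdot>\<^sub>m W s)" if "t \<in> {0..1}" for t
      using exp_h[OF s that] by (simp add: F_def)
  qed
  have "h 0 1 = Ln (1 - u 0 0) + log_Z V"
  proof (rule exp_lift_unique[of "{0..1::real}" "\<lambda>s. h s 1" "\<lambda>s. Ln (1 - u s 0) + log_Z V" 1])
    have "continuous_on {0..1} (\<lambda>s. g (s, t))" if "t \<in> {0..1}" for t
      by (rule continuous_on_compose2[OF g(1)]) (use that in \<open>auto intro!: continuous_intros\<close>)
    then show "continuous_on {0..1} (\<lambda>s. h s 1)"
      unfolding h_def by (intro continuous_intros) auto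
    show "continuous_on {0..1} (\<lambda>s. Ln (1 - u s 0) + log_Z V)"
      using Re_u0 by (intro continuous_intros cont_u) (force simp: complex_nonpos_Reals_iff)
    show "exp (h s 1) = exp (Ln (1 - u s 0) + log_Z V)" if s: "s \<in> {0..1}" for s
      using log_W[OF s] exp_log_Z[OF W nzW'[OF s]] exp_log_Z[OF V nz] nzW[OF s] u0[OF s]
      by (simp add: exp_add)
    have "W 1 = four_block_mat (mat 1 1 (\<lambda>_. -1)) (0\<^sub>m 1 n) (0\<^sub>m n 1) (1\<^sub>m n) * B"
      unfolding W_def using u(2) by (subst reflection_neg_unit) auto
    also have "\<dots> = four_block_mat (mat 1 1 (\<lambda>_. -1)) (0\<^sub>m 1 n) (0\<^sub>m n 1) V"
      unfolding B_def using V
      by (subst mult_four_block_mat[of _ 1 1 _ n _ n _ _ 1 _ n]) (auto intro!: cong_four_block_mat)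
    finally show "h 1 1 = Ln (1 - u 1 0) + log_Z V"
      using log_W[of 1] u(2) log_Z_neg_one_block[OF V] by simp
  qed auto
  then show ?thesis using log_W[of 0] u(1) by (simp add: W_def B_def)
qed

text \<open>The induction also carries isometry and the nonzero determinant, which the one-step
  formula needs. It starts at dimension 1 because \<open>V_mat m 0\<close> is a dummy.\<close>

lemma log_Z_V_mat:
  assumes sphere: "\<And>k. k \<ge> 1 \<Longrightarrow> m k \<in> sphere_cplx k" and ne: "\<And>k. k \<ge> 1 \<Longrightarrow> m k 0 \<noteq> 1"
  shows "log_Z (V_mat m n) = (\<Sum>k=1..n. Ln (1 - m k 0))"
proof -
  have "isometric_mat (V_mat m (Suc n)) \<and> Z_det (V_mat m (Suc n)) \<noteq> 0 \<and>
    log_Z (V_mat m (Suc n)) = (\<Sum>k=1..Suc n. Ln (1 - m k 0))" for n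
  proof (induction n)
    case 0
    have unit: "(\<Sum>i<1. (cmod (m 1 i))\<^sup>2) = 1" using sphere[of 1] by (simp add: sphere_cplx_def)
    have ne1: "m 1 0 \<noteq> 1" using ne[of 1] by simp
    moreover have "cnj (m 1 0) \<noteq> 1" using ne1 by (metis complex_cnj_cnj complex_cnj_one)
    ultimately have ne1: "m 1 0 \<noteq> 1" "1 - cnj (m 1 0) \<noteq> 0" by simp_all
    have refl: "reflection 1 (m 1) = mat 1 1 (\<lambda>_. m 1 0)"
    proof (rule eq_matI)
      have "m 1 0 * cnj (m 1 0) = 1"
        using unit by (simp only: complex_norm_square[symmetric]) simp
      then have "(m 1 0 - 1) * cnj (m 1 0 - 1) = (1 - m 1 0) * (1 - cnj (m 1 0))" by (simp add: algebra_simps)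
      then have "1 - (m 1 0 - 1) * cnj (m 1 0 - 1) / (1 - cnj (m 1 0)) = m 1 0"
        using ne1 by simp
      then show "reflection 1 (m 1) $$ (i, j) = mat 1 1 (\<lambda>_. m 1 0) $$ (i, j)"
        if "i < dim_row (mat 1 1 (\<lambda>_. m 1 0))" "j < dim_col (mat 1 1 (\<lambda>_. m 1 0))" for i j
        using that by (simp add: reflection_def Let_def)
    qed (auto simp: reflection_def Let_def)
    have "char_poly (reflection 1 (m 1)) = [:- m 1 0, 1:]"
      by (simp add: refl[simplified] char_poly_def char_poly_matrix_def det_single one_pCons)
    then have "log_Z (reflection 1 (m 1)) = Ln (1 - m 1 0)" by (simp add: log_Z_def)
    moreover have "Z_det (reflection 1 (m 1)) \<noteq> 0"
      unfolding refl using ne1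
      by (subst Z_det_def, subst det_single) (auto simp: det_single)
    ultimately show ?case using isometric_reflection[OF _ unit ne1(1)] by simp
  next
    case (Suc n)
    have unit: "(\<Sum>i<Suc (Suc n). (cmod (m (Suc (Suc n)) i))\<^sup>2) = 1"
      using sphere[of "Suc (Suc n)"] by (simp add: sphere_cplx_def)
    have ne1: "m (Suc (Suc n)) 0 \<noteq> 1" using ne by simp
    note V = V_mat_carrier[of m "Suc n"]
    let ?B = "four_block_mat (1\<^sub>m 1) (0\<^sub>m 1 (Suc n)) (0\<^sub>m (Suc n) 1) (V_mat m (Suc n))"
    have B: "?B \<in> carrier_mat (Suc (Suc n)) (Suc (Suc n))"
      using four_block_carrier_mat[OF one_carrier_mat[of 1] V] by simp
    have "isometric_mat (V_mat m (Suc (Suc n)))"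
      using isometric_mult[OF reflection_carrier B isometric_reflection[OF _ unit ne1] isometric_one_block[OF V]] Suc
      by simp
    moreover have "Z_det (V_mat m (Suc (Suc n))) \<noteq> 0"
      using det_one_minus_reflection_mult[OF V, of "m (Suc (Suc n))", OF ne1] Suc ne1
        V V_mat_carrier[of m "Suc (Suc n)"]
      by (simp add: Z_det_def reflection_carrier[THEN carrier_matD(1)])
    moreover have "log_Z (V_mat m (Suc (Suc n))) = (\<Sum>k=1..Suc (Suc n). Ln (1 - m k 0))"
      using log_Z_reflection_mult[OF V _ _ unit ne1] Suc by simp
    ultimately show ?case by blast
  qed
  from this[of "n - 1"] show ?thesis
    by (cases n) (simp_all add: log_Z_def char_poly_def)
qed

section \<open>Moments of a coordinate of a uniform unit vector\<close>

text \<open>The matrix with rows (p, q) and (r, s) acting on the coordinates i and j. Maps of two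
  coordinates suffice for every symmetry needed and decompose into shears.\<close>

definition sl2_map :: "nat \<Rightarrow> nat \<Rightarrow> complex \<Rightarrow> complex \<Rightarrow> complex \<Rightarrow> complex \<Rightarrow> (nat \<Rightarrow> complex) \<Rightarrow> nat \<Rightarrow> complex" where
  "sl2_map i j p q r s c = c(i := p * c i + q * c j, j := r * c i + s * c j)"

lemma measurable_fun_upd_PiM:
  fixes i k :: nat
  assumes f: "f \<in> Pi\<^sub>M {..<k} (\<lambda>_. borel) \<rightarrow>\<^sub>M borel" and i: "i < k"
    and g: "g \<in> Pi\<^sub>M {..<k} (\<lambda>_. borel) \<rightarrow>\<^sub>M Pi\<^sub>M {..<k} (\<lambda>_. borel :: complex measure)"
  shows "(\<lambda>c. (g c)(i := f c)) \<in> Pi\<^sub>M {..<k} (\<lambda>_. borel) \<rightarrow>\<^sub>M Pi\<^sub>M {..<k} (\<lambda>_. borel :: complex measure)"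
proof (rule measurable_PiM_single')
  fix l assume l: "l \<in> {..<k}"
  show "(\<lambda>c. ((g c)(i := f c)) l) \<in> borel_measurable (Pi\<^sub>M {..<k} (\<lambda>_. borel))"
    using f measurable_compose[OF g measurable_component_singleton[OF l]] by (cases "l = i") simp_all
next
  show "(\<lambda>c. (g c)(i := f c)) \<in> space (Pi\<^sub>M {..<k} (\<lambda>_. borel)) \<rightarrow> {..<k} \<rightarrow>\<^sub>E space borel"
    using measurable_space[OF g] i by (auto simp: space_PiM PiE_iff extensional_def)
qed

lemma measurable_sl2_map:
  assumes "i < k" "j < k"
  shows "sl2_map i j p q r s \<in> Pi\<^sub>M {..<k} (\<lambda>_. borel) \<rightarrow>\<^sub>M Pi\<^sub>M {..<k} (\<lambda>_. borel)"
proof -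
  have [measurable]: "(\<lambda>c. c l) \<in> borel_measurable (Pi\<^sub>M {..<k} (\<lambda>_. borel :: complex measure))" if "l < k" for l
    using that by (intro measurable_component_singleton) simp
  show ?thesis
    unfolding sl2_map_def[abs_def] using assms
    by (intro measurable_fun_upd_PiM borel_measurable_add borel_measurable_times) auto
qed

text \<open>When coordinate i is integrated first, c j is fixed and the shear is a
  translation.\<close>

lemma nn_integral_shear:
  fixes i j k :: nat and f :: "(nat \<Rightarrow> complex) \<Rightarrow> ennreal"
  assumes ij: "i < k" "j < k" "i \<noteq> j"
    and f [measurable]: "f \<in> borel_measurable (Pi\<^sub>M {..<k} (\<lambda>_. borel :: complex measure))"
  shows "(\<integral>\<^sup>+c. f (c(i := c i + a * c j)) \<partial>Pi\<^sub>M {..<k} (\<lambda>_. lborel)) = (\<integral>\<^sup>+c. f c \<partial>Pi\<^sub>M {..<k} (\<lambda>_. lborel))"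
proof -
  interpret product_sigma_finite "\<lambda>_::nat. lborel :: complex measure" by standard
  define I where "I = {..<k} - {i}"
  have I: "finite I" "i \<notin> I" "insert i I = {..<k}" using ij by (auto simp: I_def)
  have comp: "(\<lambda>c. c l) \<in> borel_measurable (Pi\<^sub>M {..<k} (\<lambda>_. borel :: complex measure))" if "l < k" for l
    using that by (intro measurable_component_singleton) simp
  have T: "(\<lambda>c. c(i := c i + a * c j)) \<in> Pi\<^sub>M {..<k} (\<lambda>_. borel) \<rightarrow>\<^sub>M Pi\<^sub>M {..<k} (\<lambda>_. borel :: complex measure)"
    using ij by (intro measurable_fun_upd_PiM borel_measurable_add borel_measurable_times comp) auto
  have f1: "f \<in> borel_measurable (Pi\<^sub>M (insert i I) (\<lambda>_. lborel))"
    using f unfolding I(3) by (simp add: measurable_cong_sets[OF sets_PiM_lborel refl])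
  have f2: "(\<lambda>c. f (c(i := c i + a * c j))) \<in> borel_measurable (Pi\<^sub>M (insert i I) (\<lambda>_. lborel))"
    using measurable_compose[OF T f] unfolding I(3) by (simp add: measurable_cong_sets[OF sets_PiM_lborel refl])
  have "(\<integral>\<^sup>+c. f (c(i := c i + a * c j)) \<partial>Pi\<^sub>M (insert i I) (\<lambda>_. lborel)) =
      (\<integral>\<^sup>+x. \<integral>\<^sup>+y. f (x(i := y + a * x j)) \<partial>lborel \<partial>Pi\<^sub>M I (\<lambda>_. lborel))"
    using ij by (subst product_nn_integral_insert[OF I(1,2) f2]) simp
  also have "\<dots> = (\<integral>\<^sup>+x. \<integral>\<^sup>+y. f (x(i := y)) \<partial>lborel \<partial>Pi\<^sub>M I (\<lambda>_. lborel))"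
  proof (rule nn_integral_cong)
    fix x assume x: "x \<in> space (Pi\<^sub>M I (\<lambda>_. lborel :: complex measure))"
    have m: "(\<lambda>y. f (x(i := y))) \<in> borel_measurable lborel"
      using measurable_comp[OF measurable_component_update f1, OF x I(2)] by (simp add: comp_def fun_upd_def)
    have "(\<integral>\<^sup>+y. f (x(i := y)) \<partial>lborel) = (\<integral>\<^sup>+y. f (x(i := y)) \<partial>distr lborel borel ((+) (a * x j)))"
      by (simp add: lborel_distr_plus)
    also have "\<dots> = (\<integral>\<^sup>+y. f (x(i := a * x j + y)) \<partial>lborel)"
      using m by (subst nn_integral_distr) auto
    finally show "(\<integral>\<^sup>+y. f (x(i := y + a * x j)) \<partial>lborel) = (\<integral>\<^sup>+y. f (x(i := y)) \<partial>lborel)"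
      by (simp add: add.commute)
  qed
  also have "\<dots> = (\<integral>\<^sup>+c. f c \<partial>Pi\<^sub>M (insert i I) (\<lambda>_. lborel))"
    by (rule product_nn_integral_insert[OF I(1,2) f1, symmetric])
  finally show ?thesis unfolding I(3) .
qed

(* A matrix of determinant 1 with lower left entry r \<noteq> 0 is a product of three shears. *)
lemma nn_integral_sl2_map:
  fixes i j k :: nat and f :: "(nat \<Rightarrow> complex) \<Rightarrow> ennreal"
  assumes ij: "i < k" "j < k" "i \<noteq> j" and det: "p * s - q * r = 1" and r: "r \<noteq> 0"
    and f: "f \<in> borel_measurable (Pi\<^sub>M {..<k} (\<lambda>_. borel :: complex measure))"
  shows "(\<integral>\<^sup>+c. f (sl2_map i j p q r s c) \<partial>Pi\<^sub>M {..<k} (\<lambda>_. lborel)) = (\<integral>\<^sup>+c. f c \<partial>Pi\<^sub>M {..<k} (\<lambda>_. lborel))"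
proof -
  \<comment> \<open>x and y are read off from the diagonal of the product of the shears with rows
    (1, x), (0, 1), then (1, 0), (r, 1), then (1, y), (0, 1); the entry q follows from the
    determinant.\<close>
  define x where "x = (p - 1) / r"
  define y where "y = (s - 1) / r"
  let ?E = "\<lambda>i j a (c :: nat \<Rightarrow> complex). c(i := c i + a * c j)"
  have comp: "(\<lambda>c. c l) \<in> borel_measurable (Pi\<^sub>M {..<k} (\<lambda>_. borel :: complex measure))" if "l < k" for l
    using that by (intro measurable_component_singleton) simp
  have E: "?E i j a \<in> Pi\<^sub>M {..<k} (\<lambda>_. borel) \<rightarrow>\<^sub>M Pi\<^sub>M {..<k} (\<lambda>_. borel :: complex measure)" if "i < k" "j < k" for i j a
    using that by (intro measurable_fun_upd_PiM borel_measurable_add borel_measurable_times comp) auto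
  have p: "1 + x * r = p" using r by (simp add: x_def)
  have s: "1 + r * y = s" using r by (simp add: y_def)
  have "r * q = r * (y + x * s)"
    using det r by (simp add: x_def y_def field_simps)
  then have q: "y + x * s = q" using r by simp
  have eq: "sl2_map i j p q r s c = ?E i j x (?E j i r (?E i j y c))" for c
  proof
    fix l
    show "sl2_map i j p q r s c l = ?E i j x (?E j i r (?E i j y c)) l"
      unfolding sl2_map_def p[symmetric] q[symmetric] s[symmetric]
      using ij(3) by (auto simp: algebra_simps)
  qed
  have "(\<integral>\<^sup>+c. f (sl2_map i j p q r s c) \<partial>Pi\<^sub>M {..<k} (\<lambda>_. lborel)) =
      (\<integral>\<^sup>+c. f (?E i j x (?E j i r c)) \<partial>Pi\<^sub>M {..<k} (\<lambda>_. lborel))"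
    unfolding eq using ij
    by (intro nn_integral_shear measurable_compose[OF E measurable_compose[OF E f]]) auto
  also have "\<dots> = (\<integral>\<^sup>+c. f (?E i j x c) \<partial>Pi\<^sub>M {..<k} (\<lambda>_. lborel))"
    using ij by (intro nn_integral_shear measurable_compose[OF E f]) auto
  also have "\<dots> = (\<integral>\<^sup>+c. f c \<partial>Pi\<^sub>M {..<k} (\<lambda>_. lborel))"
    using ij by (intro nn_integral_shear f) auto
  finally show ?thesis .
qed

lemma sets_sphere_measure:
  "sets (sphere_measure k) = sets (restrict_space (Pi\<^sub>M {..<k} (\<lambda>_. borel)) (sphere_cplx k))"
  unfolding sphere_measure_def by (intro sets_restrict_space_cong) simp

lemma measurable_sphere_measureI:
  assumes "f \<in> Pi\<^sub>M {..<k} (\<lambda>_. borel) \<rightarrow>\<^sub>M N"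
  shows "f \<in> sphere_measure k \<rightarrow>\<^sub>M N"
  using measurable_restrict_space1[OF assms] by (simp add: measurable_cong_sets[OF sets_sphere_measure refl])

text \<open>Writes the cone measure as a Lebesgue integral over the ball, so that linear symmetries
  of the ball pass to the sphere. The indicator of the sphere is there for c = 0, where the
  normalization divides by zero.\<close>

lemma nn_integral_sphere_measure:
  fixes f :: "(nat \<Rightarrow> complex) \<Rightarrow> ennreal"
  assumes f: "f \<in> borel_measurable (Pi\<^sub>M {..<k} (\<lambda>_. borel))"
  shows "(\<integral>\<^sup>+c. f c \<partial>sphere_measure k) =
    (\<integral>\<^sup>+c. f (normalize_cplx k c) * indicator (sphere_cplx k) (normalize_cplx k c) * indicator (cball_cplx k) c
      \<partial>Pi\<^sub>M {..<k} (\<lambda>_. lborel)) / emeasure (Pi\<^sub>M {..<k} (\<lambda>_. lborel)) (cball_cplx k)"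
proof -
  let ?U = "uniform_measure (Pi\<^sub>M {..<k} (\<lambda>_. lborel)) (cball_cplx k)"
  have N: "normalize_cplx k \<in> ?U \<rightarrow>\<^sub>M Pi\<^sub>M {..<k} (\<lambda>_. borel)"
    using measurable_normalize_cplx by (simp add: measurable_def sets_PiM_lborel space_PiM)
  have g: "(\<lambda>c. f c * indicator (sphere_cplx k) c) \<in> borel_measurable (Pi\<^sub>M {..<k} (\<lambda>_. borel))"
    using f sets_sphere_cplx by (intro borel_measurable_times_ennreal borel_measurable_indicator)
  have "(\<integral>\<^sup>+c. f c \<partial>sphere_measure k) =
      (\<integral>\<^sup>+c. f c * indicator (sphere_cplx k) c \<partial>distr ?U (Pi\<^sub>M {..<k} (\<lambda>_. borel)) (normalize_cplx k))"
    unfolding sphere_measure_def using sets_sphere_cplx by (subst nn_integral_restrict_space) auto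
  also have "\<dots> = (\<integral>\<^sup>+c. f (normalize_cplx k c) * indicator (sphere_cplx k) (normalize_cplx k c) \<partial>?U)"
    using g by (intro nn_integral_distr[OF N]) simp
  also have "\<dots> = (\<integral>\<^sup>+c. f (normalize_cplx k c) * indicator (sphere_cplx k) (normalize_cplx k c) * indicator (cball_cplx k) c
      \<partial>Pi\<^sub>M {..<k} (\<lambda>_. lborel)) / emeasure (Pi\<^sub>M {..<k} (\<lambda>_. lborel)) (cball_cplx k)"
    using measurable_compose[OF measurable_normalize_cplx g]
    by (intro nn_integral_uniform_measure) (simp_all add: measurable_cong_sets[OF sets_PiM_lborel refl] sets_cball_cplx sets_PiM_lborel)
  finally show ?thesis .
qed

section \<open>Unitary invariance of the sphere measure\<close>

text \<open>For |p|^2 + |r|^2 = 1 these are the elements of SU(2): determinant 1 preserves Lebesgue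
  measure, and unitarity preserves the ball and commutes with normalization.\<close>

definition su2_map :: "nat \<Rightarrow> nat \<Rightarrow> complex \<Rightarrow> complex \<Rightarrow> (nat \<Rightarrow> complex) \<Rightarrow> nat \<Rightarrow> complex" where
  "su2_map i j p r = sl2_map i j p (- cnj r) r (cnj p)"

context
  fixes i j k :: nat and p r :: complex
  assumes ij: "i < k" "j < k" "i \<noteq> j" and pr: "(cmod p)\<^sup>2 + (cmod r)\<^sup>2 = 1"
begin

lemma norm_su2_map: "(\<Sum>l<k. (cmod (su2_map i j p r c l))\<^sup>2) = (\<Sum>l<k. (cmod (c l))\<^sup>2)"
proof -
  let ?K = "{..<k} - {i} - {j}"
  have split: "(\<Sum>l<k. g l) = g i + (g j + sum g ?K)" for g :: "nat \<Rightarrow> real"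
    using ij by (simp add: sum.remove[of _ i] sum.remove[of _ j])
  have "complex_of_real ((cmod (p * c i + (- cnj r) * c j))\<^sup>2 + (cmod (r * c i + cnj p * c j))\<^sup>2) =
      complex_of_real (((cmod p)\<^sup>2 + (cmod r)\<^sup>2) * ((cmod (c i))\<^sup>2 + (cmod (c j))\<^sup>2))"
    unfolding of_real_add of_real_mult complex_norm_square by (simp add: algebra_simps)
  then have "(cmod (p * c i + (- cnj r) * c j))\<^sup>2 + (cmod (r * c i + cnj p * c j))\<^sup>2 =
      (cmod (c i))\<^sup>2 + (cmod (c j))\<^sup>2"
    unfolding of_real_eq_iff pr by simp
  then show ?thesis
    unfolding split su2_map_def sl2_map_def using ij(3) by simp
qed

lemma measurable_su2_map: "su2_map i j p r \<in> Pi\<^sub>M {..<k} (\<lambda>_. borel) \<rightarrow>\<^sub>M Pi\<^sub>M {..<k} (\<lambda>_. borel)"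
  unfolding su2_map_def using ij by (intro measurable_sl2_map)

lemma normalize_su2_map: "normalize_cplx k (su2_map i j p r c) = su2_map i j p r (normalize_cplx k c)"
  unfolding normalize_cplx_def norm_su2_map using ij
  by (auto simp: su2_map_def sl2_map_def fun_eq_iff add_divide_distrib diff_divide_distrib)

lemma su2_map_in_iff:
  "su2_map i j p r c \<in> sphere_cplx k \<longleftrightarrow> c \<in> sphere_cplx k"
  "su2_map i j p r c \<in> cball_cplx k \<longleftrightarrow> c \<in> cball_cplx k"
proof -
  have "su2_map i j p r c \<in> extensional {..<k} \<longleftrightarrow> c \<in> extensional {..<k}"
    using ij by (auto simp: su2_map_def sl2_map_def extensional_def)
  then show "su2_map i j p r c \<in> sphere_cplx k \<longleftrightarrow> c \<in> sphere_cplx k"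
    "su2_map i j p r c \<in> cball_cplx k \<longleftrightarrow> c \<in> cball_cplx k"
    unfolding sphere_cplx_def cball_cplx_def by (simp_all add: norm_su2_map PiE_def)
qed

text \<open>Nonnegative integrands give equality of the two image measures, which then covers
  Bochner integrals. The condition on r comes from the factorization into shears.\<close>

lemma integral_su2_map:
  fixes f :: "(nat \<Rightarrow> complex) \<Rightarrow> 'b :: {banach, second_countable_topology}"
  assumes r: "r \<noteq> 0" and f: "f \<in> borel_measurable (Pi\<^sub>M {..<k} (\<lambda>_. borel))"
  shows "(\<integral>c. f (su2_map i j p r c) \<partial>sphere_measure k) = (\<integral>c. f c \<partial>sphere_measure k)"
proof -
  let ?B = "Pi\<^sub>M {..<k} (\<lambda>_. borel :: complex measure)"
  let ?U = "su2_map i j p r"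
  have det: "p * cnj p - (- cnj r) * r = 1"
  proof -
    have "p * cnj p + r * cnj r = complex_of_real ((cmod p)\<^sup>2 + (cmod r)\<^sup>2)"
      unfolding of_real_add complex_norm_square ..
    then show ?thesis unfolding pr by (simp add: mult.commute)
  qed
  have U: "?U \<in> sphere_measure k \<rightarrow>\<^sub>M ?B" "(\<lambda>c. c) \<in> sphere_measure k \<rightarrow>\<^sub>M ?B"
    by (intro measurable_sphere_measureI measurable_su2_map measurable_ident_sets refl)+
  have nn: "(\<integral>\<^sup>+c. g (?U c) \<partial>sphere_measure k) = (\<integral>\<^sup>+c. g c \<partial>sphere_measure k)"
    if g: "g \<in> borel_measurable ?B" for g :: "(nat \<Rightarrow> complex) \<Rightarrow> ennreal"
  proof -
    define h where "h c = g (normalize_cplx k c) * indicator (sphere_cplx k) (normalize_cplx k c) * indicator (cball_cplx k) c" for c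
    have h: "h \<in> borel_measurable ?B"
      unfolding h_def using sets_sphere_cplx sets_cball_cplx
      by (intro borel_measurable_times_ennreal measurable_compose[OF measurable_normalize_cplx] g borel_measurable_indicator)
    have "h (?U c) = g (?U (normalize_cplx k c)) * indicator (sphere_cplx k) (normalize_cplx k c) * indicator (cball_cplx k) c" for c
      by (simp add: h_def normalize_su2_map su2_map_in_iff indicator_def)
    moreover have "(\<integral>\<^sup>+c. h (?U c) \<partial>Pi\<^sub>M {..<k} (\<lambda>_. lborel)) = (\<integral>\<^sup>+c. h c \<partial>Pi\<^sub>M {..<k} (\<lambda>_. lborel))"
      unfolding su2_map_def by (rule nn_integral_sl2_map[OF ij det r h])
    ultimately show ?thesis
      unfolding nn_integral_sphere_measure[OF g] nn_integral_sphere_measure[OF measurable_compose[OF measurable_su2_map g]]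
      by (simp add: h_def)
  qed
  have "distr (sphere_measure k) ?B ?U = distr (sphere_measure k) ?B (\<lambda>c. c)"
  proof (rule measure_eqI)
    fix A assume "A \<in> sets (distr (sphere_measure k) ?B ?U)"
    then have A: "A \<in> sets ?B" by simp
    have "emeasure (distr (sphere_measure k) ?B ?U) A = (\<integral>\<^sup>+c. indicator A c \<partial>distr (sphere_measure k) ?B ?U)"
      using A by simp
    also have "\<dots> = (\<integral>\<^sup>+c. indicator A (?U c) \<partial>sphere_measure k)"
      using A by (intro nn_integral_distr[OF U(1)]) simp
    also have "\<dots> = (\<integral>\<^sup>+c. indicator A c \<partial>sphere_measure k)" using A by (intro nn) simp
    also have "\<dots> = (\<integral>\<^sup>+c. indicator A c \<partial>distr (sphere_measure k) ?B (\<lambda>c. c))"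
      using A by (intro nn_integral_distr[OF U(2), symmetric]) simp
    also have "\<dots> = emeasure (distr (sphere_measure k) ?B (\<lambda>c. c)) A"
      using A by simp
    finally show "emeasure (distr (sphere_measure k) ?B ?U) A = emeasure (distr (sphere_measure k) ?B (\<lambda>c. c)) A" .
  qed simp
  then show ?thesis using integral_distr[OF U(1) f] integral_distr[OF U(2) f] by simp
qed

end

lemma measurable_coord:
  assumes "l < k"
  shows "(\<lambda>c. c l) \<in> borel_measurable (Pi\<^sub>M {..<k} (\<lambda>_. borel :: complex measure))"
    "(\<lambda>c. c l) \<in> borel_measurable (sphere_measure k)"
proof -
  show "(\<lambda>c. c l) \<in> borel_measurable (Pi\<^sub>M {..<k} (\<lambda>_. borel :: complex measure))"
    using assms by (intro measurable_component_singleton) simp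
  then show "(\<lambda>c. c l) \<in> borel_measurable (sphere_measure k)" by (rule measurable_sphere_measureI)
qed

lemma cmod_coord_le_1:
  assumes "c \<in> space (sphere_measure k)" "l < k"
  shows "cmod (c l) \<le> 1"
proof -
  have "(cmod (c l))\<^sup>2 \<le> (\<Sum>i<k. (cmod (c i))\<^sup>2)"
    using assms by (intro member_le_sum) auto
  also have "\<dots> = 1" using assms(1) by (simp add: space_sphere_measure sphere_cplx_def)
  finally show ?thesis by (simp add: power_le_one_iff abs_square_le_1)
qed

lemma integrable_sphere_measure:
  fixes f :: "(nat \<Rightarrow> complex) \<Rightarrow> 'b :: {banach, second_countable_topology}"
  assumes k: "1 \<le> k" and f: "f \<in> borel_measurable (Pi\<^sub>M {..<k} (\<lambda>_. borel))"
    and bound: "\<And>c. c \<in> space (sphere_measure k) \<Longrightarrow> norm (f c) \<le> B"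
  shows "integrable (sphere_measure k) f"
proof -
  interpret prob_space "sphere_measure k" by (rule prob_space_sphere_measure[OF k])
  show ?thesis
    by (rule integrable_const_bound[of _ B]) (auto intro: bound measurable_sphere_measureI f)
qed

section \<open>Phase invariance and moments of a coordinate\<close>

lemma integral_phase_coord:
  fixes f :: "complex \<Rightarrow> 'b :: {banach, second_countable_topology}"
  assumes j: "0 < j" "j < k" and w: "cmod w = 1" and f: "f \<in> borel_measurable borel"
  shows "(\<integral>c. f (w * c j) \<partial>sphere_measure k) = (\<integral>c. f (c 0) \<partial>sphere_measure k)"
proof -
  have "(\<lambda>c. f (c 0)) \<in> borel_measurable (Pi\<^sub>M {..<k} (\<lambda>_. borel))"
    using j by (intro measurable_compose[OF measurable_coord(1) f]) simp
  \<comment> \<open>With p = 0 and r = - cnj w, the new coordinate 0 is w * c j.\<close>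
  then have "(\<integral>c. f (su2_map 0 j 0 (- cnj w) c 0) \<partial>sphere_measure k) = (\<integral>c. f (c 0) \<partial>sphere_measure k)"
    using j w by (intro integral_su2_map[where f = "\<lambda>c. f (c 0)"]) auto
  then show ?thesis using j by (simp add: su2_map_def sl2_map_def)
qed

text \<open>A diagonal matrix has lower left entry 0 and is outside \<open>integral_su2_map\<close>.
  Therefore both sides are compared with an integral over the coordinate 1.\<close>

lemma integral_phase_invariant:
  fixes f :: "complex \<Rightarrow> 'b :: {banach, second_countable_topology}"
  assumes k: "2 \<le> k" and w: "cmod w = 1" and f: "f \<in> borel_measurable borel"
  shows "(\<integral>c. f (w * c 0) \<partial>sphere_measure k) = (\<integral>c. f (c 0) \<partial>sphere_measure k)"
proof -
  have "(\<lambda>z. f (w * z)) \<in> borel_measurable borel"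
    by (rule measurable_compose[OF _ f]) simp
  from integral_phase_coord[OF _ _ _ this, of 1 k 1] integral_phase_coord[OF _ _ w f, of 1 k] k
  show ?thesis by simp
qed

text \<open>All k coordinates have the same second moment, and these add up to 1.\<close>

lemma integral_cmod_sq_coord:
  assumes k: "2 \<le> k"
  shows "(\<integral>c. (cmod (c 0))\<^sup>2 \<partial>sphere_measure k) = 1 / real k"
proof -
  interpret prob_space "sphere_measure k" by (rule prob_space_sphere_measure) (use k in simp)
  have int: "integrable (sphere_measure k) (\<lambda>c. (cmod (c l))\<^sup>2)" if "l < k" for l
  proof (rule integrable_sphere_measure[where B = 1])
    show "norm ((cmod (c l))\<^sup>2) \<le> 1" if "c \<in> space (sphere_measure k)" for c
      using cmod_coord_le_1[OF that \<open>l < k\<close>] by (simp add: power_le_one)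
  qed (use k measurable_coord(1)[OF that] in simp_all)
  have eq: "(\<integral>c. (cmod (c l))\<^sup>2 \<partial>sphere_measure k) = (\<integral>c. (cmod (c 0))\<^sup>2 \<partial>sphere_measure k)" if "l < k" for l
  proof (cases "l = 0")
    case False
    then show ?thesis using integral_phase_coord[of l k 1 "\<lambda>z. (cmod z)\<^sup>2"] that by simp
  qed simp
  have "(\<Sum>l<k. \<integral>c. (cmod (c l))\<^sup>2 \<partial>sphere_measure k) = (\<Sum>l<k. \<integral>c. (cmod (c 0))\<^sup>2 \<partial>sphere_measure k)"
    by (rule sum.cong[OF refl], rule eq) simp
  then have "real k * (\<integral>c. (cmod (c 0))\<^sup>2 \<partial>sphere_measure k) = (\<Sum>l<k. \<integral>c. (cmod (c l))\<^sup>2 \<partial>sphere_measure k)"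
    by simp
  also have "\<dots> = (\<integral>c. (\<Sum>l<k. (cmod (c l))\<^sup>2) \<partial>sphere_measure k)"
    using int by (intro Bochner_Integration.integral_sum[symmetric]) auto
  also have "\<dots> = (\<integral>c. 1 \<partial>sphere_measure k)"
    by (intro Bochner_Integration.integral_cong) (auto simp: space_sphere_measure sphere_cplx_def)
  also have "\<dots> = 1" by (simp add: prob_space)
  finally show ?thesis using k by (simp add: field_simps)
qed

(* Averaging over the rotations of (c_0, c_1) by angles pi/4 and -pi/4 bounds E |c_0|^4 by
   3 E |c_0|^2 |c_1|^2, and k - 1 copies of the latter fit into E |c_0|^2. *)
lemma integral_cmod_pow4_coord:
  assumes k: "2 \<le> k"
  shows "(\<integral>c. (cmod (c 0)) ^ 4 \<partial>sphere_measure k) \<le> 6 / (real k)\<^sup>2"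
proof -
  let ?s = "sphere_measure k"
  interpret prob_space ?s by (rule prob_space_sphere_measure) (use k in simp)
  note c0 = measurable_coord[of 0 k] and c1 = measurable_coord[of 1 k]
  have k0: "0 < k" "1 < k" "1 \<le> k" using k by auto
  have m [measurable]: "(\<lambda>c. c 0) \<in> borel_measurable (Pi\<^sub>M {..<k} (\<lambda>_. borel :: complex measure))"
    "(\<lambda>c. c 1) \<in> borel_measurable (Pi\<^sub>M {..<k} (\<lambda>_. borel :: complex measure))"
    using c0 c1 k0 by auto
  have le1: "cmod (c l) \<le> 1" if "c \<in> space ?s" "l < k" for c l
    using cmod_coord_le_1 that .
  define A where "A = (\<integral>c. (cmod (c 0)) ^ 4 \<partial>?s)"
  define D where "D = (\<integral>c. (cmod (c 0))\<^sup>2 * (cmod (c 1))\<^sup>2 \<partial>?s)"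
  define h :: complex where "h = complex_of_real (sqrt 2 / 2)"
  have h2: "(cmod h)\<^sup>2 = 1 / 2" by (simp add: h_def power_divide norm_divide norm_mult)
  have h4: "cmod h ^ 4 = 1 / 4"
  proof -
    have "cmod h ^ 4 = ((cmod h)\<^sup>2)\<^sup>2" by (simp flip: power_mult)
    then show ?thesis by (simp add: h2 power_divide)
  qed
  have hne: "h \<noteq> 0" "cnj h = h" by (simp_all add: h_def)
  have int4: "integrable ?s (\<lambda>c. (cmod (c l)) ^ 4)" if "l < k" for l
  proof (rule integrable_sphere_measure[where B = 1])
    show "norm ((cmod (c l)) ^ 4) \<le> 1" if "c \<in> space ?s" for c
      using le1[OF that \<open>l < k\<close>] by (simp add: power_le_one)
  qed (use k measurable_coord(1)[OF that] in simp_all)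
  have int22: "integrable ?s (\<lambda>c. (cmod (c 0))\<^sup>2 * (cmod (c l))\<^sup>2)" if "l < k" for l
  proof (rule integrable_sphere_measure[where B = 1])
    show "norm ((cmod (c 0))\<^sup>2 * (cmod (c l))\<^sup>2) \<le> 1" if "c \<in> space ?s" for c
      using le1[OF that \<open>l < k\<close>] le1[OF that k0(1)] by (simp add: mult_le_one power_le_one)
  qed (use k0 measurable_coord(1)[OF that] in simp_all)
  have rot: "(\<integral>c. (cmod (h * c 0 - cnj r * c 1)) ^ 4 \<partial>?s) = A" if r: "cmod r = cmod h" for r
  proof -
    have "(\<integral>c. (cmod (su2_map 0 1 h r c 0)) ^ 4 \<partial>?s) = A"
      unfolding A_def by (rule integral_su2_map[where f = "\<lambda>c. (cmod (c 0)) ^ 4"]) (use k0 r hne h2 in auto)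
    then show ?thesis by (simp add: su2_map_def sl2_map_def)
  qed
  have rot_int: "integrable ?s (\<lambda>c. (cmod (h * c 0 - cnj r * c 1)) ^ 4)" if "cmod r = cmod h" for r
  proof (rule integrable_sphere_measure[OF k0(3), where B = "(cmod h + cmod h) ^ 4"])
    fix c assume c: "c \<in> space ?s"
    have "cmod (h * c 0 - cnj r * c 1) \<le> cmod (h * c 0) + cmod (cnj r * c 1)" by (rule norm_triangle_ineq4)
    also have "\<dots> \<le> cmod h * 1 + cmod h * 1"
      unfolding norm_mult complex_mod_cnj that using c k0 by (intro add_mono mult_left_mono le1) auto
    finally show "norm ((cmod (h * c 0 - cnj r * c 1)) ^ 4) \<le> (cmod h + cmod h) ^ 4"
      using power_mono[of _ "cmod h + cmod h" 4] by simp
  next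
    show "(\<lambda>c. cmod (h * c 0 - cnj r * c 1) ^ 4) \<in> borel_measurable (Pi\<^sub>M {..<k} (\<lambda>_. borel))"
      by measurable
  qed
  have A1: "(\<integral>c. (cmod (c 1)) ^ 4 \<partial>?s) = A"
    using integral_phase_coord[of 1 k 1 "\<lambda>z. (cmod z) ^ 4"] k0 by (simp add: A_def)
  \<comment> \<open>With a = |x|^2, b = |y|^2 and u = Re (x cnj y), the left side is (a + b)^2 / 2 +
    2 u^2, and u^2 \<le> a b.\<close>
  have pw: "(cmod (h * x - cnj h * y)) ^ 4 + (cmod (h * x - cnj (- h) * y)) ^ 4
      \<le> 1 / 2 * (cmod x) ^ 4 + 1 / 2 * (cmod y) ^ 4 + 3 * ((cmod x)\<^sup>2 * (cmod y)\<^sup>2)" for x y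
  proof -
    define u where "u = Re (x * cnj y)"
    have sq: "(cmod (x - y))\<^sup>2 = (cmod x)\<^sup>2 + (cmod y)\<^sup>2 - 2 * u"
      "(cmod (x + y))\<^sup>2 = (cmod x)\<^sup>2 + (cmod y)\<^sup>2 + 2 * u"
      unfolding cmod_power2 u_def by (simp_all add: power2_eq_square algebra_simps)
    have u2: "u\<^sup>2 \<le> (cmod x)\<^sup>2 * (cmod y)\<^sup>2"
    proof -
      have "\<bar>u\<bar> \<le> cmod x * cmod y" unfolding u_def by (metis abs_Re_le_cmod complex_mod_cnj norm_mult)
      then have "\<bar>u\<bar>\<^sup>2 \<le> (cmod x * cmod y)\<^sup>2" by (intro power_mono) auto
      then show ?thesis by (simp add: power_mult_distrib)
    qed
    have e4: "(cmod (h * x - cnj h * y)) ^ 4 = 1 / 4 * ((cmod (x - y))\<^sup>2)\<^sup>2"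
      "(cmod (h * x - cnj (- h) * y)) ^ 4 = 1 / 4 * ((cmod (x + y))\<^sup>2)\<^sup>2"
      using hne(2) h4 by (simp_all add: norm_mult power_mult_distrib flip: power_mult right_diff_distrib distrib_left)
    have p4: "cmod x ^ 4 = ((cmod x)\<^sup>2)\<^sup>2" "cmod y ^ 4 = ((cmod y)\<^sup>2)\<^sup>2" by (simp_all flip: power_mult)
    have "1 / 4 * (a + b - 2 * u)\<^sup>2 + 1 / 4 * (a + b + 2 * u)\<^sup>2 \<le> 1 / 2 * a\<^sup>2 + 1 / 2 * b\<^sup>2 + 3 * (a * b)"
      if "u\<^sup>2 \<le> a * b" for a b :: real
      using that by (simp add: power2_eq_square algebra_simps)
    from this[OF u2] show ?thesis unfolding e4 p4 sq .
  qed
  have "A + A = (\<integral>c. (cmod (h * c 0 - cnj h * c 1)) ^ 4 + (cmod (h * c 0 - cnj (- h) * c 1)) ^ 4 \<partial>?s)"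
    using rot[of h] rot[of "- h"] rot_int[of h] rot_int[of "- h"] by simp
  also have "\<dots> \<le> (\<integral>c. 1 / 2 * (cmod (c 0)) ^ 4 + 1 / 2 * (cmod (c 1)) ^ 4 + 3 * ((cmod (c 0))\<^sup>2 * (cmod (c 1))\<^sup>2) \<partial>?s)"
    using rot_int[of h] rot_int[of "- h"] int4 int22 k0 by (intro integral_mono pw) auto
  also have "\<dots> = 1 / 2 * A + 1 / 2 * A + 3 * D"
    using int4 int22[of 1] k0 A1 by (simp add: A_def D_def)
  finally have A_le: "A \<le> 3 * D" by simp
  have D_eq: "(\<integral>c. (cmod (c 0))\<^sup>2 * (cmod (c l))\<^sup>2 \<partial>?s) = D" if l: "0 < l" "l < k" for l
  proof (cases "l = 1")
    case False
    have "(\<integral>c. (cmod (su2_map 1 l 0 1 c 0))\<^sup>2 * (cmod (su2_map 1 l 0 1 c 1))\<^sup>2 \<partial>?s) = D"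
      unfolding D_def
      by (rule integral_su2_map[where f = "\<lambda>c. (cmod (c 0))\<^sup>2 * (cmod (c 1))\<^sup>2"]) (use k0 l False in auto)
    then show ?thesis using False l by (simp add: su2_map_def sl2_map_def)
  qed (simp add: D_def)
  have "(real k - 1) * D = (\<Sum>l\<in>{1..<k}. \<integral>c. (cmod (c 0))\<^sup>2 * (cmod (c l))\<^sup>2 \<partial>?s)"
  proof -
    have "(\<Sum>l\<in>{1..<k}. \<integral>c. (cmod (c 0))\<^sup>2 * (cmod (c l))\<^sup>2 \<partial>?s) = (\<Sum>l\<in>{1..<k}. D)"
      by (rule sum.cong[OF refl], rule D_eq) auto
    then show ?thesis using k0 by (simp add: of_nat_diff)
  qed
  also have "\<dots> = (\<integral>c. (\<Sum>l\<in>{1..<k}. (cmod (c 0))\<^sup>2 * (cmod (c l))\<^sup>2) \<partial>?s)"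
    using int22 by (intro Bochner_Integration.integral_sum[symmetric]) auto
  also have "\<dots> \<le> (\<integral>c. (cmod (c 0))\<^sup>2 \<partial>?s)"
  proof (rule integral_mono)
    show "integrable ?s (\<lambda>c. \<Sum>l\<in>{1..<k}. (cmod (c 0))\<^sup>2 * (cmod (c l))\<^sup>2)"
      using int22 by (intro Bochner_Integration.integrable_sum) auto
    show "integrable ?s (\<lambda>c. (cmod (c 0))\<^sup>2)"
    proof (rule integrable_sphere_measure[where B = 1])
      show "norm ((cmod (c 0))\<^sup>2) \<le> 1" if "c \<in> space ?s" for c
        using le1[OF that k0(1)] by (simp add: power_le_one)
    qed (use k0 in simp_all)
    fix c assume c: "c \<in> space ?s"
    have "(\<Sum>l\<in>{1..<k}. (cmod (c 0))\<^sup>2 * (cmod (c l))\<^sup>2) = (cmod (c 0))\<^sup>2 * (\<Sum>l\<in>{1..<k}. (cmod (c l))\<^sup>2)"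
      by (simp add: sum_distrib_left)
    also have "(\<Sum>l\<in>{1..<k}. (cmod (c l))\<^sup>2) \<le> (\<Sum>l<k. (cmod (c l))\<^sup>2)"
      by (intro sum_mono2) auto
    also have "\<dots> = 1" using c by (simp add: space_sphere_measure sphere_cplx_def)
    finally show "(\<Sum>l\<in>{1..<k}. (cmod (c 0))\<^sup>2 * (cmod (c l))\<^sup>2) \<le> (cmod (c 0))\<^sup>2" by (simp add: mult_left_mono)
  qed
  also have "\<dots> = 1 / real k" by (rule integral_cmod_sq_coord[OF k])
  finally have "(real k - 1) * D \<le> 1 / real k" .
  then have D_le: "D \<le> 1 / (real k * (real k - 1))" using k by (simp add: field_simps)
  \<comment> \<open>This turns 3 / (k (k - 1)) into 6 / k^2.\<close>
  have "real k \<le> 2 * (real k - 1)" using k by simp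
  then have "(real k)\<^sup>2 \<le> 2 * (real k * (real k - 1))" by (simp add: power2_eq_square mult_left_mono)
  then have "1 / (real k * (real k - 1)) \<le> 2 / (real k)\<^sup>2"
    using k by (simp add: field_simps)
  with A_le D_le show ?thesis by (simp add: A_def)
qed

text \<open>A phase w with w^(n - m) = -1 reverses the sign of the integrand, respects the
  truncation and keeps the integral.\<close>

lemma integral_cnj_power_mult_power_coord:
  assumes k: "2 \<le> k" and ne: "m \<noteq> n"
  shows "(\<integral>c. (if cmod (c 0) \<le> \<rho> then cnj (c 0) ^ m * c 0 ^ n else 0) \<partial>sphere_measure k) = 0" (is "?I = 0")
proof -
  let ?f = "\<lambda>z. if cmod z \<le> \<rho> then cnj z ^ m * z ^ n else 0"
  define w where "w = cis (pi / (real n - real m))"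
  have w: "cmod w = 1" by (simp add: w_def)
  have "cnj w ^ m * w ^ n = cis (real n * (pi / (real n - real m)) - real m * (pi / (real n - real m)))"
    unfolding w_def cis_cnj Complex.DeMoivre cis_mult by (simp add: algebra_simps)
  also have "real n * (pi / (real n - real m)) - real m * (pi / (real n - real m)) = pi"
    using ne unfolding left_diff_distrib[symmetric] by simp
  finally have wm: "cnj w ^ m * w ^ n = -1" by simp
  have "?f \<in> borel_measurable borel"
    by (intro measurable_If borel_measurable_continuous_onI continuous_intros borel_measurable_le
        pred_sets2 borel_measurable_const)
  then have "?I = (\<integral>c. ?f (w * c 0) \<partial>sphere_measure k)"
    by (rule integral_phase_invariant[OF k w, symmetric])
  also have "\<dots> = (\<integral>c. (cnj w ^ m * w ^ n) * ?f (c 0) \<partial>sphere_measure k)"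
    by (intro Bochner_Integration.integral_cong) (auto simp: norm_mult w power_mult_distrib)
  also have "\<dots> = - ?I" unfolding wm by simp
  finally show ?thesis by simp
qed

section \<open>The moment generating function of one summand\<close>

text \<open>On |z| \<le> 1/2 the partial sums are bounded by 2 B, so they can be integrated term by
  term. Phase invariance kills the terms with n \<noteq> m, and \<open>b m = 0\<close> the remaining
  one.\<close>

lemma integral_cnj_power_mult_series_eq_0:
  fixes f :: "complex \<Rightarrow> complex"
  assumes k: "2 \<le> k" and f: "\<And>z. cmod z \<le> 1 / 2 \<Longrightarrow> (\<lambda>n. b n * z ^ n) sums f z"
    and B: "\<And>n. cmod (b n) \<le> B" and m: "b m = 0"
  defines "F \<equiv> \<lambda>c :: nat \<Rightarrow> complex. if cmod (c 0) \<le> 1 / 2 then cnj (c 0) ^ m * f (c 0) else 0"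
  shows "integrable (sphere_measure k) F" "(\<integral>c. F c \<partial>sphere_measure k) = 0"
proof -
  let ?s = "sphere_measure k"
  interpret prob_space ?s by (rule prob_space_sphere_measure) (use k in simp)
  have c0 [measurable]: "(\<lambda>c. c 0) \<in> borel_measurable ?s" using measurable_coord(2)[of 0 k] k by simp
  define p where "p n c = (if cmod (c 0) \<le> 1 / 2 then cnj (c 0) ^ m * c 0 ^ n else 0)" for n and c :: "nat \<Rightarrow> complex"
  define S where "S N c = (\<Sum>n<N. b n * p n c)" for N c
  have [measurable]: "cnj \<in> borel_measurable borel"
    by (intro borel_measurable_continuous_onI continuous_intros)
  have p_meas [measurable]: "p n \<in> borel_measurable ?s" for n unfolding p_def by measurable
  have p_bound: "cmod (p n c) \<le> (1 / 2) ^ n" for n c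
  proof (cases "cmod (c 0) \<le> 1 / 2")
    case True
    then have "cmod (c 0) ^ m * cmod (c 0) ^ n \<le> 1 * (1 / 2) ^ n"
      by (intro mult_mono power_le_one power_mono) auto
    then show ?thesis using True by (simp add: p_def norm_mult norm_power)
  qed (simp add: p_def)
  have p_int: "integrable ?s (p n)" for n
    by (rule integrable_const_bound[of _ "(1 / 2) ^ n"]) (auto simp: p_bound)
  have S_bound: "cmod (S N c) \<le> B * 2" for N c
  proof -
    have B0: "0 \<le> B" using B[of 0] norm_ge_zero order.trans by blast
    have "cmod (S N c) \<le> (\<Sum>n<N. B * (1 / 2) ^ n)"
      unfolding S_def by (intro order.trans[OF norm_sum] sum_mono) (auto simp: norm_mult intro!: mult_mono B p_bound B0)
    also have "\<dots> = B * (\<Sum>n<N. (1 / 2) ^ n)" by (simp add: sum_distrib_left)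
    also have "(\<Sum>n<N. (1 / 2 :: real) ^ n) \<le> (\<Sum>n. (1 / 2) ^ n)"
      by (intro sum_le_suminf summable_geometric) auto
    also have "\<dots> = 2" by (subst suminf_geometric) auto
    finally show ?thesis using B0 by (simp add: mult_left_mono)
  qed
  have S_lim: "(\<lambda>N. S N c) \<longlonglongrightarrow> F c" for c
  proof (cases "cmod (c 0) \<le> 1 / 2")
    case True
    have "(\<lambda>N. cnj (c 0) ^ m * (\<Sum>n<N. b n * c 0 ^ n)) \<longlonglongrightarrow> cnj (c 0) ^ m * f (c 0)"
      using f[OF True] unfolding sums_def by (intro tendsto_mult tendsto_const)
    then show ?thesis using True by (simp add: S_def p_def F_def sum_distrib_left mult_ac)
  qed (simp add: S_def p_def F_def)
  have S_meas: "S N \<in> borel_measurable ?s" for N unfolding S_def by measurable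
  have F_meas: "F \<in> borel_measurable ?s" by (rule borel_measurable_LIMSEQ_metric[OF S_meas S_lim])
  show "integrable ?s F"
  proof (rule integrable_const_bound[of _ "B * 2"])
    have "cmod (F c) \<le> B * 2" for c
      using tendsto_norm[OF S_lim[of c]] S_bound by (intro LIMSEQ_le_const2) auto
    then show "AE c in ?s. cmod (F c) \<le> B * 2" by simp
  qed (rule F_meas)
  have "(\<lambda>N. \<integral>c. S N c \<partial>?s) \<longlonglongrightarrow> (\<integral>c. F c \<partial>?s)"
    by (rule integral_dominated_convergence[where w = "\<lambda>_. B * 2"]) (use F_meas S_meas S_lim S_bound in auto)
  moreover have "(\<integral>c. S N c \<partial>?s) = 0" for N
  proof -
    have "(\<integral>c. S N c \<partial>?s) = (\<Sum>n<N. \<integral>c. b n * p n c \<partial>?s)"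
      unfolding S_def using p_int by (intro Bochner_Integration.integral_sum) auto
    also have "\<dots> = (\<Sum>n<N. 0)"
    proof (rule sum.cong)
      fix n
      show "(\<integral>c. b n * p n c \<partial>?s) = 0"
        using integral_cnj_power_mult_power_coord[OF k, of m n "1 / 2"] m by (cases "m = n") (auto simp: p_def)
    qed simp
    finally show ?thesis by simp
  qed
  ultimately show "(\<integral>c. F c \<partial>?s) = 0" by (simp add: LIMSEQ_const_iff)
qed

text \<open>Successive coefficients have a ratio of modulus at most 1, and the coefficient at 1 is
  a. Keeping the factor |a| is what later gives the error terms a factor t^2.\<close>

lemma norm_gbinomial_Suc_le:
  fixes a :: complex
  assumes "cmod a \<le> 1"
  shows "cmod (a gchoose Suc n) \<le> cmod a"
proof (induction n)
  case (Suc n)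
  have "a gchoose Suc (Suc n) = (a gchoose Suc n) * ((a - of_nat (Suc n)) / of_nat (Suc (Suc n)))"
    by (simp add: gbinomial_prod_rev field_simps)
  moreover have "cmod (a - of_nat (Suc n)) \<le> real (Suc (Suc n))"
  proof -
    have "cmod (of_nat (Suc n)) = real (Suc n)" by (rule norm_of_nat)
    then show ?thesis using norm_triangle_ineq4[of a "of_nat (Suc n)"] assms by linarith
  qed
  then have "cmod ((a - of_nat (Suc n)) / of_nat (Suc (Suc n))) \<le> 1"
    by (simp add: norm_divide del: of_nat_Suc)
  ultimately have "cmod (a gchoose Suc (Suc n)) \<le> cmod (a gchoose Suc n)"
    by (simp only: norm_mult mult_left_le norm_ge_zero)
  with Suc show ?case by linarith
qed simp

text \<open>The binomial series without its orders 0 and 1. These stay in the series as zero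
  coefficients, ready for pairing with the powers 0 and 1 of cnj z; the factor 2 is the geometric
  series at 1/2.\<close>

lemma powr_series_tail:
  fixes a z :: complex
  assumes a: "cmod a \<le> 1" and z: "cmod z \<le> 1 / 2"
  defines "b \<equiv> \<lambda>n. if n < 2 then 0 else (-1) ^ n * (a gchoose n)"
    and "h \<equiv> (1 - z) powr a - 1 + a * z"
  shows "(\<lambda>n. b n * z ^ n) sums h" "cmod (b n) \<le> cmod a" "cmod h \<le> 2 * cmod a * (cmod z)\<^sup>2"
proof -
  show b: "cmod (b n) \<le> cmod a" for n
    using norm_gbinomial_Suc_le[OF a, of "n - 1"] by (cases n) (auto simp: b_def norm_mult norm_power)
  have "(\<lambda>n. (a gchoose n) * (- z) ^ n) sums (1 + - z) powr a"
    using z by (intro gen_binomial_complex) auto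
  then have "(\<lambda>n. (a gchoose n) * (- z) ^ n - (if n < 2 then (a gchoose n) * (- z) ^ n else 0)) sums
      ((1 - z) powr a - (\<Sum>n | n < 2. (a gchoose n) * (- z) ^ n))"
    by (intro sums_diff) (auto intro!: sums_If_finite)
  moreover have "(\<Sum>n | n < 2. (a gchoose n) * (- z) ^ n) = 1 - a * z"
  proof -
    have "{n :: nat. n < 2} = {0, 1}" by auto
    then show ?thesis by simp
  qed
  moreover have "(\<lambda>n. (a gchoose n) * (- z) ^ n - (if n < 2 then (a gchoose n) * (- z) ^ n else 0)) = (\<lambda>n. b n * z ^ n)"
    by (auto simp: b_def power_minus[of z] fun_eq_iff)
  ultimately show sums: "(\<lambda>n. b n * z ^ n) sums h" by (simp add: h_def algebra_simps)
  have "(\<lambda>n. b (n + 2) * z ^ (n + 2)) sums h"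
  proof -
    have "(\<Sum>n<2. b n * z ^ n) = 0" by (simp add: b_def)
    then show ?thesis using sums_split_initial_segment[OF sums, of 2] by simp
  qed
  moreover have geo: "(\<lambda>n. cmod a * (cmod z)\<^sup>2 * (1 / 2) ^ n) sums (cmod a * (cmod z)\<^sup>2 * 2)"
    using sums_mult[OF geometric_sums[of "1 / 2 :: real"]] by simp
  ultimately have "cmod h \<le> cmod a * (cmod z)\<^sup>2 * 2"
  proof (rule norm_sums_le)
    fix n
    have "cmod (b (n + 2)) * (cmod z ^ 2 * cmod z ^ n) \<le> cmod a * (cmod z ^ 2 * (1 / 2) ^ n)"
      using z by (intro mult_mono b power_mono) auto
    then show "cmod (b (n + 2) * z ^ (n + 2)) \<le> cmod a * (cmod z)\<^sup>2 * (1 / 2) ^ n"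
      by (simp only: norm_mult norm_power power_add mult_ac)
  qed
  then show "cmod h \<le> 2 * cmod a * (cmod z)\<^sup>2" by (simp add: mult_ac)
qed

text \<open>\<alpha> = 1 selects the real part and \<alpha> = -i the imaginary part. The cut at 1/2
  keeps the value bounded and the power series uniformly convergent.\<close>

definition trunc_log :: "complex \<Rightarrow> complex \<Rightarrow> real" where
  "trunc_log \<alpha> z = (if cmod z \<le> 1 / 2 then Re (\<alpha> * Ln (1 - z)) else 0)"

text \<open>Halving the exponent makes the exponential the squared modulus of a function that is
  analytic in z.\<close>

lemma exp_trunc_log:
  assumes "cmod z \<le> 1 / 2"
  shows "exp (t * trunc_log \<alpha> z) = (cmod ((1 - z) powr (of_real t * \<alpha> / 2)))\<^sup>2"
proof -
  have "z \<noteq> 1" using assms by auto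
  then show ?thesis
    using assms by (simp add: trunc_log_def powr_def exp_double[symmetric] algebra_simps)
qed

(* With a = t alpha / 2, exp (t trunc_log) is |1 - a z + h z|^2, and the phase invariance of c 0 removes
   all mixed terms from the expectation. *)
lemma integral_exp_trunc_log:
  assumes k: "2 \<le> k" and \<alpha>: "cmod \<alpha> = 1" and t: "\<bar>t\<bar> \<le> 2"
  defines "e \<equiv> (\<integral>c. exp (t * trunc_log \<alpha> (c 0)) \<partial>sphere_measure k)"
  shows "1 \<le> e" "1 + t\<^sup>2 / 4 * (1 / real k - 24 / (real k)\<^sup>2) \<le> e" "e \<le> 1 + t\<^sup>2 / 4 * (1 / real k + 24 / (real k)\<^sup>2)"
proof -
  let ?s = "sphere_measure k"
  interpret prob_space ?s by (rule prob_space_sphere_measure) (use k in simp)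
  have c0 [measurable]: "(\<lambda>c. c 0) \<in> borel_measurable ?s" using measurable_coord(2)[of 0 k] k by simp
  define a where "a = of_real t * \<alpha> / 2"
  have a: "cmod a = \<bar>t\<bar> / 2" "cmod a \<le> 1" using \<alpha> t by (simp_all add: a_def norm_mult norm_divide)
  have a2: "(cmod a)\<^sup>2 = t\<^sup>2 / 4" by (simp add: a power_divide)
  define b where "b = (\<lambda>n. if n < 2 then 0 else (-1) ^ n * (a gchoose n))"
  define h where "h z = (1 - z) powr a - 1 + a * z" for z
  define I :: "(nat \<Rightarrow> complex) \<Rightarrow> real" where "I c = (if cmod (c 0) \<le> 1 / 2 then 1 else 0)" for c
  have I [measurable]: "I \<in> borel_measurable ?s" unfolding I_def by measurable
  have I01: "0 \<le> I c" "I c \<le> 1" for c by (auto simp: I_def)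
  define F where "F m c = (if cmod (c 0) \<le> 1 / 2 then cnj (c 0) ^ m * h (c 0) else 0)" for m and c :: "nat \<Rightarrow> complex"
  have F: "integrable ?s (F m)" "(\<integral>c. F m c \<partial>?s) = 0" if "m < 2" for m
  proof -
    have sums: "(\<lambda>n. b n * z ^ n) sums h z" if "cmod z \<le> 1 / 2" for z
      unfolding b_def h_def by (rule powr_series_tail(1)[OF a(2) that])
    have b: "cmod (b n) \<le> cmod a" for n
      unfolding b_def by (rule powr_series_tail(2)[OF a(2), of 0]) simp
    have bm: "b m = 0" using that by (simp add: b_def)
    show "integrable ?s (F m)" "(\<integral>c. F m c \<partial>?s) = 0"
      unfolding F_def using integral_cnj_power_mult_series_eq_0[OF k sums b bm] by auto
  qed
  define p where "p c = (if cmod (c 0) \<le> 1 / 2 then c 0 else 0)" for c :: "nat \<Rightarrow> complex"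
  have p: "integrable ?s p"
  proof (rule integrable_const_bound[of _ "1 / 2"])
    show "p \<in> borel_measurable ?s" unfolding p_def by measurable
  qed (simp add: p_def)
  have p0: "(\<integral>c. p c \<partial>?s) = 0"
    unfolding p_def using integral_cnj_power_mult_power_coord[OF k, of 0 1 "1 / 2"] by (simp cong: if_cong)
  have I_int: "integrable ?s (\<lambda>c. I c * (cmod (c 0))\<^sup>2)"
    by (rule integrable_const_bound[of _ 1]) (auto simp: I_def power_le_one)
  have h_le: "I c * (cmod (h (c 0)))\<^sup>2 \<le> t\<^sup>2 * (cmod (c 0)) ^ 4" for c
  proof (cases "cmod (c 0) \<le> 1 / 2")
    case True
    have "cmod (h (c 0)) \<le> \<bar>t\<bar> * (cmod (c 0))\<^sup>2"
      using powr_series_tail(3)[OF a(2) True] a(1) by (simp add: h_def)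
    then have "(cmod (h (c 0)))\<^sup>2 \<le> (\<bar>t\<bar> * (cmod (c 0))\<^sup>2)\<^sup>2" by (intro power_mono) auto
    then show ?thesis using True by (simp add: I_def power_mult_distrib flip: power_mult)
  qed (simp add: I_def)
  have int4: "integrable ?s (\<lambda>c. (cmod (c 0)) ^ 4)"
  proof (rule integrable_sphere_measure[where B = 1])
    show "norm ((cmod (c 0)) ^ 4) \<le> 1" if "c \<in> space ?s" for c
      using cmod_coord_le_1[OF that, of 0] k by (simp add: power_le_one)
  qed (use k measurable_coord(1)[of 0 k] in simp_all)
  have h_int: "integrable ?s (\<lambda>c. I c * (cmod (h (c 0)))\<^sup>2)"
  proof (rule Bochner_Integration.integrable_bound[OF integrable_mult_right[OF int4, of "t\<^sup>2"]])
    have "(\<lambda>c. (cmod (F 0 c))\<^sup>2) \<in> borel_measurable ?s"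
      using borel_measurable_integrable[OF F(1)[of 0]] by measurable
    then show "(\<lambda>c. I c * (cmod (h (c 0)))\<^sup>2) \<in> borel_measurable ?s"
      by (rule measurable_cong[THEN iffD1, rotated]) (simp add: F_def I_def)
  qed (use h_le I01 in auto)
  have pw: "exp (t * trunc_log \<alpha> (c 0)) = 1 + (cmod a)\<^sup>2 * (I c * (cmod (c 0))\<^sup>2) +
      I c * (cmod (h (c 0)))\<^sup>2 - 2 * Re (a * p c) + 2 * Re (F 0 c - cnj a * F 1 c)" for c
  proof (cases "cmod (c 0) \<le> 1 / 2")
    case True
    have "exp (t * trunc_log \<alpha> (c 0)) = (cmod (1 - a * c 0 + h (c 0)))\<^sup>2"
      unfolding exp_trunc_log[OF True] a_def[symmetric] by (simp add: h_def)
    also have "\<dots> = 1 + (cmod (a * c 0))\<^sup>2 + (cmod (h (c 0)))\<^sup>2 - 2 * Re (a * c 0)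
        + 2 * Re (h (c 0) - cnj a * (cnj (c 0) * h (c 0)))"
      unfolding cmod_power2 by (simp add: power2_eq_square algebra_simps)
    finally show ?thesis using True by (simp add: I_def p_def F_def norm_mult power_mult_distrib)
  qed (simp add: trunc_log_def I_def p_def F_def)
  \<comment> \<open>\<open>r\<close> collects the linear term and the products of \<open>h\<close>
    with 1 and with cnj z; all of them have mean 0.\<close>
  define r where "r c = 2 * (F 0 c - cnj a * F 1 c) - 2 * (a * p c)" for c
  have r: "integrable ?s r" "(\<integral>c. r c \<partial>?s) = 0"
    unfolding r_def using p p0 F[of 0] F[of 1] by auto
  have r_Re: "integrable ?s (\<lambda>c. Re (r c))" "(\<integral>c. Re (r c) \<partial>?s) = 0"
    using integrable_Re[OF r(1)] integral_Re[OF r(1)] r(2) by simp_all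
  have pw': "exp (t * trunc_log \<alpha> (c 0)) = 1 + (cmod a)\<^sup>2 * (I c * (cmod (c 0))\<^sup>2) +
      I c * (cmod (h (c 0)))\<^sup>2 + Re (r c)" for c
    unfolding pw r_def by simp
  have E: "e = 1 + (cmod a)\<^sup>2 * (\<integral>c. I c * (cmod (c 0))\<^sup>2 \<partial>?s) + (\<integral>c. I c * (cmod (h (c 0)))\<^sup>2 \<partial>?s)"
    unfolding e_def pw' using I_int h_int r_Re by (simp add: prob_space)
  have m4: "(\<integral>c. (cmod (c 0)) ^ 4 \<partial>?s) \<le> 6 / (real k)\<^sup>2" by (rule integral_cmod_pow4_coord[OF k])
  have int2: "integrable ?s (\<lambda>c. (cmod (c 0))\<^sup>2)"
  proof (rule integrable_sphere_measure[where B = 1])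
    show "norm ((cmod (c 0))\<^sup>2) \<le> 1" if "c \<in> space ?s" for c
      using cmod_coord_le_1[OF that, of 0] k by (simp add: power_le_one)
  qed (use k measurable_coord(1)[of 0 k] in simp_all)
  have h_nonneg: "0 \<le> (\<integral>c. I c * (cmod (h (c 0)))\<^sup>2 \<partial>?s)" using I01 by (intro integral_nonneg_AE) auto
  have I_nonneg: "0 \<le> (\<integral>c. I c * (cmod (c 0))\<^sup>2 \<partial>?s)" using I01 by (intro integral_nonneg_AE) auto
  show "1 \<le> e" unfolding E using h_nonneg I_nonneg by simp
  have I_le: "(\<integral>c. I c * (cmod (c 0))\<^sup>2 \<partial>?s) \<le> 1 / real k"
    unfolding integral_cmod_sq_coord[OF k, symmetric]
    by (intro integral_mono I_int int2) (use I01 in \<open>simp add: mult_left_le_one_le\<close>)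
  have I_ge: "1 / real k - 24 / (real k)\<^sup>2 \<le> (\<integral>c. I c * (cmod (c 0))\<^sup>2 \<partial>?s)"
  proof -
    \<comment> \<open>Outside the truncation |z|^2 \<le> 4 |z|^4, so with the fourth moment the loss
      is at most 4 * 6 / k^2; this is the constant 24.\<close>
    have "(cmod (c 0))\<^sup>2 - 4 * (cmod (c 0)) ^ 4 \<le> I c * (cmod (c 0))\<^sup>2" for c
    proof (cases "cmod (c 0) \<le> 1 / 2")
      case False
      then have "1 / 2 * (1 / 2) \<le> cmod (c 0) * cmod (c 0)" by (intro mult_mono) auto
      then have "1 * (cmod (c 0))\<^sup>2 \<le> (4 * (cmod (c 0))\<^sup>2) * (cmod (c 0))\<^sup>2"
        by (intro mult_right_mono) (auto simp: power2_eq_square)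
      then show ?thesis using False by (simp add: I_def mult.assoc flip: power_add)
    qed (simp add: I_def)
    then have "(\<integral>c. (cmod (c 0))\<^sup>2 - 4 * (cmod (c 0)) ^ 4 \<partial>?s) \<le> (\<integral>c. I c * (cmod (c 0))\<^sup>2 \<partial>?s)"
      using int2 int4 I_int by (intro integral_mono) auto
    also have "(\<integral>c. (cmod (c 0))\<^sup>2 - 4 * (cmod (c 0)) ^ 4 \<partial>?s) = 1 / real k - 4 * (\<integral>c. (cmod (c 0)) ^ 4 \<partial>?s)"
      using int2 int4 integral_cmod_sq_coord[OF k] by simp
    finally show ?thesis using m4 by simp
  qed
  have "t\<^sup>2 / 4 * (1 / real k - 24 / (real k)\<^sup>2) \<le> t\<^sup>2 / 4 * (\<integral>c. I c * (cmod (c 0))\<^sup>2 \<partial>?s)"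
    using I_ge by (intro mult_left_mono) auto
  then show "1 + t\<^sup>2 / 4 * (1 / real k - 24 / (real k)\<^sup>2) \<le> e"
    unfolding E a2 using h_nonneg by linarith
  have "(\<integral>c. I c * (cmod (h (c 0)))\<^sup>2 \<partial>?s) \<le> (\<integral>c. t\<^sup>2 * (cmod (c 0)) ^ 4 \<partial>?s)"
    using int4 h_int h_le by (intro integral_mono) auto
  also have "\<dots> \<le> t\<^sup>2 * (6 / (real k)\<^sup>2)" using mult_left_mono[OF m4, of "t\<^sup>2"] by simp
  also have "\<dots> = t\<^sup>2 / 4 * (24 / (real k)\<^sup>2)" by simp
  finally have "(\<integral>c. I c * (cmod (h (c 0)))\<^sup>2 \<partial>?s) \<le> t\<^sup>2 / 4 * (24 / (real k)\<^sup>2)" .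
  moreover have "t\<^sup>2 / 4 * (\<integral>c. I c * (cmod (c 0))\<^sup>2 \<partial>?s) \<le> t\<^sup>2 / 4 * (1 / real k)"
    using I_le by (intro mult_left_mono) auto
  ultimately show "e \<le> 1 + t\<^sup>2 / 4 * (1 / real k + 24 / (real k)\<^sup>2)"
    unfolding E a2 distrib_left by linarith
qed

section \<open>Exceptional events and multiplicative bounds\<close>

text \<open>If the normalized coordinate is 1, the coordinate before normalization is real, and the
  real line is a null set of the plane.\<close>

lemma AE_sphere_measure_coord_ne_1:
  assumes k: "1 \<le> k"
  shows "AE c in sphere_measure k. c 0 \<noteq> 1"
proof -
  let ?L = "Pi\<^sub>M {..<k} (\<lambda>_. lborel :: complex measure)"
  let ?B = "Pi\<^sub>M {..<k} (\<lambda>_. borel :: complex measure)"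
  define A where "A = {c \<in> space ?B. c 0 = 1}"
  define D where "D = Pi\<^sub>E {..<k} (\<lambda>i. if i = 0 then {z :: complex. Im z = 0} else UNIV)"
  have [measurable]: "(\<lambda>c. c 0) \<in> borel_measurable ?B" using measurable_coord(1)[of 0 k] k by simp
  have A: "A \<in> sets ?B" unfolding A_def by measurable
  have closed: "closed {z :: complex. Im z = 0}" by (intro closed_Collect_eq continuous_intros)
  have "negligible {z :: complex. z \<bullet> \<i> = 0}" by (intro negligible_standard_hyperplane) (simp add: Basis_complex_def)
  then have "emeasure lebesgue {z :: complex. Im z = 0} = 0"
    by (simp add: negligible_iff_null_sets inner_complex_def null_sets_def)
  then have null: "emeasure lborel {z :: complex. Im z = 0} = 0" using closed by simp
  have "emeasure ?L D = (\<Prod>i<k. emeasure lborel (if i = 0 then {z :: complex. Im z = 0} else UNIV))"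
    unfolding D_def using closed by (intro emeasure_PiM_lborel) auto
  also have "\<dots> = 0" using k null by (intro prod_zero) (auto intro!: bexI[of _ 0])
  finally have D0: "emeasure ?L D = 0" .
  have D: "D \<in> sets ?L"
    unfolding D_def using closed by (intro sets_PiM_I_finite) auto
  have "(\<integral>\<^sup>+c. indicator A (normalize_cplx k c) * indicator (sphere_cplx k) (normalize_cplx k c) * indicator (cball_cplx k) c \<partial>?L)
      \<le> (\<integral>\<^sup>+c. indicator D c \<partial>?L)"
  proof (rule nn_integral_mono)
    fix c assume c: "c \<in> space ?L"
    have "c \<in> D" if "normalize_cplx k c \<in> A"
    proof -
      define r where "r = sqrt (\<Sum>j<k. (cmod (c j))\<^sup>2)"
      have eq: "c 0 / complex_of_real r = 1" using that k by (simp add: A_def normalize_cplx_def r_def)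
      then have "c 0 = complex_of_real r" by (cases "r = 0") auto
      then have "Im (c 0) = 0" by simp
      then show ?thesis using c by (auto simp: D_def space_PiM PiE_iff)
    qed
    then show "indicator A (normalize_cplx k c) * indicator (sphere_cplx k) (normalize_cplx k c) * indicator (cball_cplx k) c
        \<le> (indicator D c :: ennreal)"
      by (auto simp: indicator_def)
  qed
  also have "\<dots> = 0" using D D0 by simp
  finally have "(\<integral>\<^sup>+c. indicator A c \<partial>sphere_measure k) = 0"
    using A by (subst nn_integral_sphere_measure) auto
  then have "AE c in sphere_measure k. indicator A c = (0 :: ennreal)"
    by (subst (asm) nn_integral_0_iff_AE) (intro measurable_sphere_measureI borel_measurable_indicator A)
  then show ?thesis using AE_space
  proof eventually_elim
    case (elim c)
    have "c \<in> space ?B" using elim(2) by (auto simp: space_sphere_measure sphere_cplx_def space_PiM)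
    with elim(1) show ?case by (auto simp: A_def indicator_def)
  qed
qed

text \<open>Markov's inequality for the fourth power, with 16 * 6 = 96. The second moment would only
  give order 1 / k, which is not summable.\<close>

lemma prob_coord_gt_half:
  assumes k: "2 \<le> k"
  shows "measure (sphere_measure k) {c \<in> space (sphere_measure k). 1 / 2 < cmod (c 0)} \<le> 96 / (real k)\<^sup>2"
proof -
  let ?s = "sphere_measure k"
  interpret prob_space ?s by (rule prob_space_sphere_measure) (use k in simp)
  have [measurable]: "(\<lambda>c. c 0) \<in> borel_measurable ?s" using measurable_coord(2)[of 0 k] k by simp
  have int4: "integrable ?s (\<lambda>c. (cmod (c 0)) ^ 4)"
  proof (rule integrable_sphere_measure[where B = 1])
    show "norm ((cmod (c 0)) ^ 4) \<le> 1" if "c \<in> space ?s" for c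
      using cmod_coord_le_1[OF that, of 0] k by (simp add: power_le_one)
  qed (use k measurable_coord(1)[of 0 k] in simp_all)
  let ?A = "{c \<in> space ?s. 1 / 2 < cmod (c 0)}"
  have "prob ?A = expectation (indicator ?A)" by simp
  also have "\<dots> \<le> expectation (\<lambda>c. 16 * (cmod (c 0)) ^ 4)"
  proof (rule integral_mono)
    fix c :: "nat \<Rightarrow> complex"
    have "(1 / 2) ^ 4 \<le> (cmod (c 0)) ^ 4" if "1 / 2 < cmod (c 0)"
      using that by (intro power_mono) auto
    then show "indicator ?A c \<le> 16 * (cmod (c 0)) ^ 4" by (auto simp: indicator_def power_divide)
  qed (use int4 in \<open>auto simp: less_top[symmetric]\<close>)
  also have "\<dots> = 16 * expectation (\<lambda>c. (cmod (c 0)) ^ 4)" by simp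
  also have "\<dots> \<le> 16 * (6 / (real k)\<^sup>2)" by (intro mult_left_mono integral_cmod_pow4_coord[OF k]) simp
  finally show ?thesis by simp
qed

text \<open>A crude bound, by 1 for ln |1 - z| and by pi for the argument; it serves
  integrability.\<close>

lemma trunc_log_bound:
  assumes "cmod \<alpha> = 1"
  shows "\<bar>trunc_log \<alpha> z\<bar> \<le> 1 + pi"
proof (cases "cmod z \<le> 1 / 2")
  case True
  have "cmod (1 - z) \<ge> 1 / 2" using norm_triangle_ineq2[of 1 z] True by simp
  moreover have "cmod (1 - z) \<le> 2" using norm_triangle_ineq4[of 1 z] True by simp
  moreover have "0 < cmod (1 - z)" using \<open>cmod (1 - z) \<ge> 1 / 2\<close> by linarith
  ultimately have "ln (1 / 2) \<le> ln (cmod (1 - z))" "ln (cmod (1 - z)) \<le> ln 2"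
    by (subst ln_le_cancel_iff; simp)+
  then have "\<bar>ln (cmod (1 - z))\<bar> \<le> 1" using ln_2_less_1 by (simp add: ln_div)
  moreover have ne: "1 - z \<noteq> 0" using True by auto
  ultimately have "\<bar>Re (Ln (1 - z))\<bar> \<le> 1" by simp
  moreover have "\<bar>Im (Ln (1 - z))\<bar> \<le> pi" using Im_Ln_le_pi[OF ne] mpi_less_Im_Ln[OF ne] by simp
  ultimately have "cmod (Ln (1 - z)) \<le> 1 + pi" using cmod_le[of "Ln (1 - z)"] by linarith
  then have "\<bar>Re (\<alpha> * Ln (1 - z))\<bar> \<le> 1 + pi"
    using abs_Re_le_cmod[of "\<alpha> * Ln (1 - z)"] assms by (simp add: norm_mult)
  then show ?thesis using True by (simp add: trunc_log_def)
qed (simp add: trunc_log_def)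

lemma measurable_trunc_log [measurable]: "trunc_log \<alpha> \<in> borel_measurable borel"
proof -
  have "(\<lambda>z. Ln (1 - z)) \<in> borel_measurable borel" by measurable
  then show ?thesis unfolding trunc_log_def[abs_def] by measurable
qed

text \<open>Exponential form, so that the bounds multiply over independent summands. The constant 7
  is 24 / 4 = 6 plus room for the quadratic term in ln (1 + x) \<ge> x - x^2.\<close>

lemma exp_trunc_log_bounds:
  assumes k: "1 \<le> k" and \<alpha>: "cmod \<alpha> = 1" and t: "\<bar>t\<bar> \<le> 1"
  defines "e \<equiv> (\<integral>c. exp (t * trunc_log \<alpha> (c 0)) \<partial>sphere_measure k)"
  shows "exp (t\<^sup>2 / 4 * (1 / real k) - 7 / (real k)\<^sup>2) \<le> e" "e \<le> exp (t\<^sup>2 / 4 * (1 / real k) + 7 / (real k)\<^sup>2)"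
proof -
  have t2: "t\<^sup>2 \<le> 1" using t by (simp add: abs_square_le_1)
  have "exp (t\<^sup>2 / 4 * (1 / real k) - 7 / (real k)\<^sup>2) \<le> e \<and> e \<le> exp (t\<^sup>2 / 4 * (1 / real k) + 7 / (real k)\<^sup>2)"
  proof (cases "k = 1")
    \<comment> \<open>In dimension 1 the coordinate has modulus 1, so the truncated logarithm is 0
      throughout.\<close>
    case True
    interpret prob_space "sphere_measure k" by (rule prob_space_sphere_measure[OF k])
    have "e = (\<integral>c. 1 \<partial>sphere_measure k)"
      unfolding e_def
    proof (rule Bochner_Integration.integral_cong)
      fix c assume "c \<in> space (sphere_measure k)"
      then have "(cmod (c 0))\<^sup>2 = 1" using True by (simp add: space_sphere_measure sphere_cplx_def)
      then have "cmod (c 0) = 1" by (simp add: power2_eq_1_iff) (use norm_ge_zero[of "c 0"] in linarith)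
      then show "exp (t * trunc_log \<alpha> (c 0)) = 1" by (simp add: trunc_log_def)
    qed simp
    then have "e = 1" by (simp add: prob_space)
    then show ?thesis using True t2 by simp
  next
    case False
    then have k2: "2 \<le> k" using k by simp
    note e = integral_exp_trunc_log[OF k2 \<alpha>, of t, folded e_def]
    have t': "\<bar>t\<bar> \<le> 2" using t by simp
    define y where "y = 1 / real k"
    have y: "0 < y" "y \<le> 1" using k by (simp_all add: y_def)
    have yk: "1 / real k = y" "24 / (real k)\<^sup>2 = 24 * y\<^sup>2" "7 / (real k)\<^sup>2 = 7 * y\<^sup>2"
      by (simp_all add: y_def power_divide)
    have ty: "t\<^sup>2 * y\<^sup>2 \<le> 1 * y\<^sup>2" using t2 by (intro mult_right_mono) auto
    have "e \<le> 1 + t\<^sup>2 / 4 * (y + 24 * y\<^sup>2)" using e(3)[OF t'] by (simp add: yk)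
    also have "\<dots> \<le> exp (t\<^sup>2 / 4 * (y + 24 * y\<^sup>2))" by (rule exp_ge_add_one_self)
    also have "\<dots> \<le> exp (t\<^sup>2 / 4 * y + 7 * y\<^sup>2)"
    proof -
      have "t\<^sup>2 / 4 * (y + 24 * y\<^sup>2) = t\<^sup>2 / 4 * y + 6 * (t\<^sup>2 * y\<^sup>2)" by (simp add: algebra_simps)
      with ty zero_le_power2[of y] show ?thesis by (subst exp_le_cancel_iff) linarith
    qed
    finally have upper: "e \<le> exp (t\<^sup>2 / 4 * y + 7 * y\<^sup>2)" .
    define x where "x = t\<^sup>2 / 4 * (y - 24 * y\<^sup>2)"
    have x_eq: "x = t\<^sup>2 / 4 * y - 6 * (t\<^sup>2 * y\<^sup>2)" by (simp add: x_def algebra_simps)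
    have lower: "exp (t\<^sup>2 / 4 * y - 7 * y\<^sup>2) \<le> e"
    proof (cases "0 \<le> x")
      case True
      have "x \<le> t\<^sup>2 / 4 * y" unfolding x_eq by simp
      also have "\<dots> \<le> 1 / 4 * y" using t2 y by (intro mult_right_mono) auto
      finally have xy: "x \<le> y / 4" by simp
      then have "x\<^sup>2 \<le> (y / 4)\<^sup>2" using True by (intro power_mono) auto
      then have x2: "x\<^sup>2 \<le> y\<^sup>2 / 16" by (simp add: power_divide)
      have "x \<le> 1" using xy y by simp
      then have "x - x\<^sup>2 \<le> ln (1 + x)" using True by (intro ln_one_plus_pos_lower_bound)
      moreover have "t\<^sup>2 / 4 * y - 7 * y\<^sup>2 \<le> x - x\<^sup>2" using x2 ty zero_le_power2[of y] x_eq by linarith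
      ultimately have "exp (t\<^sup>2 / 4 * y - 7 * y\<^sup>2) \<le> exp (ln (1 + x))" by (subst exp_le_cancel_iff) linarith
      also have "\<dots> = 1 + x" using True by simp
      also have "\<dots> \<le> e" using e(2)[OF t'] by (simp add: yk x_def)
      finally show ?thesis .
    next
      \<comment> \<open>A negative x leaves no use for the logarithm bound, but then the left side
        is below 1, and e is at least 1.\<close>
      case False
      then have "t\<^sup>2 / 4 * y - 7 * y\<^sup>2 \<le> 0" unfolding x_eq using ty zero_le_power2[of y] by linarith
      then have "exp (t\<^sup>2 / 4 * y - 7 * y\<^sup>2) \<le> 1" by simp
      then show ?thesis using e(1)[OF t'] by linarith
    qed
    show ?thesis unfolding yk using lower upper by simp
  qed
  then show "exp (t\<^sup>2 / 4 * (1 / real k) - 7 / (real k)\<^sup>2) \<le> e" "e \<le> exp (t\<^sup>2 / 4 * (1 / real k) + 7 / (real k)\<^sup>2)" by auto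
qed

section \<open>A law of the iterated logarithm\<close>

text \<open>By independence and 1 - p \<le> exp (- p), the probability that nothing happens from n
  on is at most the exponential of minus any partial sum of a divergent series.\<close>

lemma (in prob_space) borel_cantelli_indep_vars:
  fixes D :: "nat \<Rightarrow> 'a \<Rightarrow> real"
  assumes indep: "indep_vars (\<lambda>_. borel) D UNIV"
    and div: "\<not> summable (\<lambda>j. prob {\<omega>\<in>space M. x j \<le> D j \<omega>})"
  shows "AE \<omega> in M. \<exists>\<^sub>F j in sequentially. x j \<le> D j \<omega>"
proof -
  define p where "p j = prob {\<omega>\<in>space M. x j \<le> D j \<omega>}" for j
  have meas [measurable]: "D j \<in> borel_measurable M" for j
    using indep by (auto simp: indep_vars_def)
  have "AE \<omega> in M. \<exists>j\<ge>n. x j \<le> D j \<omega>" for n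
  proof -
    define F where "F = {\<omega>\<in>space M. \<forall>j\<ge>n. D j \<omega> < x j}"
    have F [measurable]: "F \<in> events" unfolding F_def by measurable
    have bound: "prob F \<le> exp (- (\<Sum>j\<in>{n..<n + Suc K}. p j))" for K
    proof -
      let ?J = "{n..<n + Suc K}"
      have "prob F \<le> prob (\<Inter>j\<in>?J. D j -` {..<x j} \<inter> space M)"
        by (intro finite_measure_mono) (auto simp: F_def)
      also have "\<dots> = (\<Prod>j\<in>?J. prob (D j -` {..<x j} \<inter> space M))"
        by (rule indep_varsD[OF indep]) auto
      also have "\<dots> = (\<Prod>j\<in>?J. 1 - p j)"
      proof (rule prod.cong)
        fix j
        have "D j -` {..<x j} \<inter> space M = space M - {\<omega>\<in>space M. x j \<le> D j \<omega>}" by auto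
        then show "prob (D j -` {..<x j} \<inter> space M) = 1 - p j"
          by (simp add: p_def prob_compl)
      qed simp
      also have "\<dots> \<le> (\<Prod>j\<in>?J. exp (- p j))"
        using exp_ge_add_one_self[of "- p _"] by (intro prod_mono) (auto simp: p_def)
      also have "\<dots> = exp (- (\<Sum>j\<in>?J. p j))" by (simp add: exp_sum sum_negf[symmetric] del: sum.op_ivl_Suc)
      finally show ?thesis .
    qed
    have "prob F \<le> e" if "e > 0" for e
    proof (rule ccontr)
      assume "\<not> prob F \<le> e"
      then have lt: "e < exp (- (\<Sum>j\<in>{n..<n + Suc K}. p j))" for K
        using bound[of K] by linarith
      have bnd: "(\<Sum>j\<in>{n..<n + Suc K}. p j) \<le> - ln e" for K
        using lt[of K] that ln_less_cancel_iff[of e "exp (- (\<Sum>j\<in>{n..<n + Suc K}. p j))"]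
        by (simp del: sum.op_ivl_Suc ln_less_cancel_iff)
      have "(\<Sum>j<K. p j) \<le> (\<Sum>j<n. p j) - ln e" for K
      proof -
        have "(\<Sum>j<K. p j) \<le> (\<Sum>j\<in>{..<n} \<union> {n..<n + Suc K}. p j)"
          by (intro sum_mono2) (auto simp: p_def)
        also have "\<dots> = (\<Sum>j<n. p j) + (\<Sum>j\<in>{n..<n + Suc K}. p j)"
          by (rule sum.union_disjoint) auto
        finally show ?thesis using bnd[of K] by linarith
      qed
      then have "summable p"
        by (intro summableI_nonneg_bounded[of p "(\<Sum>j<n. p j) - ln e"]) (auto simp: p_def)
      with div show False by (simp add: p_def[abs_def])
    qed
    then have "prob F \<le> 0" by (rule field_le_epsilon[of _ 0, simplified])
    then have "prob F = 0" by (simp add: measure_le_0_iff)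
    then have "AE \<omega> in M. \<omega> \<notin> F" by (intro AE_not_in) (auto simp: emeasure_eq_measure)
    then show ?thesis using AE_space by eventually_elim (auto simp: F_def not_less)
  qed
  then have "AE \<omega> in M. \<forall>n. \<exists>j\<ge>n. x j \<le> D j \<omega>" by (subst AE_all_countable) auto
  then show ?thesis by eventually_elim (auto simp: frequently_sequentially)
qed

(* Splitting at Y = (1 - d) t v and Y = (1 + d) t v, the two outer parts of E exp (t Y) are negligible
   by exponential tilting, so the tail event carries half of it. *)
lemma (in prob_space) prob_ge_of_mgf_bounds:
  fixes Y :: "'a \<Rightarrow> real"
  assumes Y [measurable]: "Y \<in> borel_measurable M"
    and int: "\<And>u. integrable M (\<lambda>\<omega>. exp (u * Y \<omega>))"
    and C: "C \<ge> 1" and t: "0 < t" and d: "0 < d" "d < 1" and v: "0 \<le> v"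
    and upper: "\<And>u. 0 < u \<Longrightarrow> u \<le> (1 + d) * t \<Longrightarrow> expectation (\<lambda>\<omega>. exp (u * Y \<omega>)) \<le> C * exp (u\<^sup>2 * v / 2)"
    and lower: "exp (t\<^sup>2 * v / 2) / C \<le> expectation (\<lambda>\<omega>. exp (t * Y \<omega>))"
    and large: "exp (- (d\<^sup>2 * (t\<^sup>2 * v / 2))) \<le> 1 / (4 * C\<^sup>2)"
  shows "exp (- ((1 + 2 * d) * (t\<^sup>2 * v / 2))) / (2 * C) \<le> prob {\<omega>\<in>space M. (1 - d) * t * v \<le> Y \<omega>}"
proof -
  define q where "q = t\<^sup>2 * v / 2"
  let ?T = "{\<omega>\<in>space M. (1 - d) * t * v \<le> Y \<omega>}"
  have pw: "exp (t * Y \<omega>) \<le> exp (d * t * ((1 - d) * t * v)) * exp ((1 - d) * t * Y \<omega>) +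
      exp (- (d * t * ((1 + d) * t * v))) * exp ((1 + d) * t * Y \<omega>) +
      exp (t * ((1 + d) * t * v)) * indicator ?T \<omega>" if "\<omega> \<in> space M" for \<omega>
  proof -
    consider "Y \<omega> \<le> (1 - d) * t * v" | "(1 + d) * t * v \<le> Y \<omega>"
      | "(1 - d) * t * v \<le> Y \<omega>" "Y \<omega> \<le> (1 + d) * t * v" by linarith
    then show ?thesis
    proof cases
      case 1
      then have "d * t * Y \<omega> \<le> d * t * ((1 - d) * t * v)" using d t by (intro mult_left_mono) auto
      then have "t * Y \<omega> \<le> d * t * ((1 - d) * t * v) + (1 - d) * t * Y \<omega>" by (simp add: algebra_simps)
      then have "exp (t * Y \<omega>) \<le> exp (d * t * ((1 - d) * t * v)) * exp ((1 - d) * t * Y \<omega>)"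
        by (simp flip: exp_add)
      then show ?thesis by (simp add: add_increasing2 indicator_def)
    next
      case 2
      then have "d * t * Y \<omega> \<ge> d * t * ((1 + d) * t * v)" using d t by (intro mult_left_mono) auto
      then have "t * Y \<omega> \<le> - (d * t * ((1 + d) * t * v)) + (1 + d) * t * Y \<omega>" by (simp add: algebra_simps)
      then have "exp (t * Y \<omega>) \<le> exp (- (d * t * ((1 + d) * t * v))) * exp ((1 + d) * t * Y \<omega>)"
        by (simp flip: exp_add)
      then show ?thesis by (simp add: add_increasing add_increasing2 indicator_def)
    next
      case 3
      then have "exp (t * Y \<omega>) \<le> exp (t * ((1 + d) * t * v))" using t by simp
      then show ?thesis using 3 that by (simp add: add_increasing)
    qed
  qed
  have ind: "integrable M (indicat_real ?T)" by (intro integrable_real_indicator) (auto simp: less_top[symmetric])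
  have "exp q / C \<le> expectation (\<lambda>\<omega>. exp (t * Y \<omega>))" using lower by (simp add: q_def)
  also have "\<dots> \<le> expectation (\<lambda>\<omega>. exp (d * t * ((1 - d) * t * v)) * exp ((1 - d) * t * Y \<omega>) +
      exp (- (d * t * ((1 + d) * t * v))) * exp ((1 + d) * t * Y \<omega>) +
      exp (t * ((1 + d) * t * v)) * indicator ?T \<omega>)"
    by (intro integral_mono int pw Bochner_Integration.integrable_add integrable_mult_right int ind)
  also have "\<dots> = exp (d * t * ((1 - d) * t * v)) * expectation (\<lambda>\<omega>. exp ((1 - d) * t * Y \<omega>)) +
      exp (- (d * t * ((1 + d) * t * v))) * expectation (\<lambda>\<omega>. exp ((1 + d) * t * Y \<omega>)) +
      exp (t * ((1 + d) * t * v)) * prob ?T"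
    using int[of "(1 - d) * t"] int[of "(1 + d) * t"] ind by simp
  also have "\<dots> \<le> exp (d * t * ((1 - d) * t * v)) * (C * exp (((1 - d) * t)\<^sup>2 * v / 2)) +
      exp (- (d * t * ((1 + d) * t * v))) * (C * exp (((1 + d) * t)\<^sup>2 * v / 2)) +
      exp (t * ((1 + d) * t * v)) * prob ?T"
    using d t upper[of "(1 - d) * t"] upper[of "(1 + d) * t"]
    by (intro add_mono mult_left_mono) auto
  \<comment> \<open>Completing the square, both outer exponents become q - d^2 q.\<close>
  also have "\<dots> = 2 * C * exp q * exp (- (d\<^sup>2 * q)) + exp (2 * (1 + d) * q) * prob ?T"
    unfolding q_def by (simp flip: exp_add) (simp add: power2_eq_square field_simps exp_add[symmetric])
  \<comment> \<open>By \<open>large\<close> the outer parts are at most half of the lower bound exp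
    q / C, so the other half is left for the tail event.\<close>
  also have "\<dots> \<le> 2 * C * exp q * (1 / (4 * C\<^sup>2)) + exp (2 * (1 + d) * q) * prob ?T"
    using large C by (intro add_mono mult_left_mono) (auto simp: q_def)
  also have "2 * C * exp q * (1 / (4 * C\<^sup>2)) = exp q / (2 * C)"
    using C by (simp add: power2_eq_square)
  finally have "exp q / (2 * C) \<le> exp (2 * (1 + d) * q) * prob ?T" by (simp add: field_simps)
  then have "exp q / (2 * C) * exp (- (2 * (1 + d) * q)) \<le> prob ?T"
    unfolding exp_minus[of "2 * (1 + d) * q"] divide_inverse[symmetric]
    by (subst pos_divide_le_eq) (simp_all add: mult.commute)
  also have "exp q / (2 * C) * exp (- (2 * (1 + d) * q)) = exp (- ((1 + 2 * d) * q)) / (2 * C)"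
    by (simp add: mult_exp_exp algebra_simps)
  finally show ?thesis by (simp add: q_def)
qed

section \<open>Sums with nearly Gaussian moment generating functions\<close>

definition lil_norm :: "real \<Rightarrow> real" where
  "lil_norm x = sqrt (2 * x * ln (ln x))"

lemma lil_norm_mono:
  assumes "exp 1 \<le> x" "x \<le> y"
  shows "lil_norm x \<le> lil_norm y"
proof -
  have "0 < x" using assms(1) exp_gt_zero[of "1::real"] by linarith
  have "1 \<le> ln x" using assms(1) \<open>0 < x\<close> by (simp add: ln_ge_iff)
  moreover have "ln x \<le> ln y" using assms \<open>0 < x\<close> by simp
  ultimately have "0 \<le> ln (ln x)" "ln (ln x) \<le> ln (ln y)" by simp_all
  then show ?thesis unfolding lil_norm_def using assms \<open>0 < x\<close>
    by (intro real_sqrt_le_mono mult_mono) auto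
qed

text \<open>\<open>s n\<close> plays the role of the variance of the n-th partial sum. The moment
  bounds are restricted to |t| \<le> 1 because the tilts used tend to 0; C is uniform in m and n, so
  a block of any length costs only a constant. \<open>s_step\<close> limits how far the variance
  overshoots a prescribed level.\<close>

locale gaussian_mgf_sum = prob_space +
  fixes X :: "nat \<Rightarrow> 'a \<Rightarrow> real" and s :: "nat \<Rightarrow> real" and B C :: real
  assumes indep: "indep_vars (\<lambda>_. borel) X UNIV"
    and bounded: "\<And>i \<omega>. \<omega> \<in> space M \<Longrightarrow> \<bar>X i \<omega>\<bar> \<le> B"
    and C: "C \<ge> 1"
    and s_0: "s 0 = 0" and s_mono: "mono s" and s_top: "filterlim s at_top sequentially"
    and s_step: "\<And>n. s (Suc n) \<le> s n + 1"
    and mgf_upper: "\<And>t m n. \<bar>t\<bar> \<le> 1 \<Longrightarrow> m \<le> n \<Longrightarrow>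
      expectation (\<lambda>\<omega>. exp (t * (\<Sum>i\<in>{m..<n}. X i \<omega>))) \<le> C * exp (t\<^sup>2 * (s n - s m) / 2)"
    and mgf_lower: "\<And>t m n. \<bar>t\<bar> \<le> 1 \<Longrightarrow> m \<le> n \<Longrightarrow>
      exp (t\<^sup>2 * (s n - s m) / 2) / C \<le> expectation (\<lambda>\<omega>. exp (t * (\<Sum>i\<in>{m..<n}. X i \<omega>)))"
begin

lemma measurable_X [measurable]: "X i \<in> borel_measurable M"
  using indep by (auto simp: indep_vars_def)

lemma integrable_exp_sum:
  assumes "finite I"
  shows "integrable M (\<lambda>\<omega>. exp (t * (\<Sum>i\<in>I. X i \<omega>)))"
proof (rule integrable_const_bound[where B = "exp (\<bar>t\<bar> * (\<Sum>i\<in>I. B))"])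
  show "AE \<omega> in M. norm (exp (t * (\<Sum>i\<in>I. X i \<omega>))) \<le> exp (\<bar>t\<bar> * (\<Sum>i\<in>I. B))"
  proof (rule AE_I2)
    fix \<omega> assume "\<omega> \<in> space M"
    then have "\<bar>\<Sum>i\<in>I. X i \<omega>\<bar> \<le> (\<Sum>i\<in>I. B)"
      by (intro order.trans[OF sum_abs] sum_mono bounded)
    then have "\<bar>t * (\<Sum>i\<in>I. X i \<omega>)\<bar> \<le> \<bar>t\<bar> * (\<Sum>i\<in>I. B)"
      unfolding abs_mult by (intro mult_left_mono) auto
    then show "norm (exp (t * (\<Sum>i\<in>I. X i \<omega>))) \<le> exp (\<bar>t\<bar> * (\<Sum>i\<in>I. B))" by simp
  qed
qed simp

text \<open>A substitute for Doob's inequality. On the event \<open>E m\<close> that a is first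
  reached at time m, the remaining increment is independent of the past and its exponential has mean
  at least 1 / C. Summing over m and comparing with the mean of exp (t S_n) costs the factor
  C^2.\<close>

lemma prob_max_ge:
  assumes t: "0 < t" "t \<le> 1"
  shows "prob {\<omega>\<in>space M. \<exists>m\<le>n. a \<le> (\<Sum>i<m. X i \<omega>)} \<le> C\<^sup>2 * exp (t\<^sup>2 * s n / 2 - t * a)"
proof -
  define S where "S m \<omega> = (\<Sum>i<m. X i \<omega>)" for m \<omega>
  have S [measurable]: "S m \<in> borel_measurable M" for m unfolding S_def by measurable
  define E where "E m = {\<omega>\<in>space M. a \<le> S m \<omega> \<and> (\<forall>l<m. S l \<omega> < a)}" for m
  have E [measurable]: "E m \<in> events" for m unfolding E_def by measurable
  have disj: "disjoint_family_on E {..n}"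
    by (auto simp: disjoint_family_on_def E_def) (metis linorder_neqE_nat not_le)
  have "{\<omega>\<in>space M. \<exists>m\<le>n. a \<le> S m \<omega>} = (\<Union>m\<in>{..n}. E m)"
  proof (intro equalityI subsetI)
    fix \<omega> assume \<omega>: "\<omega> \<in> {\<omega>\<in>space M. \<exists>m\<le>n. a \<le> S m \<omega>}"
    define m where "m = (LEAST m. a \<le> S m \<omega>)"
    from \<omega> obtain k where k: "k \<le> n" "a \<le> S k \<omega>" by auto
    have "a \<le> S m \<omega>" unfolding m_def using k(2) by (rule LeastI)
    moreover have "m \<le> n" unfolding m_def using Least_le[of "\<lambda>m. a \<le> S m \<omega>", OF k(2)] k(1) by linarith
    moreover have "S l \<omega> < a" if "l < m" for l
      using not_less_Least[of l "\<lambda>m. a \<le> S m \<omega>"] that by (simp add: m_def not_le)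
    ultimately show "\<omega> \<in> (\<Union>m\<in>{..n}. E m)" using \<omega> by (auto simp: E_def)
  qed (auto simp: E_def)
  then have prob_eq: "prob {\<omega>\<in>space M. \<exists>m\<le>n. a \<le> S m \<omega>} = (\<Sum>m\<le>n. prob (E m))"
    using finite_measure_finite_Union[OF _ image_subsetI[OF E] disj] by simp
  have int1: "integrable M (\<lambda>\<omega>. indicator (E m) \<omega> * exp (t * S m \<omega>))" for m
    using integrable_real_mult_indicator[OF E integrable_exp_sum[of "{..<m}" t]] by (simp add: S_def mult.commute)
  have int2: "integrable M (\<lambda>\<omega>. indicator (E m) \<omega> * exp (t * S n \<omega>))" for m
    using integrable_real_mult_indicator[OF E integrable_exp_sum[of "{..<n}" t]] by (simp add: S_def mult.commute)
  have step: "exp (t * a) * prob (E m) / C \<le> expectation (\<lambda>\<omega>. indicator (E m) \<omega> * exp (t * S n \<omega>))"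
    if m: "m \<le> n" for m
  proof -
    \<comment> \<open>\<open>f\<close> is exp (t S_m) on \<open>E m\<close> and 0 elsewhere, written
      as a function of the first m variables so that independence applies.\<close>
    define f where "f y = (if a \<le> (\<Sum>i<m. y i) then exp (t * (\<Sum>i<m. y i)) else 0) *
        (\<Prod>l<m. if (\<Sum>i<l. y i) < a then 1 else 0)"
      for y :: "nat \<Rightarrow> real"
    define g where "g y = exp (t * (\<Sum>i\<in>{m..<n}. y i))" for y :: "nat \<Rightarrow> real"
    have comp: "(\<lambda>y. y i) \<in> borel_measurable (Pi\<^sub>M {..<m} (\<lambda>_. borel))" if "i < m" for i
      using that by (intro measurable_component_singleton) simp
    have sum_meas: "(\<lambda>y::nat \<Rightarrow> real. \<Sum>i<l. y i) \<in> borel_measurable (Pi\<^sub>M {..<m} (\<lambda>_. borel))" if "l \<le> m" for l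
      by (rule borel_measurable_sum[of "{..<l}" "\<lambda>i y. y i"]) (use that in \<open>auto intro: comp\<close>)
    have f: "f \<in> borel_measurable (Pi\<^sub>M {..<m} (\<lambda>_. borel))"
      unfolding f_def
      by (intro borel_measurable_times borel_measurable_prod measurable_If borel_measurable_le
          borel_measurable_less measurable_compose[OF _ borel_measurable_exp]
          borel_measurable_const sum_meas predE pred_sets2) auto
    have f_restrict: "f (restrict y {..<m}) = f y" for y
    proof -
      have "(\<Sum>i<l. restrict y {..<m} i) = (\<Sum>i<l. y i)" if "l \<le> m" for l
        using that by (intro sum.cong) auto
      then show ?thesis unfolding f_def by (intro arg_cong2[of _ _ _ _ "(*)"] prod.cong) auto
    qed
    have g: "g \<in> borel_measurable (Pi\<^sub>M {m..<n} (\<lambda>_. borel))"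
      unfolding g_def by measurable
    have "indep_var borel (f \<circ> (\<lambda>\<omega>. restrict (\<lambda>i. X i \<omega>) {..<m})) borel (g \<circ> (\<lambda>\<omega>. restrict (\<lambda>i. X i \<omega>) {m..<n}))"
      by (rule indep_var_compose[OF indep_var_restrict[OF indep] f g]) auto
    also have "f \<circ> (\<lambda>\<omega>. restrict (\<lambda>i. X i \<omega>) {..<m}) = (\<lambda>\<omega>. f (\<lambda>i. X i \<omega>))"
      by (auto simp: f_restrict)
    also have "g \<circ> (\<lambda>\<omega>. restrict (\<lambda>i. X i \<omega>) {m..<n}) = (\<lambda>\<omega>. g (\<lambda>i. X i \<omega>))"
      by (auto simp: g_def fun_eq_iff)
    finally have ind: "indep_var borel (\<lambda>\<omega>. f (\<lambda>i. X i \<omega>)) borel (\<lambda>\<omega>. g (\<lambda>i. X i \<omega>))" .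
    have f_eq: "f (\<lambda>i. X i \<omega>) = indicator (E m) \<omega> * exp (t * S m \<omega>)" if "\<omega> \<in> space M" for \<omega>
      using that by (auto simp: f_def S_def E_def indicator_def)
    have intf: "integrable M (\<lambda>\<omega>. f (\<lambda>i. X i \<omega>))"
      using int1[of m] by (rule Bochner_Integration.integrable_cong[THEN iffD2, rotated 2]) (simp_all add: f_eq)
    have intg: "integrable M (\<lambda>\<omega>. g (\<lambda>i. X i \<omega>))"
      unfolding g_def by (rule integrable_exp_sum) simp
    have "S n \<omega> = S m \<omega> + (\<Sum>i\<in>{m..<n}. X i \<omega>)" for \<omega>
      unfolding S_def using m by (simp add: sum.atLeastLessThan_concat lessThan_atLeast0)
    then have "expectation (\<lambda>\<omega>. indicator (E m) \<omega> * exp (t * S n \<omega>)) =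
        expectation (\<lambda>\<omega>. f (\<lambda>i. X i \<omega>) * g (\<lambda>i. X i \<omega>))"
      by (intro Bochner_Integration.integral_cong) (auto simp: f_eq g_def algebra_simps exp_add)
    also have "\<dots> = expectation (\<lambda>\<omega>. f (\<lambda>i. X i \<omega>)) * expectation (\<lambda>\<omega>. g (\<lambda>i. X i \<omega>))"
      by (rule indep_var_lebesgue_integral[OF ind intf intg])
    also have "\<dots> \<ge> (exp (t * a) * prob (E m)) * (1 / C)"
    proof (intro mult_mono)
      have "exp (t * a) * prob (E m) = expectation (\<lambda>\<omega>. exp (t * a) * indicator (E m) \<omega>)" by simp
      also have "\<dots> \<le> expectation (\<lambda>\<omega>. f (\<lambda>i. X i \<omega>))"
      proof (rule integral_mono[OF _ intf])
        show "integrable M (\<lambda>\<omega>. exp (t * a) * indicator (E m) \<omega>)" by (auto simp: less_top[symmetric])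
        show "exp (t * a) * indicator (E m) \<omega> \<le> f (\<lambda>i. X i \<omega>)" if "\<omega> \<in> space M" for \<omega>
          using t by (auto simp: f_eq[OF that] indicator_def E_def)
      qed
      finally show "exp (t * a) * prob (E m) \<le> expectation (\<lambda>\<omega>. f (\<lambda>i. X i \<omega>))" .
      have "1 / C \<le> exp (t\<^sup>2 * (s n - s m) / 2) / C"
        using C s_mono m by (intro divide_right_mono) (auto dest: monoD)
      also have "\<dots> \<le> expectation (\<lambda>\<omega>. g (\<lambda>i. X i \<omega>))"
        unfolding g_def using t m by (intro mgf_lower) auto
      finally show "1 / C \<le> expectation (\<lambda>\<omega>. g (\<lambda>i. X i \<omega>))" .
      show "0 \<le> expectation (\<lambda>\<omega>. f (\<lambda>i. X i \<omega>))"
        by (intro integral_nonneg_AE) (auto simp: f_def intro!: mult_nonneg_nonneg prod_nonneg)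
    qed (use C in auto)
    finally show ?thesis by simp
  qed
  have "exp (t * a) / C * (\<Sum>m\<le>n. prob (E m)) = (\<Sum>m\<le>n. exp (t * a) * prob (E m) / C)"
    by (simp add: sum_distrib_left)
  also have "\<dots> \<le> (\<Sum>m\<le>n. expectation (\<lambda>\<omega>. indicator (E m) \<omega> * exp (t * S n \<omega>)))"
    by (intro sum_mono step) auto
  also have "\<dots> = expectation (\<lambda>\<omega>. \<Sum>m\<le>n. indicator (E m) \<omega> * exp (t * S n \<omega>))"
    by (rule Bochner_Integration.integral_sum[symmetric]) (rule int2)
  also have "\<dots> \<le> expectation (\<lambda>\<omega>. exp (t * S n \<omega>))"
  proof (rule integral_mono)
    fix \<omega>
    have "(\<Sum>m\<le>n. indicator (E m) \<omega>) = (indicator (\<Union>m\<le>n. E m) \<omega> :: real)"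
      by (rule indicator_UN_disjoint[OF _ disj, symmetric]) simp
    then have "(\<Sum>m\<le>n. indicator (E m) \<omega> * exp (t * S n \<omega>)) = indicator (\<Union>m\<le>n. E m) \<omega> * exp (t * S n \<omega>)"
      by (simp only: sum_distrib_right[symmetric])
    also have "\<dots> \<le> exp (t * S n \<omega>)" by (simp add: indicator_def)
    finally show "(\<Sum>m\<le>n. indicator (E m) \<omega> * exp (t * S n \<omega>)) \<le> exp (t * S n \<omega>)" .
  next
    show "integrable M (\<lambda>\<omega>. \<Sum>m\<le>n. indicat_real (E m) \<omega> * exp (t * S n \<omega>))"
      by (intro Bochner_Integration.integrable_sum int2)
    show "integrable M (\<lambda>\<omega>. exp (t * S n \<omega>))" unfolding S_def by (rule integrable_exp_sum) simp
  qed
  also have "expectation (\<lambda>\<omega>. exp (t * S n \<omega>)) \<le> C * exp (t\<^sup>2 * s n / 2)"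
    using mgf_upper[of t 0 n] t by (simp add: S_def s_0 lessThan_atLeast0)
  finally have "exp (t * a) / C * (\<Sum>m\<le>n. prob (E m)) \<le> C * exp (t\<^sup>2 * s n / 2)" .
  then have "(\<Sum>m\<le>n. prob (E m)) \<le> C\<^sup>2 * exp (t\<^sup>2 * s n / 2 - t * a)"
    using C unfolding exp_diff by (simp add: power2_eq_square) (simp add: field_simps)
  then show ?thesis using prob_eq by (simp add: S_def)
qed

text \<open>The time at which the variance reaches x; blocks are cut at such times.\<close>

definition level :: "real \<Rightarrow> nat" where
  "level x = (LEAST n. x \<le> s n)"

lemma s_level_ge: "x \<le> s (level x)"
proof -
  have "eventually (\<lambda>n. x \<le> s n) sequentially"
    using s_top by (simp add: filterlim_at_top)
  then show ?thesis unfolding level_def by (meson LeastI eventually_sequentially order_refl)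
qed

lemma s_level_le: "0 \<le> x \<Longrightarrow> s (level x) \<le> x + 1"
proof (cases "level x")
  case (Suc n)
  then have "\<not> x \<le> s n" using not_less_Least[of n "\<lambda>n. x \<le> s n"] by (simp add: level_def)
  then show ?thesis using s_step[of n] Suc by simp
qed (simp add: s_0)

lemma level_le_iff: "level x \<le> n \<longleftrightarrow> x \<le> s n"
  using s_level_ge[of x] monoD[OF s_mono] Least_le[of "\<lambda>n. x \<le> s n" n]
  unfolding level_def by (meson order.trans)

lemma level_mono: "x \<le> y \<Longrightarrow> level x \<le> level y"
  using s_level_ge[of y] by (simp add: level_le_iff)

section \<open>The upper bound\<close>

text \<open>Blocks end at variance r^(j + 1) with r = sqrt c. The maximal inequality with threshold
  c * lil_norm (r^j) and variance at most r^(j + 2) = c r^j gives the exponent - c ln (j ln r),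
  hence the summable bound (j ln r)^(- c) up to a constant.\<close>

lemma eventually_sum_le:
  assumes c: "1 < c"
  shows "AE \<omega> in M. eventually (\<lambda>n. (\<Sum>i<n. X i \<omega>) \<le> c * lil_norm (s n)) sequentially"
proof -
  define r where "r = sqrt c"
  have r: "1 < r" using c by (simp add: r_def)
  have r2: "r\<^sup>2 = c" using c by (simp add: r_def)
  define a where "a j = c * lil_norm (r ^ j)" for j :: nat
  define F where "F j = {\<omega>\<in>space M. \<exists>m\<le>level (r ^ Suc j). a j \<le> (\<Sum>i<m. X i \<omega>)}" for j
  have F [measurable]: "F j \<in> events" for j unfolding F_def by measurable
  have "eventually (\<lambda>j. prob (F j) \<le> C\<^sup>2 * (real j * ln r) powr (- c)) sequentially"
  proof -
    have "filterlim (\<lambda>j::nat. r ^ j) at_top sequentially" using r by real_asymp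
    then have "eventually (\<lambda>j. 1 / (r - 1) \<le> r ^ j) sequentially" by (simp add: filterlim_at_top)
    moreover have "eventually (\<lambda>j::nat. 1 < real j * ln r) sequentially"
      using r by real_asymp
    \<comment> \<open>This quotient is the tilt \<open>t\<close> below; it has to stay in the range
      of the moment bounds.\<close>
    moreover have "((\<lambda>j. a j / r ^ (j + 2)) \<longlongrightarrow> 0) sequentially"
      unfolding a_def lil_norm_def using r by real_asymp
    then have "eventually (\<lambda>j. a j / r ^ (j + 2) < 1) sequentially"
      by (rule order_tendstoD) simp
    ultimately show ?thesis
    proof eventually_elim
      case (elim j)
      \<comment> \<open>One power more than the end of the block absorbs the overshoot by 1 of
        \<open>level\<close>.\<close>
      define v where "v = r ^ (j + 2)"
      \<comment> \<open>The minimizer of t^2 v / 2 - t a_j.\<close>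
      define t where "t = a j / v"
      have v: "v > 0" using r by (simp add: v_def)
      have ln_ln: "0 < ln (ln (r ^ j))" using elim(2) r by (simp add: ln_realpow)
      have a: "0 < a j" using c r ln_ln by (simp add: a_def lil_norm_def)
      have t: "0 < t" "t \<le> 1" using a v elim(3) by (simp_all add: t_def v_def)
      have "1 \<le> r ^ j * (r - 1)" using elim(1) r by (simp add: field_simps)
      also have "\<dots> \<le> r * (r ^ j * (r - 1))" using r by simp
      also have "\<dots> = v - r ^ Suc j" by (simp add: v_def algebra_simps)
      finally have s_le: "s (level (r ^ Suc j)) \<le> v"
        using s_level_le[of "r ^ Suc j"] r by simp
      have "prob (F j) \<le> C\<^sup>2 * exp (t\<^sup>2 * s (level (r ^ Suc j)) / 2 - t * a j)"
        unfolding F_def by (rule prob_max_ge[OF t])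
      also have "\<dots> \<le> C\<^sup>2 * exp (t\<^sup>2 * v / 2 - t * a j)"
        using s_le by (intro mult_left_mono) (auto intro!: mult_left_mono)
      also have "t\<^sup>2 * v / 2 - t * a j = - ((a j)\<^sup>2 / (2 * v))"
        using v by (simp add: t_def power2_eq_square field_simps)
      also have "(a j)\<^sup>2 = c\<^sup>2 * (2 * r ^ j * ln (ln (r ^ j)))"
        using r ln_ln by (simp add: a_def lil_norm_def power_mult_distrib)
      also have "c\<^sup>2 * (2 * r ^ j * ln (ln (r ^ j))) / (2 * v) = c * ln (real j * ln r)"
      proof -
        have "v = r ^ j * c" using r2 by (simp add: v_def power2_eq_square algebra_simps)
        then show ?thesis using r c by (simp add: ln_realpow power2_eq_square)
      qed
      also have "exp (- (c * ln (real j * ln r))) = (real j * ln r) powr (- c)"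
        using elim(2) r by (cases "j = 0") (auto simp: powr_def)
      finally show ?case .
    qed
  qed
  moreover have "summable (\<lambda>j. C\<^sup>2 * (real j * ln r) powr (- c))"
  proof -
    have "(real j * ln r) powr (- c) = ln r powr (- c) * real j powr (- c)" for j
      using r by (simp add: powr_mult mult.commute)
    then show ?thesis using c by (simp add: summable_real_powr_iff summable_mult)
  qed
  ultimately have "summable (\<lambda>j. prob (F j))"
    by (intro summable_comparison_test_ev[of "\<lambda>j. prob (F j)" "\<lambda>j. C\<^sup>2 * (real j * ln r) powr (- c)"])
      (auto elim: eventually_mono)
  then have "AE \<omega> in M. eventually (\<lambda>j. \<omega> \<in> space M - F j) sequentially"
    by (intro borel_cantelli_AE1) (auto simp: emeasure_eq_measure)
  then show ?thesis
  proof eventually_elim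
    case (elim \<omega>)
    then have "eventually (\<lambda>j. \<forall>m\<le>level (r ^ Suc j). (\<Sum>i<m. X i \<omega>) < a j) sequentially"
      by eventually_elim (use F_def not_le in blast)
    moreover have "filterlim (\<lambda>j::nat. r ^ j) at_top sequentially" using r by real_asymp
    then have "eventually (\<lambda>j. exp 1 \<le> r ^ j) sequentially" by (simp add: filterlim_at_top)
    ultimately have "eventually (\<lambda>j. (\<forall>m\<le>level (r ^ Suc j). (\<Sum>i<m. X i \<omega>) < a j) \<and> exp 1 \<le> r ^ j) sequentially"
      by eventually_elim simp
    then obtain J where J: "\<And>j m. j \<ge> J \<Longrightarrow> m \<le> level (r ^ Suc j) \<Longrightarrow> (\<Sum>i<m. X i \<omega>) < a j"
      "\<And>j. j \<ge> J \<Longrightarrow> exp 1 \<le> r ^ j"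
      unfolding eventually_sequentially by blast
    have "eventually (\<lambda>n. r ^ J \<le> s n) sequentially"
      using s_top by (simp add: filterlim_at_top)
    then show ?case
    proof eventually_elim
      case (elim n)
      have "\<exists>k. s n < r ^ k" by (rule real_arch_pow[OF r])
      \<comment> \<open>With k = j + 1, s n lies between r^j and r^(j + 1): n is covered by the
        maximum of block j, while its norm is at least that at r^j.\<close>
      define k where "k = (LEAST k. s n < r ^ k)"
      have k: "s n < r ^ k" unfolding k_def using \<open>\<exists>k. s n < r ^ k\<close> by (rule LeastI_ex)
      have "J < k"
      proof (rule ccontr)
        assume "\<not> J < k"
        then have "r ^ k \<le> r ^ J" using r by (intro power_increasing) auto
        with k elim show False by linarith
      qed
      then obtain j where j: "k = Suc j" "J \<le> j" by (cases k) auto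
      have "r ^ j \<le> s n" using not_less_Least[of j "\<lambda>k. s n < r ^ k"] j by (simp add: k_def not_less)
      have "n \<le> level (r ^ Suc j)"
      proof (rule ccontr)
        assume "\<not> n \<le> level (r ^ Suc j)"
        then have "level (r ^ Suc j) \<le> n" by simp
        then show False using k j by (simp add: level_le_iff)
      qed
      then have "(\<Sum>i<n. X i \<omega>) < a j" using J(1)[OF j(2)] by blast
      also have "a j \<le> c * lil_norm (s n)"
        unfolding a_def using c lil_norm_mono[OF J(2)[OF j(2)] \<open>r ^ j \<le> s n\<close>] by simp
      finally show ?case by simp
    qed
  qed
qed

text \<open>The moment bounds cover both signs of t. The upper bound for -X will control the past
  sums from below.\<close>

lemma uminus: "gaussian_mgf_sum M (\<lambda>i \<omega>. - X i \<omega>) s B C"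
proof
  show "indep_vars (\<lambda>_. borel) (\<lambda>i \<omega>. - X i \<omega>) UNIV"
    using indep_vars_compose2[OF indep, of "\<lambda>_ x. - x" "\<lambda>_. borel"] by simp
  fix t :: real and m n :: nat assume "\<bar>t\<bar> \<le> 1" "m \<le> n"
  then show "expectation (\<lambda>\<omega>. exp (t * (\<Sum>i\<in>{m..<n}. - X i \<omega>))) \<le> C * exp (t\<^sup>2 * (s n - s m) / 2)"
    "exp (t\<^sup>2 * (s n - s m) / 2) / C \<le> expectation (\<lambda>\<omega>. exp (t * (\<Sum>i\<in>{m..<n}. - X i \<omega>)))"
    using mgf_upper[of "- t" m n] mgf_lower[of "- t" m n] by (simp_all add: sum_negf)
qed (use bounded C s_0 s_mono s_top s_step in auto)

section \<open>The lower bound\<close>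

text \<open>The tilt t with (1 + 2 d) t^2 v / 2 = ln j makes the tail probability at least 1 / (2 C
  j), whose sum diverges. Block ends at variance j^j grow so fast that the past becomes negligible,
  while ln (ln (j^j)) is still asymptotic to ln j.\<close>

lemma frequently_block_sum_ge:
  assumes d: "0 < d" "d < 1"
  defines "n \<equiv> \<lambda>j::nat. level (real j ^ j)"
  defines "v \<equiv> \<lambda>j. s (n (Suc j)) - s (n j)"
  shows "AE \<omega> in M. \<exists>\<^sub>F j in sequentially.
    (1 - d) * sqrt (2 * v j * ln (real j) / (1 + 2 * d)) \<le> (\<Sum>i\<in>{n j..<n (Suc j)}. X i \<omega>)"
proof (rule borel_cantelli_indep_vars)
  have "real j ^ j \<le> real (Suc j) ^ Suc j" for j
  proof -
    have "real j ^ j \<le> real (Suc j) ^ j" by (intro power_mono) auto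
    also have "\<dots> \<le> real (Suc j) ^ Suc j" by (intro power_increasing) auto
    finally show ?thesis .
  qed
  then have n_mono: "mono n" unfolding n_def by (intro incseq_SucI level_mono)
  have disj: "disjoint_family (\<lambda>j. {n j..<n (Suc j)})"
  proof -
    have "{n i..<n (Suc i)} \<inter> {n j..<n (Suc j)} = {}" if "i < j" for i j
      using monoD[OF n_mono, of "Suc i" j] that by auto
    then show ?thesis unfolding disjoint_family_on_def by (metis Int_commute linorder_neqE_nat)
  qed
  have "indep_vars (\<lambda>j. Pi\<^sub>M {n j..<n (Suc j)} (\<lambda>_. borel)) (\<lambda>j \<omega>. restrict (\<lambda>i. X i \<omega>) {n j..<n (Suc j)}) UNIV"
    using indep disj by (intro indep_vars_restrict) auto
  then have "indep_vars (\<lambda>_. borel) (\<lambda>j \<omega>. (\<lambda>y. \<Sum>i\<in>{n j..<n (Suc j)}. y i) (restrict (\<lambda>i. X i \<omega>) {n j..<n (Suc j)})) UNIV"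
    by (rule indep_vars_compose2) measurable
  then show "indep_vars (\<lambda>_. borel) (\<lambda>j \<omega>. \<Sum>i\<in>{n j..<n (Suc j)}. X i \<omega>) UNIV"
    by simp
  define p where "p j = prob {\<omega>\<in>space M. (1 - d) * sqrt (2 * v j * ln (real j) / (1 + 2 * d)) \<le> (\<Sum>i\<in>{n j..<n (Suc j)}. X i \<omega>)}" for j
  have "eventually (\<lambda>j. 1 / (2 * C) * (1 / real j) \<le> p j) sequentially"
  proof -
    have v_ge: "real (Suc j) ^ Suc j - real j ^ j - 1 \<le> v j" for j
      using s_level_ge[of "real (Suc j) ^ Suc j"] s_level_le[of "real j ^ j"] by (simp add: v_def n_def)
    have "((\<lambda>j::nat. ln (real j) / (real (Suc j) ^ Suc j - real j ^ j - 1)) \<longlongrightarrow> 0) sequentially"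
      by real_asymp
    \<comment> \<open>The value 1 / 8 yields t^2 \<le> 1 / 4, so that even (1 + d) t \<le>
      1.\<close>
    then have "eventually (\<lambda>j. ln (real j) / (real (Suc j) ^ Suc j - real j ^ j - 1) < 1 / 8) sequentially"
      by (rule order_tendstoD) simp
    moreover have "filterlim (\<lambda>j::nat. real (Suc j) ^ Suc j - real j ^ j - 1) at_top sequentially"
      by real_asymp
    then have "eventually (\<lambda>j. 1 \<le> real (Suc j) ^ Suc j - real j ^ j - 1) sequentially" by (simp only: filterlim_at_top)
    moreover have "((\<lambda>j::nat. exp (- (d\<^sup>2 * (ln (real j) / (1 + 2 * d))))) \<longlongrightarrow> 0) sequentially"
      using d by real_asymp
    then have "eventually (\<lambda>j::nat. exp (- (d\<^sup>2 * (ln (real j) / (1 + 2 * d)))) < 1 / (4 * C\<^sup>2)) sequentially"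
      by (rule order_tendstoD) (use C in simp)
    moreover have "eventually (\<lambda>j::nat. 1 < j) sequentially" by (rule eventually_gt_at_top)
    ultimately show ?thesis
    proof eventually_elim
      case (elim j)
      have v: "1 \<le> v j" using v_ge[of j] elim(2) by linarith
      have lnj: "0 < ln (real j)" using elim(4) by simp
      define q where "q = ln (real j) / (1 + 2 * d)"
      have q: "0 < q" using lnj d by (simp add: q_def)
      define t where "t = sqrt (2 * q / v j)"
      have t: "0 < t" using q v by (simp add: t_def)
      have tv: "t\<^sup>2 * v j / 2 = q" using q v by (simp add: t_def)
      have "ln (real j) / v j \<le> ln (real j) / (real (Suc j) ^ Suc j - real j ^ j - 1)"
        using v_ge[of j] elim(2) lnj v by (intro divide_left_mono mult_pos_pos) linarith+
      then have "ln (real j) / v j \<le> 1 / 8" using elim(1) by linarith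
      moreover have "q \<le> ln (real j)" using lnj d by (simp add: q_def field_simps)
      then have "q / v j \<le> ln (real j) / v j" using v by (simp add: divide_right_mono)
      ultimately have "2 * (q / v j) \<le> 2 * (1 / 8)" by linarith
      then have "2 * q / v j \<le> (1 / 2)\<^sup>2" by (simp add: power2_eq_square)
      then have "t \<le> 1 / 2" unfolding t_def by (intro real_le_lsqrt) auto
      then have "(1 + d) * t \<le> 2 * (1 / 2)" using d t by (intro mult_mono) auto
      then have t1: "(1 + d) * t \<le> 1" by simp
      have t1': "t \<le> 1" using \<open>t \<le> 1 / 2\<close> by simp
      have n_le: "n j \<le> n (Suc j)" using n_mono by (simp add: monoD)
      have "exp (- ((1 + 2 * d) * (t\<^sup>2 * v j / 2))) / (2 * C) \<le>
          prob {\<omega>\<in>space M. (1 - d) * t * v j \<le> (\<Sum>i\<in>{n j..<n (Suc j)}. X i \<omega>)}"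
      proof (rule prob_ge_of_mgf_bounds[OF _ _ C t d])
        show "expectation (\<lambda>\<omega>. exp (u * (\<Sum>i\<in>{n j..<n (Suc j)}. X i \<omega>))) \<le> C * exp (u\<^sup>2 * v j / 2)"
          if "0 < u" "u \<le> (1 + d) * t" for u
          unfolding v_def using that t1 n_le by (intro mgf_upper) auto
        show "exp (t\<^sup>2 * v j / 2) / C \<le> expectation (\<lambda>\<omega>. exp (t * (\<Sum>i\<in>{n j..<n (Suc j)}. X i \<omega>)))"
          unfolding v_def using t t1' n_le by (intro mgf_lower) auto
        show "exp (- (d\<^sup>2 * (t\<^sup>2 * v j / 2))) \<le> 1 / (4 * C\<^sup>2)"
          unfolding tv q_def using elim(3) by simp
      qed (use v integrable_exp_sum in auto)
      also have "exp (- ((1 + 2 * d) * (t\<^sup>2 * v j / 2))) = 1 / real j"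
      proof -
        have "(1 + 2 * d) * q = ln (real j)" using d by (simp add: q_def)
        then show ?thesis unfolding tv using elim(4) by (simp add: exp_minus field_simps)
      qed
      also have "(1 - d) * t * v j = (1 - d) * sqrt (2 * v j * ln (real j) / (1 + 2 * d))"
      proof -
        have "t * v j = sqrt (2 * q / v j) * sqrt ((v j)\<^sup>2)" using v by (simp add: t_def)
        also have "\<dots> = sqrt (2 * q / v j * (v j)\<^sup>2)" by (rule real_sqrt_mult[symmetric])
        also have "2 * q / v j * (v j)\<^sup>2 = 2 * v j * ln (real j) / (1 + 2 * d)"
          using v by (simp add: q_def power2_eq_square)
        finally show ?thesis by (simp add: mult.assoc)
      qed
      finally show ?case by (simp add: p_def field_simps)
    qed
  qed
  moreover have "\<not> summable (\<lambda>j. 1 / (2 * C) * (1 / real j))"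
  proof
    assume "summable (\<lambda>j. 1 / (2 * C) * (1 / real j))"
    then have "summable (\<lambda>j. 2 * C * (1 / (2 * C) * (1 / real j)))" by (rule summable_mult)
    then have "summable (\<lambda>j. inverse (real j))" using C by (simp add: inverse_eq_divide)
    with not_summable_harmonic[where 'a = real] show False by simp
  qed
  ultimately have "\<not> summable p"
    using summable_comparison_test_ev[of "\<lambda>j. 1 / (2 * C) * (1 / real j)" p] C
    by (auto elim!: eventually_mono)
  then show "\<not> summable (\<lambda>j. prob {\<omega>\<in>space M. (1 - d) * sqrt (2 * v j * ln (real j) / (1 + 2 * d)) \<le> (\<Sum>i\<in>{n j..<n (Suc j)}. X i \<omega>)})"
    by (simp add: p_def[abs_def])
qed

text \<open>A partial sum is the last block plus the past. The block is often almost maximal, and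
  the past is eventually at least -2 times its own norm, which is of smaller order than the norm at
  the end of the block.\<close>

lemma frequently_sum_ge:
  assumes c: "c < 1"
  shows "AE \<omega> in M. \<exists>\<^sub>F n in sequentially. c * lil_norm (s n) \<le> (\<Sum>i<n. X i \<omega>)"
proof -
  define n where "n j = level (real j ^ j)" for j :: nat
  define v where "v j = s (n (Suc j)) - s (n j)" for j
  have "((\<lambda>d::real. (1 - d) / sqrt (1 + 2 * d)) \<longlongrightarrow> 1) (at_right 0)" by real_asymp
  then have "eventually (\<lambda>d. (1 - d) / sqrt (1 + 2 * d) > c) (at_right 0)"
    using c by (rule order_tendstoD)
  moreover have "eventually (\<lambda>d::real. d \<in> {0<..<1}) (at_right 0)"
    by (rule eventually_at_right_real) simp
  ultimately have "eventually (\<lambda>d::real. d \<in> {0<..<1} \<and> (1 - d) / sqrt (1 + 2 * d) > c) (at_right 0)"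
    by eventually_elim simp
  then obtain d :: real where d: "0 < d" "d < 1" "c < (1 - d) / sqrt (1 + 2 * d)"
    using eventually_happens[of _ "at_right (0::real)"] by auto
  define k where "k = (1 - d) / sqrt (1 + 2 * d)"
  \<comment> \<open>c may be negative; its positive part can be multiplied into inequalities and is
    still below k.\<close>
  define c' where "c' = max c 0"
  have c': "0 \<le> c'" "c \<le> c'" "c' < k" using d by (auto simp: c'_def k_def)
  define R where "R j = real (Suc j) ^ Suc j" for j
  define Z where "Z j = sqrt (2 * R j * ln (real j))" for j
  \<comment> \<open>Relative to Z the block contributes k, the past 0 and the target c', and c' < k
    leaves a positive margin.\<close>
  have lim: "(\<lambda>j. k * sqrt (2 * (R j - real j ^ j - 1) * ln (real j)) / Z j
      - 2 * (lil_norm (real j ^ j + 1) / Z j) - c' * (lil_norm (R j + 1) / Z j)) \<longlonglongrightarrow> k * 1 - 2 * 0 - c' * 1"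
  proof (intro tendsto_intros)
    have "(\<lambda>j. sqrt (2 * (R j - real j ^ j - 1) * ln (real j)) / Z j) \<longlonglongrightarrow> 1"
      unfolding Z_def R_def by real_asymp
    then show "(\<lambda>j. k * sqrt (2 * (R j - real j ^ j - 1) * ln (real j)) / Z j) \<longlonglongrightarrow> k * 1"
      by (auto dest: tendsto_mult_left[of _ _ _ k])
    show "(\<lambda>j. lil_norm (real j ^ j + 1) / Z j) \<longlonglongrightarrow> 0"
      unfolding Z_def R_def lil_norm_def by real_asymp
    show "(\<lambda>j. lil_norm (R j + 1) / Z j) \<longlonglongrightarrow> 1"
      unfolding Z_def R_def lil_norm_def by real_asymp
  qed
  have "eventually (\<lambda>j. 0 < k * sqrt (2 * (R j - real j ^ j - 1) * ln (real j)) / Z j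
      - 2 * (lil_norm (real j ^ j + 1) / Z j) - c' * (lil_norm (R j + 1) / Z j)) sequentially"
    by (rule order_tendstoD(1)[OF lim]) (use c' in simp)
  moreover have "eventually (\<lambda>j::nat. 3 < j) sequentially" by (rule eventually_gt_at_top)
  ultimately have ev: "eventually (\<lambda>j. c * lil_norm (s (n (Suc j))) \<le>
      (1 - d) * sqrt (2 * v j * ln (real j) / (1 + 2 * d)) - 2 * lil_norm (s (n j))) sequentially"
  proof eventually_elim
    case (elim j)
    have "exp 1 \<le> (3 :: real)" by (rule exp_le)
    also have "(3::real) \<le> real j ^ 1" using elim(2) by simp
    also have "\<dots> \<le> real j ^ j" using elim(2) by (intro power_increasing) auto
    finally have e1: "exp 1 \<le> real j ^ j" .
    have "real j ^ j \<le> real (Suc j) ^ j" by (intro power_mono) auto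
    also have "\<dots> \<le> R j" unfolding R_def by (intro power_increasing) auto
    finally have e2: "exp 1 \<le> R j" using e1 by linarith
    have Z: "0 < Z j" using elim(2) e2 exp_gt_zero[of "1::real"] by (simp add: Z_def del: exp_gt_zero)
    have s1: "real j ^ j \<le> s (n j)" "s (n j) \<le> real j ^ j + 1"
      unfolding n_def by (auto intro: s_level_ge s_level_le)
    have s2: "R j \<le> s (n (Suc j))" "s (n (Suc j)) \<le> R j + 1"
      unfolding n_def R_def by (auto intro: s_level_ge s_level_le simp del: power_Suc)
    have nonneg: "0 \<le> lil_norm (s (n (Suc j)))"
    proof -
      have e3: "exp 1 \<le> s (n (Suc j))" using s2(1) e2 by linarith
      then have "0 < s (n (Suc j))" using exp_gt_zero[of "1::real"] by linarith
      with e3 show ?thesis unfolding lil_norm_def by (simp add: ln_ge_iff)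
    qed
    have v_ge: "R j - real j ^ j - 1 \<le> v j" unfolding v_def using s1 s2 by linarith
    have "0 < (k * sqrt (2 * (R j - real j ^ j - 1) * ln (real j)) - 2 * lil_norm (real j ^ j + 1)
        - c' * lil_norm (R j + 1)) / Z j"
      using elim(1) by (simp only: diff_divide_distrib times_divide_eq_right)
    then have mid: "c' * lil_norm (R j + 1) \<le>
        k * sqrt (2 * (R j - real j ^ j - 1) * ln (real j)) - 2 * lil_norm (real j ^ j + 1)"
      using Z by (simp only: zero_less_divide_iff) linarith
    have "c * lil_norm (s (n (Suc j))) \<le> c' * lil_norm (s (n (Suc j)))"
      using c' nonneg by (intro mult_right_mono)
    also have "\<dots> \<le> c' * lil_norm (R j + 1)"
      using c' s2 e2 by (intro mult_left_mono lil_norm_mono) auto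
    also have "\<dots> \<le> k * sqrt (2 * (R j - real j ^ j - 1) * ln (real j)) - 2 * lil_norm (real j ^ j + 1)"
      by (rule mid)
    also have "\<dots> \<le> k * sqrt (2 * v j * ln (real j)) - 2 * lil_norm (s (n j))"
      using c' elim(2) s1 e1 v_ge
      by (intro diff_mono mult_left_mono lil_norm_mono real_sqrt_le_mono mult_right_mono) auto
    also have "k * sqrt (2 * v j * ln (real j)) = (1 - d) * sqrt (2 * v j * ln (real j) / (1 + 2 * d))"
      by (simp add: k_def real_sqrt_divide)
    finally show ?case .
  qed
  have n_top: "filterlim (\<lambda>j. n j) at_top sequentially"
  proof -
    have "filterlim (\<lambda>j. real j ^ j) at_top sequentially" by real_asymp
    then have lt: "eventually (\<lambda>j. s N < real j ^ j) sequentially" for N by (simp add: filterlim_at_top_dense)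
    have "eventually (\<lambda>j. N \<le> n j) sequentially" for N
      using lt[of N]
    proof eventually_elim
      case (elim j)
      then have "\<not> n j \<le> N" by (simp add: n_def level_le_iff not_le)
      then show ?case by simp
    qed
    then show ?thesis by (simp add: filterlim_at_top)
  qed
  interpret minus: gaussian_mgf_sum M "\<lambda>i \<omega>. - X i \<omega>" s B C by (rule uminus)
  have n_le: "n j \<le> n (Suc j)" for j
  proof -
    have "real j ^ j \<le> real (Suc j) ^ j" by (intro power_mono) auto
    also have "\<dots> \<le> real (Suc j) ^ Suc j" by (intro power_increasing) auto
    finally show ?thesis unfolding n_def by (rule level_mono)
  qed
  have "AE \<omega> in M. \<exists>\<^sub>F j in sequentially. (1 - d) * sqrt (2 * v j * ln (real j) / (1 + 2 * d))
      \<le> (\<Sum>i\<in>{n j..<n (Suc j)}. X i \<omega>)"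
    using frequently_block_sum_ge[OF d(1,2)] by (simp add: v_def n_def)
  then show ?thesis using minus.eventually_sum_le[of 2, simplified]
  proof eventually_elim
    case (elim \<omega>)
    have "eventually (\<lambda>j. (\<Sum>i<n j. - X i \<omega>) \<le> 2 * lil_norm (s (n j))) sequentially"
      using elim(2) n_top by (rule eventually_compose_filterlim)
    then have "eventually (\<lambda>j. - (2 * lil_norm (s (n j))) \<le> (\<Sum>i<n j. X i \<omega>)) sequentially"
      by eventually_elim (simp add: sum_negf)
    note freq = frequently_eventually_frequently[OF elim(1) eventually_conj[OF ev this]]
    have freq': "\<exists>\<^sub>F j in sequentially. c * lil_norm (s (n (Suc j))) \<le> (\<Sum>i<n (Suc j). X i \<omega>)"
      using freq
    proof (rule frequently_elim1)
      fix j
      assume *: "(1 - d) * sqrt (2 * v j * ln (real j) / (1 + 2 * d)) \<le> (\<Sum>i\<in>{n j..<n (Suc j)}. X i \<omega>) \<and>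
        c * lil_norm (s (n (Suc j))) \<le> (1 - d) * sqrt (2 * v j * ln (real j) / (1 + 2 * d)) - 2 * lil_norm (s (n j)) \<and>
        - (2 * lil_norm (s (n j))) \<le> (\<Sum>i<n j. X i \<omega>)"
      have "(\<Sum>i<n (Suc j). X i \<omega>) = (\<Sum>i<n j. X i \<omega>) + (\<Sum>i\<in>{n j..<n (Suc j)}. X i \<omega>)"
        using n_le[of j] by (simp add: sum.atLeastLessThan_concat lessThan_atLeast0)
      with * show "c * lil_norm (s (n (Suc j))) \<le> (\<Sum>i<n (Suc j). X i \<omega>)" by linarith
    qed
    have n_Suc_top: "filterlim (\<lambda>j. n (Suc j)) at_top sequentially"
      using n_top by (rule filterlim_compose) (rule filterlim_Suc)
    show ?case unfolding frequently_def
    proof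
      assume "\<forall>\<^sub>F n in sequentially. \<not> c * lil_norm (s n) \<le> (\<Sum>i<n. X i \<omega>)"
      from eventually_compose_filterlim[OF this n_Suc_top] freq' show False
        by (simp add: frequently_def)
    qed
  qed
qed

section \<open>The upper limit\<close>

text \<open>Quantifying over Y and K inside the almost sure event allows a perturbation whose bound
  depends on \<omega>, such as the one from undoing the truncation. The sequence b allows any
  asymptotically equal normalization.\<close>

theorem AE_limsup_eq_1:
  assumes b: "(\<lambda>n. b n / lil_norm (s n)) \<longlonglongrightarrow> 1"
  shows "AE \<omega> in M. \<forall>Y K. (\<forall>\<^sub>F n in sequentially. \<bar>Y n - (\<Sum>i<n. X i \<omega>)\<bar> \<le> K) \<longrightarrow>
    limsup (\<lambda>n. ereal (Y n / b n)) = 1"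
proof -
  have "filterlim (\<lambda>n. lil_norm (s n)) at_top sequentially"
  proof (rule filterlim_compose[OF _ s_top])
    show "filterlim lil_norm at_top at_top" unfolding lil_norm_def[abs_def] by real_asymp
  qed
  then have L_top: "filterlim (\<lambda>n. lil_norm (s n)) at_top sequentially" .
  \<comment> \<open>Countably many constants approach 1, so that the almost sure events can be
    intersected.\<close>
  have "AE \<omega> in M. \<forall>k::nat. eventually (\<lambda>n. (\<Sum>i<n. X i \<omega>) \<le> (1 + 1 / real (Suc k)) * lil_norm (s n)) sequentially"
    unfolding AE_all_countable by (intro allI eventually_sum_le) simp
  moreover have "AE \<omega> in M. \<forall>k::nat. \<exists>\<^sub>F n in sequentially. (1 - 1 / real (Suc k)) * lil_norm (s n) \<le> (\<Sum>i<n. X i \<omega>)"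
    unfolding AE_all_countable by (intro allI frequently_sum_ge) simp
  ultimately show ?thesis
  proof eventually_elim
    case (elim \<omega>)
    show ?case
    proof (intro allI impI)
      fix Y K assume K: "\<forall>\<^sub>F n in sequentially. \<bar>Y n - (\<Sum>i<n. X i \<omega>)\<bar> \<le> K"
      define L where "L n = lil_norm (s n)" for n
      define S where "S n = (\<Sum>i<n. X i \<omega>)" for n
      have Lpos: "eventually (\<lambda>n. 0 < L n) sequentially"
        using L_top by (simp add: L_def filterlim_at_top_dense)
      have bpos: "eventually (\<lambda>n. 0 < b n) sequentially"
      proof -
        have "(0 :: real) < 1" by simp
        from order_tendstoD(1)[OF b this] Lpos show ?thesis
          by eventually_elim (simp add: L_def zero_less_divide_iff)
      qed
      have alpha: "(\<lambda>n. L n / b n) \<longlonglongrightarrow> 1"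
        using tendsto_inverse[OF b] by (simp add: L_def)
      have "(\<lambda>n. \<bar>K\<bar> / L n) \<longlonglongrightarrow> 0"
        using L_top unfolding L_def by (rule real_tendsto_divide_at_top[OF tendsto_const])
      from tendsto_mult[OF this alpha] have "(\<lambda>n. \<bar>K\<bar> / L n * (L n / b n)) \<longlonglongrightarrow> 0" by simp
      moreover have "\<forall>\<^sub>F n in sequentially. norm ((Y n - S n) / b n) \<le> \<bar>K\<bar> / L n * (L n / b n)"
        using K Lpos bpos
      proof eventually_elim
        case (elim n)
        then have "norm ((Y n - S n) / b n) = \<bar>Y n - S n\<bar> / b n" by simp
        also have "\<dots> \<le> \<bar>K\<bar> / b n" using elim by (intro divide_right_mono) (auto simp: S_def)
        finally show ?case using elim by simp
      qed
      ultimately have beta: "(\<lambda>n. (Y n - S n) / b n) \<longlonglongrightarrow> 0" by (rule Lim_null_comparison[rotated])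
      have lim: "(\<lambda>n. c * (L n / b n) + (Y n - S n) / b n) \<longlonglongrightarrow> c" for c
        using tendsto_add[OF tendsto_mult[OF tendsto_const alpha] beta] by simp
      \<comment> \<open>The second 1 / (k + 1) pays for the change of normalization and the bounded
        perturbation.\<close>
      have upper: "limsup (\<lambda>n. ereal (Y n / b n)) \<le> ereal (1 + 2 / real (Suc k))" for k
      proof (rule Limsup_bounded)
        have "eventually (\<lambda>n. (1 + 1 / real (Suc k)) * (L n / b n) + (Y n - S n) / b n < 1 + 2 / real (Suc k)) sequentially"
          by (rule order_tendstoD(2)[OF lim]) (simp add: divide_strict_right_mono)
        moreover have "eventually (\<lambda>n. S n \<le> (1 + 1 / real (Suc k)) * L n) sequentially"
          using elim(1) by (simp add: S_def L_def)
        ultimately show "eventually (\<lambda>n. ereal (Y n / b n) \<le> ereal (1 + 2 / real (Suc k))) sequentially"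
          using bpos
        proof eventually_elim
          case (elim n)
          have "Y n / b n = S n / b n + (Y n - S n) / b n" by (simp add: diff_divide_distrib)
          also have "\<dots> \<le> (1 + 1 / real (Suc k)) * L n / b n + (Y n - S n) / b n"
            using elim by (intro add_right_mono divide_right_mono) auto
          finally show ?case using elim(1) by simp
        qed
      qed
      have lower: "ereal (1 - 2 / real (Suc k)) \<le> limsup (\<lambda>n. ereal (Y n / b n))" for k
      proof (rule ccontr)
        assume "\<not> ?thesis"
        then have "limsup (\<lambda>n. ereal (Y n / b n)) < ereal (1 - 2 / real (Suc k))" by simp
        then have "eventually (\<lambda>n. Y n / b n < 1 - 2 / real (Suc k)) sequentially"
          by (auto dest!: Limsup_lessD)
        moreover have "eventually (\<lambda>n. 1 - 2 / real (Suc k) < (1 - 1 / real (Suc k)) * (L n / b n) + (Y n - S n) / b n) sequentially"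
          by (rule order_tendstoD(1)[OF lim]) (simp add: divide_strict_right_mono)
        ultimately have "eventually (\<lambda>n. \<not> (1 - 1 / real (Suc k)) * L n \<le> S n) sequentially"
          using bpos
        proof eventually_elim
          case (elim n)
          have "Y n / b n = S n / b n + (Y n - S n) / b n" by (simp add: diff_divide_distrib)
          with elim have "S n / b n < (1 - 1 / real (Suc k)) * L n / b n" by simp
          then show ?case using elim(3) by (simp add: divide_less_cancel not_le)
        qed
        with elim(2) show False by (auto simp: frequently_def S_def L_def)
      qed
      have "(\<lambda>k. ereal (1 + 2 / real (Suc k))) \<longlonglongrightarrow> ereal 1" "(\<lambda>k. ereal (1 - 2 / real (Suc k))) \<longlonglongrightarrow> ereal 1"
        by (intro tendsto_ereal; real_asymp)+
      then have "limsup (\<lambda>n. ereal (Y n / b n)) \<le> 1" "1 \<le> limsup (\<lambda>n. ereal (Y n / b n))"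
        using upper lower
        by (auto intro: LIMSEQ_le_const LIMSEQ_le_const2 simp: one_ereal_def)
      then show "limsup (\<lambda>n. ereal (Y n / b n)) = 1" by (rule antisym)
    qed
  qed
qed
end

section \<open>The random sequence\<close>

lemma indep_vars_PiM_components:
  assumes M: "\<And>i. i \<in> I \<Longrightarrow> prob_space (M i)" and I: "I \<noteq> {}"
  shows "prob_space.indep_vars (Pi\<^sub>M I M) M (\<lambda>i \<omega>. \<omega> i) I"
proof -
  interpret prob_space "Pi\<^sub>M I M" by (rule prob_space_PiM[OF M])
  have "distr (Pi\<^sub>M I M) (Pi\<^sub>M I M) (\<lambda>x. \<lambda>i\<in>I. x i) = distr (Pi\<^sub>M I M) (Pi\<^sub>M I M) (\<lambda>x. x)"
    by (rule distr_cong) (auto simp: space_PiM PiE_restrict)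
  also have "\<dots> = Pi\<^sub>M I M" by (rule distr_id)
  also have "\<dots> = Pi\<^sub>M I (\<lambda>i. distr (Pi\<^sub>M I M) (M i) (\<lambda>x. x i))"
    by (rule PiM_cong) (simp_all, rule distr_PiM_component[OF M, symmetric])
  finally show ?thesis
    by (subst indep_vars_iff_distr_eq_PiM'[OF I]) simp_all
qed

text \<open>The moment generating function of a block is the product of those of its summands. The
  errors 7 / k^2 are summable, so C = exp K with K their total works for all blocks. Index i belongs
  to dimension i + 1.\<close>

lemma gaussian_mgf_sum_trunc_log:
  assumes \<alpha>: "cmod \<alpha> = 1"
  obtains C where "gaussian_mgf_sum (Pi\<^sub>M {1..} sphere_measure) (\<lambda>i c. trunc_log \<alpha> (c (Suc i) 0))
    (\<lambda>n. harm n / 2) (1 + pi) C"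
proof -
  let ?Q = "Pi\<^sub>M {1..} sphere_measure"
  let ?X = "\<lambda>i c. trunc_log \<alpha> (c (Suc i) 0)"
  have prob: "prob_space (sphere_measure k)" if "k \<in> {1..}" for k
    using that by (intro prob_space_sphere_measure) simp
  interpret Q: prob_space ?Q by (rule prob_space_PiM[OF prob])
  have coord: "(\<lambda>x. trunc_log \<alpha> (x 0)) \<in> borel_measurable (sphere_measure (Suc i))" for i
    by (intro measurable_compose[OF measurable_coord(2) measurable_trunc_log]) simp
  have X: "?X i \<in> borel_measurable ?Q" for i
    by (rule measurable_compose[where f = "\<lambda>c. c (Suc i)", OF _ coord[of i]])
      (intro measurable_component_singleton, simp)
  \<comment> \<open>Singleton blocks shift the index set from dimensions k \<ge> 1 to all natural
    numbers.\<close>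
  have "Q.indep_vars (\<lambda>j. Pi\<^sub>M {Suc j} sphere_measure) (\<lambda>j c. restrict (\<lambda>i. c i) {Suc j}) UNIV"
    using indep_vars_PiM_components[of "{1..}" sphere_measure, OF prob]
    by (intro Q.indep_vars_restrict) (auto simp: disjoint_family_on_def)
  then have "Q.indep_vars (\<lambda>_. borel) (\<lambda>j c. (\<lambda>y. trunc_log \<alpha> (y (Suc j) 0)) (restrict (\<lambda>i. c i) {Suc j})) UNIV"
  proof (rule Q.indep_vars_compose2)
    show "(\<lambda>y. trunc_log \<alpha> (y (Suc j) 0)) \<in> borel_measurable (Pi\<^sub>M {Suc j} sphere_measure)" for j
      by (rule measurable_compose[where f = "\<lambda>c. c (Suc j)", OF _ coord[of j]])
        (intro measurable_component_singleton, simp)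
  qed
  then have indep: "Q.indep_vars (\<lambda>_. borel) ?X UNIV" by simp
  define e where "e t k = (\<integral>c. exp (t * trunc_log \<alpha> (c 0)) \<partial>sphere_measure k)" for t k
  have E_prod: "Q.expectation (\<lambda>c. exp (t * (\<Sum>i\<in>{m..<n}. ?X i c))) = (\<Prod>i\<in>{m..<n}. e t (Suc i))" for t m n
  proof -
    have expX: "Q.indep_vars (\<lambda>_. borel) (\<lambda>i c. exp (t * ?X i c)) {m..<n}"
      by (rule Q.indep_vars_compose2[OF Q.indep_vars_subset[OF indep subset_UNIV]]) measurable
    have "Q.expectation (\<lambda>c. exp (t * (\<Sum>i\<in>{m..<n}. ?X i c))) = Q.expectation (\<lambda>c. \<Prod>i\<in>{m..<n}. exp (t * ?X i c))"
      by (simp add: sum_distrib_left exp_sum)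
    also have "\<dots> = (\<Prod>i\<in>{m..<n}. Q.expectation (\<lambda>c. exp (t * ?X i c)))"
    proof (rule Q.indep_vars_lebesgue_integral[OF _ expX])
      show "integrable ?Q (\<lambda>c. exp (t * ?X i c))" for i
      proof (rule Q.integrable_const_bound[of _ "exp (\<bar>t\<bar> * (1 + pi))"])
        have "t * ?X i c \<le> \<bar>t\<bar> * (1 + pi)" for c
        proof -
          have "t * ?X i c \<le> \<bar>t * ?X i c\<bar>" by simp
          also have "\<dots> \<le> \<bar>t\<bar> * (1 + pi)"
            unfolding abs_mult using trunc_log_bound[OF \<alpha>] by (intro mult_left_mono) auto
          finally show ?thesis .
        qed
        then show "AE c in ?Q. norm (exp (t * ?X i c)) \<le> exp (\<bar>t\<bar> * (1 + pi))"
          by (intro AE_I2) simp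
      qed (use X[of i] in measurable)
    qed simp
    also have "\<dots> = (\<Prod>i\<in>{m..<n}. e t (Suc i))"
    proof (rule prod.cong)
      fix i
      have "e t (Suc i) = (\<integral>c. exp (t * trunc_log \<alpha> (c 0)) \<partial>distr ?Q (sphere_measure (Suc i)) (\<lambda>c. c (Suc i)))"
        unfolding e_def by (subst distr_PiM_component[OF prob]) auto
      also have "\<dots> = Q.expectation (\<lambda>c. exp (t * ?X i c))"
      proof (rule integral_distr)
        show "(\<lambda>x. exp (t * trunc_log \<alpha> (x 0))) \<in> borel_measurable (sphere_measure (Suc i))"
          using coord[of i] by measurable
      qed simp
      finally show "Q.expectation (\<lambda>c. exp (t * ?X i c)) = e t (Suc i)" ..
    qed simp
    finally show ?thesis .
  qed
  define K where "K = (\<Sum>n. 7 / (real (Suc n))\<^sup>2)"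
  have K_sum: "summable (\<lambda>n. 7 / (real (Suc n))\<^sup>2)"
    using summable_mult[OF inverse_power_summable[of 2, where 'a = real], of 7]
    by (subst summable_Suc_iff) (simp add: divide_inverse)
  have K: "(\<Sum>i\<in>{m..<n}. 7 / (real (Suc i))\<^sup>2) \<le> K" for m n
    unfolding K_def by (intro sum_le_suminf K_sum) auto
  have K0: "0 \<le> K" using K[of 0 0] by simp
  have harm: "t\<^sup>2 * (harm n / 2 - harm m / 2) / 2 = (\<Sum>i\<in>{m..<n}. t\<^sup>2 / 4 * (1 / real (Suc i)))" if "m \<le> n" for t :: real and m n
  proof -
    have "(harm n :: real) = harm m + (\<Sum>i\<in>{m..<n}. 1 / real (Suc i))"
      using that by (induction n rule: dec_induct) (auto simp: harm_Suc inverse_eq_divide)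
    then have "t\<^sup>2 * (harm n / 2 - harm m / 2) / 2 = t\<^sup>2 / 4 * (\<Sum>i\<in>{m..<n}. 1 / real (Suc i))"
      by (simp add: field_simps)
    then show ?thesis by (simp only: sum_distrib_left)
  qed
  have "gaussian_mgf_sum ?Q ?X (\<lambda>n. harm n / 2) (1 + pi) (exp K)"
  proof
    show "Q.indep_vars (\<lambda>_. borel) ?X UNIV" by (rule indep)
    show "\<bar>?X i c\<bar> \<le> 1 + pi" for i c by (rule trunc_log_bound[OF \<alpha>])
    show "1 \<le> exp K" using K0 by simp
    show "harm 0 / 2 = (0 :: real)" by (simp add: harm_def)
    show "mono (\<lambda>n. harm n / 2 :: real)" by (intro incseq_SucI) (simp add: harm_Suc)
    show "filterlim (\<lambda>n. harm n / 2 :: real) at_top sequentially"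
    proof (rule filterlim_at_top_mono)
      show "filterlim (\<lambda>n. ln (real n + 1) / 2) at_top sequentially" by real_asymp
      show "\<forall>\<^sub>F n in sequentially. ln (real n + 1) / 2 \<le> harm n / 2"
        by (intro always_eventually allI divide_right_mono ln_le_harm) simp
    qed
    show "harm (Suc n) / 2 \<le> harm n / 2 + (1 :: real)" for n
      by (simp add: harm_Suc field_simps)
    fix t :: real and m n :: nat assume t: "\<bar>t\<bar> \<le> 1" and mn: "m \<le> n"
    have e: "exp (t\<^sup>2 / 4 * (1 / real (Suc i)) - 7 / (real (Suc i))\<^sup>2) \<le> e t (Suc i)"
      "e t (Suc i) \<le> exp (t\<^sup>2 / 4 * (1 / real (Suc i)) + 7 / (real (Suc i))\<^sup>2)" for i
      unfolding e_def using exp_trunc_log_bounds[of "Suc i" \<alpha> t, OF _ \<alpha> t] by (simp_all del: of_nat_Suc)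
    have "(\<Prod>i\<in>{m..<n}. e t (Suc i)) \<le> (\<Prod>i\<in>{m..<n}. exp (t\<^sup>2 / 4 * (1 / real (Suc i)) + 7 / (real (Suc i))\<^sup>2))"
      using e order.trans[OF exp_ge_zero e(1)] by (intro prod_mono) auto
    also have "\<dots> = exp (t\<^sup>2 * (harm n / 2 - harm m / 2) / 2 + (\<Sum>i\<in>{m..<n}. 7 / (real (Suc i))\<^sup>2))"
      unfolding harm[OF mn] by (simp add: exp_sum[symmetric] sum.distrib)
    also have "\<dots> \<le> exp (t\<^sup>2 * (harm n / 2 - harm m / 2) / 2 + K)" using K[of m n] by simp
    finally show "Q.expectation (\<lambda>c. exp (t * (\<Sum>i\<in>{m..<n}. ?X i c))) \<le> exp K * exp (t\<^sup>2 * (harm n / 2 - harm m / 2) / 2)"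
      unfolding E_prod by (simp add: exp_add mult.commute)
    have "exp (t\<^sup>2 * (harm n / 2 - harm m / 2) / 2 - K) \<le>
        exp (t\<^sup>2 * (harm n / 2 - harm m / 2) / 2 - (\<Sum>i\<in>{m..<n}. 7 / (real (Suc i))\<^sup>2))" using K[of m n] by simp
    also have "\<dots> = (\<Prod>i\<in>{m..<n}. exp (t\<^sup>2 / 4 * (1 / real (Suc i)) - 7 / (real (Suc i))\<^sup>2))"
      unfolding harm[OF mn] by (simp add: exp_sum[symmetric] sum_subtractf)
    also have "\<dots> \<le> (\<Prod>i\<in>{m..<n}. e t (Suc i))" using e(1) by (intro prod_mono) auto
    finally show "exp (t\<^sup>2 * (harm n / 2 - harm m / 2) / 2) / exp K \<le> Q.expectation (\<lambda>c. exp (t * (\<Sum>i\<in>{m..<n}. ?X i c)))"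
      unfolding E_prod by (simp add: exp_diff)
  qed
  then show ?thesis by (rule that)
qed

section \<open>Normalization, truncation and conclusion\<close>

text \<open>At variance \<open>harm n / 2\<close> the factor 2 in \<open>lil_norm\<close> cancels,
  and the double logarithm of a quantity of order ln n becomes a triple one. Eventually
  \<open>harm n\<close> lies between ln n and ln n + 2, since Euler's constant is below 2, and
  monotonicity of \<open>lil_norm\<close> gives a sandwich of elementary functions.\<close>

lemma lil_norm_harm_asymp:
  "(\<lambda>n. sqrt (ln (real n) * ln (ln (ln (real n)))) / lil_norm (harm n / 2)) \<longlonglongrightarrow> 1"
proof -
  define b where "b n = sqrt (ln (real n) * ln (ln (ln (real n))))" for n :: nat
  have le: "eventually (\<lambda>n. harm n \<le> ln (real n) + 2) sequentially"
  proof -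
    have "euler_mascheroni < (2 :: real)" using euler_mascheroni_less_13_over_22 by simp
    from order_tendstoD(2)[OF euler_mascheroni_LIMSEQ this] show ?thesis by eventually_elim simp
  qed
  have ge: "eventually (\<lambda>n. ln (real n) \<le> harm n) sequentially"
    using eventually_gt_at_top[of 0]
  proof eventually_elim
    case (elim n)
    have "ln (real n) \<le> ln (real n + 1)" using elim by simp
    then show ?case using ln_le_harm[of n] by linarith
  qed
  have "eventually (\<lambda>n. exp 1 \<le> ln (real n) / 2) sequentially" by real_asymp
  moreover have "eventually (\<lambda>n. 0 \<le> ln (real n) * ln (ln (ln (real n)))) sequentially" by real_asymp
  moreover have "eventually (\<lambda>n. 0 < lil_norm (ln (real n) / 2)) sequentially"
    unfolding lil_norm_def by real_asymp
  ultimately have "eventually (\<lambda>n. b n / lil_norm ((ln (real n) + 2) / 2) \<le> b n / lil_norm (harm n / 2) \<and>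
      b n / lil_norm (harm n / 2) \<le> b n / lil_norm (ln (real n) / 2)) sequentially"
    using le ge
  proof eventually_elim
    case (elim n)
    have 1: "lil_norm (ln (real n) / 2) \<le> lil_norm (harm n / 2)"
      using elim by (intro lil_norm_mono) auto
    have 2: "lil_norm (harm n / 2) \<le> lil_norm ((ln (real n) + 2) / 2)"
      using elim by (intro lil_norm_mono) auto
    have "0 \<le> b n" using elim by (simp add: b_def)
    then show ?case using elim(3) 1 2 by (intro conjI divide_left_mono mult_pos_pos) linarith+
  qed
  then have ev: "eventually (\<lambda>n. b n / lil_norm ((ln (real n) + 2) / 2) \<le> b n / lil_norm (harm n / 2)) sequentially"
    "eventually (\<lambda>n. b n / lil_norm (harm n / 2) \<le> b n / lil_norm (ln (real n) / 2)) sequentially"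
    by (auto elim: eventually_mono)
  have "(\<lambda>n. b n / lil_norm (harm n / 2)) \<longlonglongrightarrow> 1"
  proof (rule tendsto_sandwich[OF ev])
    show "(\<lambda>n. b n / lil_norm ((ln (real n) + 2) / 2)) \<longlonglongrightarrow> 1"
      unfolding b_def lil_norm_def by real_asymp
    show "(\<lambda>n. b n / lil_norm (ln (real n) / 2)) \<longlonglongrightarrow> 1"
      unfolding b_def lil_norm_def by real_asymp
  qed
  then show ?thesis by (simp add: b_def)
qed

lemma AE_eventually_coord_le_half:
  "AE c in Pi\<^sub>M {1..} sphere_measure. \<forall>\<^sub>F i in sequentially. cmod (c (Suc i) 0) \<le> 1 / 2"
proof -
  let ?Q = "Pi\<^sub>M {1..} sphere_measure"
  have prob: "prob_space (sphere_measure k)" if "k \<in> {1..}" for k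
    using that by (intro prob_space_sphere_measure) simp
  interpret Q: prob_space ?Q by (rule prob_space_PiM[OF prob])
  define A where "A i = {c \<in> space ?Q. 1 / 2 < cmod (c (Suc i) 0)}" for i
  have comp: "(\<lambda>c. c (Suc i)) \<in> ?Q \<rightarrow>\<^sub>M sphere_measure (Suc i)" for i
    by (intro measurable_component_singleton) simp
  have coord [measurable]: "(\<lambda>c. c 0) \<in> borel_measurable (sphere_measure (Suc i))" for i
    by (rule measurable_coord(2)) simp
  have [measurable]: "(\<lambda>c. c (Suc i) 0) \<in> borel_measurable ?Q" for i
    by (rule measurable_compose[where f = "\<lambda>c. c (Suc i)", OF comp coord])
  have A [measurable]: "A i \<in> sets ?Q" for i unfolding A_def by measurable
  \<comment> \<open>The tail bound needs dimension at least 2; in dimension 1 the coordinate has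
    modulus 1.\<close>
  have bound: "Q.prob (A i) \<le> 96 * (1 / (real (Suc i))\<^sup>2)" if "1 \<le> i" for i
  proof -
    have "Q.prob (A i) = measure (distr ?Q (sphere_measure (Suc i)) (\<lambda>c. c (Suc i)))
        {c \<in> space (sphere_measure (Suc i)). 1 / 2 < cmod (c 0)}"
    proof -
      have "(\<lambda>c. c (Suc i)) -` {c \<in> space (sphere_measure (Suc i)). 1 / 2 < cmod (c 0)} \<inter> space ?Q = A i"
        using measurable_space[OF comp[of i]] by (auto simp only: A_def)
      then show ?thesis by (subst measure_distr[OF comp]) simp_all
    qed
    also have "\<dots> = measure (sphere_measure (Suc i)) {c \<in> space (sphere_measure (Suc i)). 1 / 2 < cmod (c 0)}"
      by (subst distr_PiM_component[OF prob]) auto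
    also have "\<dots> \<le> 96 / (real (Suc i))\<^sup>2" using that by (intro prob_coord_gt_half) simp
    finally show ?thesis by simp
  qed
  have bound_summable: "summable (\<lambda>i. 96 * (1 / (real (Suc i))\<^sup>2))"
    using summable_mult[OF inverse_power_summable[of 2, where 'a = real], of 96]
    by (subst summable_Suc_iff) (simp add: divide_inverse)
  have "summable (\<lambda>i. Q.prob (A i))"
  proof (rule summable_comparison_test'[OF bound_summable])
    show "norm (Q.prob (A i)) \<le> 96 * (1 / (real (Suc i))\<^sup>2)" if "1 \<le> i" for i
      using bound[OF that] unfolding real_norm_def abs_of_nonneg[OF measure_nonneg] .
  qed
  then have "AE c in ?Q. \<forall>\<^sub>F i in sequentially. c \<in> space ?Q - A i"
    by (intro borel_cantelli_AE1 A) (simp_all only: Q.emeasure_eq_measure ennreal_less_top infinity_ennreal_def)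
  then show ?thesis
    by (rule AE_mp) (auto intro!: AE_I2 elim!: eventually_mono simp: A_def not_less)
qed

lemma AE_limsup_Re_log_Z:
  assumes \<alpha>: "cmod \<alpha> = 1"
  shows "AE c in Pi\<^sub>M {1..} sphere_measure.
    limsup (\<lambda>N. ereal (Re (\<alpha> * log_Z (V_mat c N)) / sqrt (ln (real N) * ln (ln (ln (real N)))))) = 1"
proof -
  let ?Q = "Pi\<^sub>M {1..} sphere_measure"
  have prob: "prob_space (sphere_measure k)" if "k \<in> {1..}" for k
    using that by (intro prob_space_sphere_measure) simp
  obtain C where "gaussian_mgf_sum ?Q (\<lambda>i c. trunc_log \<alpha> (c (Suc i) 0)) (\<lambda>n. harm n / 2) (1 + pi) C"
    using gaussian_mgf_sum_trunc_log[OF \<alpha>] by blast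
  then interpret gaussian_mgf_sum ?Q "\<lambda>i c. trunc_log \<alpha> (c (Suc i) 0)" "\<lambda>n. harm n / 2" "1 + pi" C .
  have "AE c in ?Q. \<forall>k. 1 \<le> k \<longrightarrow> c k 0 \<noteq> 1"
    unfolding AE_all_countable
  proof
    fix k
    show "AE c in ?Q. 1 \<le> k \<longrightarrow> c k 0 \<noteq> 1"
    proof (cases "1 \<le> k")
      case True
      then have "AE c in ?Q. c k 0 \<noteq> 1"
        by (intro AE_PiM_component[where P = "\<lambda>x. x 0 \<noteq> 1", OF prob]) (auto intro: AE_sphere_measure_coord_ne_1)
      then show ?thesis by (rule AE_mp) (auto intro: AE_I2)
    qed simp
  qed
  moreover note AE_limsup_eq_1[OF lil_norm_harm_asymp] AE_eventually_coord_le_half AE_space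
  ultimately show ?thesis
  proof eventually_elim
    case (elim c)
    have sphere: "c k \<in> sphere_cplx k" if "k \<ge> 1" for k
      using elim(4) that by (auto simp: space_PiM space_sphere_measure)
    define f where "f i = Re (\<alpha> * Ln (1 - c (Suc i) 0)) - trunc_log \<alpha> (c (Suc i) 0)" for i
    have log_Z: "Re (\<alpha> * log_Z (V_mat c n)) - (\<Sum>i<n. trunc_log \<alpha> (c (Suc i) 0)) = (\<Sum>i<n. f i)" for n
    proof -
      have "log_Z (V_mat c n) = (\<Sum>k=1..n. Ln (1 - c k 0))"
        using elim(1) by (intro log_Z_V_mat sphere) auto
      also have "\<dots> = (\<Sum>i<n. Ln (1 - c (Suc i) 0))" by (simp add: sum.atLeast1_atMost_eq)
      finally show ?thesis by (simp add: f_def sum_subtractf sum_distrib_left)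
    qed
    obtain n0 where "\<And>i. i \<ge> n0 \<Longrightarrow> cmod (c (Suc i) 0) \<le> 1 / 2"
      using elim(3) unfolding eventually_sequentially by blast
    then have n0: "f i = 0" if "i \<ge> n0" for i
      using that by (simp add: f_def trunc_log_def)
    \<comment> \<open>The discrepancies f i vanish from n0 on, so their partial sums are eventually
      constant and provide the bound K for this c.\<close>
    have "\<forall>\<^sub>F n in sequentially. \<bar>Re (\<alpha> * log_Z (V_mat c n)) - (\<Sum>i<n. trunc_log \<alpha> (c (Suc i) 0))\<bar> \<le> \<bar>\<Sum>i<n0. f i\<bar>"
      using eventually_ge_at_top[of n0]
    proof eventually_elim
      case (elim n)
      have "(\<Sum>i<n. f i) = (\<Sum>i<n0. f i)"
        using elim n0 by (intro sum.mono_neutral_right) auto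
      then show ?case by (simp only: log_Z)
    qed
    then show ?case by (rule elim(2)[THEN spec, THEN spec, THEN mp])
  qed
qed

theorem proposition5p4:
  fixes P :: "'a measure" and m :: "'a \<Rightarrow> nat \<Rightarrow> nat \<Rightarrow> complex"
  assumes "prob_space P"
    and "m \<in> P \<rightarrow>\<^sub>M Pi\<^sub>M {1..} sphere_measure"
    and "distr P (Pi\<^sub>M {1..} sphere_measure) m = Pi\<^sub>M {1..} sphere_measure"
  shows "AE \<omega> in P.
      limsup (\<lambda>N. ereal (Re (log_Z (V_mat (m \<omega>) N)) /
        sqrt (ln (real N) * ln (ln (ln (real N)))))) = 1 \<and>
      limsup (\<lambda>N. ereal (Im (log_Z (V_mat (m \<omega>) N)) /
        sqrt (ln (real N) * ln (ln (ln (real N)))))) = 1"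
proof -
  \<comment> \<open>The imaginary part is the case \<alpha> = -i, as Re (-i w) = Im w.\<close>
  have "AE c in Pi\<^sub>M {1..} sphere_measure.
      limsup (\<lambda>N. ereal (Re (log_Z (V_mat c N)) / sqrt (ln (real N) * ln (ln (ln (real N)))))) = 1 \<and>
      limsup (\<lambda>N. ereal (Im (log_Z (V_mat c N)) / sqrt (ln (real N) * ln (ln (ln (real N)))))) = 1"
    using AE_limsup_Re_log_Z[of 1] AE_limsup_Re_log_Z[of "- \<i>"] by simp
  then show ?thesis
    by (intro AE_distrD[OF assms(2)]) (simp only: assms(3))
qed

end
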